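(* (i) Let $n\in\{1,\dots,\nu-r\}$ and $j\in\{0,1,2,\dots\}$, and let the band function $E_{n,j}(\vartheta)$, $\vartheta\in\mathbb T^d$, of the metric Laplacian $\Delta_M$ have a minimum (respectively, maximum) at some point $\vartheta_0\in\mathbb T^d$. Assume that $E_{n,j}(\vartheta_0)\ne(\pi k)^2$ for all $k\in\mathbb Z$ and that $E_{n,j}(\vartheta_0)$ is a simple eigenvalue of $\Delta_M(\vartheta_0)$. Then the effective form $\mu_{n,j}(\omega)=\frac12\frac{\partial^2}{\partial\varepsilon^2}E_{n,j}(\vartheta_0+\varepsilon\omega)\big|_{\varepsilon=0}$, $\omega\in\mathbb S^{d-1}$, of the metric Laplacian at $\vartheta_0$ satisfies $$\mu_{n,j}(\omega)=\frac{2\sqrt{E_{n,j}(\vartheta_0)}}{\sin\sqrt{E_{n,j}(\vartheta_0)}}\,\mu_n(\omega),\qquad \omega\in\mathbb S^{d-1},$$ where $\mu_n(\omega)=\frac12\frac{\partial^2}{\partial\varepsilon^2}\lambda_n(\vartheta_0+\varepsilon\omega)\big|_{\varepsilon=0}$ is the effective form for the discrete Laplacian $\Delta$ at $\vartheta_0$. (ii) The effective form $\mu_{1,0}(\omega)=\frac12\frac{\partial^2}{\partial\varepsilon^2}E_{1,0}(\varepsilon\omega)\big|_{\varepsilon=0}$ at the beginning of the spectrum of $\Delta_M$ is non-degenerate and satisfies, for every $\omega\in\mathbb S^{d-1}$, $$0<\frac{2\Lambda_0}{\varkappa\,\nu\,d}\le\mu_{1,0}(\omega)=2\mu(\omega)\le\frac2\varkappa\sum_{\mathbf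 e\in\mathcal B_*}\langle\tau(\mathbf e),\omega\rangle^2\le\frac{2\Lambda_1}{\varkappa},\qquad\varkappa=\sum_{v\in V_*}\varkappa_v,$$ where $\mu(\omega)=\frac12\frac{\partial^2}{\partial\varepsilon^2}\lambda_1(\varepsilon\omega)\big|_{\varepsilon=0}$ is the effective form at the beginning of the spectrum of the discrete Laplacian.
   Context: Graph. Let $d\ge2$ and let $\Gamma=(V,\mathcal E)$ be a connected infinite graph, possibly with loops and multiple edges, with vertex set $V$ and set $\mathcal E$ of unoriented edges. The degree $\varkappa_v$ of a vertex is the number of edges incident to it, a loop being counted twice. $\Gamma$ is $\mathbb Z^d$-periodic: it is equipped with an action of $\mathbb Z^d$ by graph automorphisms, written $v\mapsto v+m$, free on vertices; all degrees are finite; and the quotient (fundamental) graph $\Gamma_*=\Gamma/\mathbb Z^d=(V_*,\mathcal E_* )$ is finite. Put $\nu=\#V_*$. The degree of a vertex of $\Gamma_*$ equals that of any of its representatives in $V$. Oriented edges and indices. Each unoriented edge with endpoints $u,v$ yields two oriented edges $(u,v)$ and $(v,u)$ (also for loops); $\mathcal A$ and $\mathcal A_*$ denote the sets of oriented edges of $\Gamma$ and $\Gamma_*$. A fundamental vertex set $V_0\subset V$ is a set of $\nu$ pairwise non-$\mathbb Z^d$-equivalent vertices. Each $v\in V$ is uniquely $v=v_0+[v]$ with $v_0\in V_0$, $[v]\in\mathbb Z^d$. The index of $\mathbf e=(u,v)\in\mathcal A$ is $\tau(\mathbf e)=[v]-[u]\in\mathbb Z^d$; it is $\mathbb Z^d$-invariant,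 so it defines the index $\tau(\mathbf e_* )$ of each $\mathbf e_*\in\mathcal A_*$. Choice of $V_0$. $V_0$ is the vertex set $V_T$ of a subgraph $T=(V_T,\mathcal E_T)$ of $\Gamma$ that is a tree and whose vertex set is a fundamental vertex set (such $T$ exists). Then $T_*=T/\mathbb Z^d$ is a spanning tree of $\Gamma_*$ all of whose edges have zero index. Bridges. Orient each edge of $\mathcal E_*$ in an arbitrary way; indices of edges of $\mathcal E_*$ refer to this orientation. $\mathcal B_*\subset\mathcal E_*$ is the set of bridges, i.e. edges with nonzero index; $\nu_1=\#\mathcal B_*$. Since $\Gamma$ is connected, there exist bridges $\mathbf e_1,\dots,\mathbf e_d\in\mathcal B_*$ with linearly independent indices; fix such bridges and write $\mathcal B_*=\{\mathbf e_1,\dots,\mathbf e_{\nu_1}\}$. Let $\mathcal T_0$ be the $d\times d$ matrix with rows $\tau(\mathbf e_1),\dots,\tau(\mathbf e_d)$ and $\mathcal T_1$ the $\nu_1\times d$ matrix with rows $\tau(\mathbf e_1),\dots,\tau(\mathbf e_{\nu_1})$. $\Lambda_0>0$ is the smallest eigenvalue of $\mathcal T_0^*\mathcal T_0$, $\Lambda_1$ the largest eigenvalue of $\mathcal T_1^*\mathcal T_1$. Discrete Laplacian. On $\ell^2(V)$, $(\Delta f)(v)=\frac1{\sqrt{\varkappa_v}}\sum_{(v,u)_e\in\mathcal E}\Big(\frac{f(v)}{\sqrt{\varkappa_v}}-\frac{f(u)}{\sqrt{\varkappa_u}}\Big)$, loops counted twice. It decomposes into a direct integral over $\mathbb T^d=\mathbb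 R^d/(2\pi\mathbb Z)^d$ with fibers the $\nu\times\nu$ Hermitian Floquet matrices $\Delta(\vartheta)$, $$\Delta_{uv}(\vartheta)=\delta_{uv}-\frac1{\sqrt{\varkappa_u\varkappa_v}}\sum_{\mathbf e=(u,v)\in\mathcal A_*}e^{i\langle\tau(\mathbf e),\vartheta\rangle},\qquad u,v\in V_*$$ (empty sum $=0$). If $\Delta$ has $r\ge0$ flat bands, i.e. eigenvalues of $\Delta(\vartheta)$ constant in $\vartheta$ (counted with multiplicity), they are denoted $\lambda_j$, $\nu-r<j\le\nu$; the remaining eigenvalues are enumerated, with multiplicity, as $\lambda_1(\vartheta)\le\dots\le\lambda_{\nu-r}(\vartheta)$. All $\lambda_n(\vartheta)\in[0,2]$. One has $\lambda_1(0)=0$, the beginning of the spectrum of $\Delta$, and it is a simple eigenvalue of $\Delta(0)$. Metric Laplacian. Identify each edge of $\Gamma$ (with a $\mathbb Z^d$-invariant orientation) with $[0,1]$, with local coordinate $t$ running from the initial to the terminal vertex. The metric Laplacian $\Delta_M$ on $L^2(\Gamma)=\bigoplus_{\mathbf e\in\mathcal E}L^2(0,1)$ acts by $(\Delta_My)_{\mathbf e}=-y_{\mathbf e}''$ on functions with $(y_{\mathbf e}'')\in L^2(\Gamma)$ that are continuous on $\Gamma$ and satisfy the Kirchhoff condition that at each vertex $v$ the sum of the outgoing derivatives along all edge-ends at $v$ ($y_{\mathbf e}'(0)$ if $v$ is the initial vertex of $\mathbf e$, $-y_{\mathbf e}'(1)$ if $v$ is the terminal vertex) is zero. It decomposes into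 a direct integral over $\mathbb T^d$ with fibers the Floquet operators $\Delta_M(\vartheta)$ (up to unitary equivalence: the operator $-y_{\mathbf e}''$ on functions $y$ on $\Gamma$ that are continuous, satisfy the Kirchhoff conditions and are quasi-periodic, $y(x+m)=e^{i\langle m,\vartheta\rangle}y(x)$, $m\in\mathbb Z^d$, considered in $L^2$ over one representative of each $\mathbb Z^d$-orbit of edges). Each $\Delta_M(\vartheta)$ has discrete spectrum consisting of $(\pi k)^2$, $k\in\mathbb N$, and of $$E_{n,j}(\vartheta)=z_{n,j}^2(\vartheta),\quad n=1,\dots,\nu,\ j=0,1,2,\dots,$$ $$z_{n,j}=z_n+\pi j\ (j\text{ even}),\qquad z_{n,j}=(\pi-z_n)+\pi j\ (j\text{ odd}),\qquad z_n(\vartheta)=\arccos(1-\lambda_n(\vartheta))\in[0,\pi].$$ The functions $E_{n,j}(\cdot)$ are the band functions of $\Delta_M$; the beginning of the spectrum of $\Delta_M$ is $E_{1,0}(0)=0$. $\langle\cdot,\cdot\rangle$ is the Euclidean inner product on $\mathbb R^d$ and $\mathbb S^{d-1}$ its unit sphere. *)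

theory Defs
  imports
    "HOL-Analysis.Analysis"
    "HOL-Library.Multiset"
    "HOL-Library.Function_Algebras"
    "Graph_Theory.Digraph_Component"
begin

section \<open>Periodic graphs\<close>

text \<open>
  A graph with loops and multiple edges is a \<^typ>\<open>('v, 'e) pre_digraph\<close> in which every unoriented
  edge is represented by exactly one arc; the direction of that arc is the chosen orientation of
  the edge. The action of \<open>int ^ 'd\<close> is required to preserve directions. This is no restriction:
  since the action is free on vertices, no element of it can reverse an edge, so every periodic
  graph has invariant orientations, and they correspond to the orientations of the edges of the
  quotient graph.
\<close>

record ('v, 'e, 'd) zd_graph =
  gph :: "('v, 'e) pre_digraph"
  vact :: "int ^ 'd \<Rightarrow> 'v \<Rightarrow> 'v"
  eact :: "int ^ 'd \<Rightarrow> 'e \<Rightarrow> 'e"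

definition vorbit :: "('v, 'e, 'd::finite) zd_graph \<Rightarrow> 'v \<Rightarrow> 'v set" where
  "vorbit P v = (\<lambda>m. vact P m v) ` UNIV"

definition eorbit :: "('v, 'e, 'd::finite) zd_graph \<Rightarrow> 'e \<Rightarrow> 'e set" where
  "eorbit P e = (\<lambda>m. eact P m e) ` UNIV"

definition quotient_graph :: "('v, 'e, 'd::finite) zd_graph \<Rightarrow> ('v set, 'e set) pre_digraph" where
  "quotient_graph P =
     \<lparr> verts = vorbit P ` verts (gph P),
       arcs = eorbit P ` arcs (gph P),
       tail = (\<lambda>x. vorbit P (tail (gph P) (SOME e. e \<in> x))),
       head = (\<lambda>x. vorbit P (head (gph P) (SOME e. e \<in> x))) \<rparr>"

locale periodic_graph =
  fixes P :: "('v, 'e, 'd::finite) zd_graph"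
  assumes dim_ge_2: "CARD('d) \<ge> 2"
    and wf: "wf_digraph (gph P)"
    and conn: "Digraph_Component.connected (gph P)"
    and inf: "infinite (verts (gph P))"
    and vact_closed: "v \<in> verts (gph P) \<Longrightarrow> vact P m v \<in> verts (gph P)"
    and vact_zero: "v \<in> verts (gph P) \<Longrightarrow> vact P 0 v = v"
    and vact_add: "v \<in> verts (gph P) \<Longrightarrow> vact P (m + n) v = vact P m (vact P n v)"
    and eact_closed: "e \<in> arcs (gph P) \<Longrightarrow> eact P m e \<in> arcs (gph P)"
    and eact_zero: "e \<in> arcs (gph P) \<Longrightarrow> eact P 0 e = e"
    and eact_add: "e \<in> arcs (gph P) \<Longrightarrow> eact P (m + n) e = eact P m (eact P n e)"
    and tail_eact: "e \<in> arcs (gph P) \<Longrightarrow> tail (gph P) (eact P m e) = vact P m (tail (gph P) e)"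
    and head_eact: "e \<in> arcs (gph P) \<Longrightarrow> head (gph P) (eact P m e) = vact P m (head (gph P) e)"
    and free: "v \<in> verts (gph P) \<Longrightarrow> vact P m v = v \<Longrightarrow> m = 0"
    and finite_out: "v \<in> verts (gph P) \<Longrightarrow> finite (out_arcs (gph P) v)"
    and finite_in: "v \<in> verts (gph P) \<Longrightarrow> finite (in_arcs (gph P) v)"
    and finite_quotient_verts: "finite (verts (quotient_graph P))"
    and finite_quotient_arcs: "finite (arcs (quotient_graph P))"

text \<open>A loop is both an in-arc and an out-arc, hence counted twice.\<close>

definition degree :: "('a, 'b) pre_digraph \<Rightarrow> 'a \<Rightarrow> nat" where
  "degree G v = out_degree G v + in_degree G v"

definition nu :: "('v, 'e, 'd::finite) zd_graph \<Rightarrow> nat" where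
  "nu P = card (verts (quotient_graph P))"

definition kappa :: "('v, 'e, 'd::finite) zd_graph \<Rightarrow> nat" where
  "kappa P = (\<Sum>v\<in>verts (quotient_graph P). degree (quotient_graph P) v)"

text \<open>
  The digraph of oriented edges: each edge \<open>e\<close> (loops included) yields \<open>(e, True)\<close>, traversed
  along its orientation, and \<open>(e, False)\<close>, traversed against it.
\<close>

definition oriented :: "('a, 'b) pre_digraph \<Rightarrow> ('a, 'b \<times> bool) pre_digraph" where
  "oriented G =
     \<lparr> verts = verts G,
       arcs = arcs G \<times> UNIV,
       tail = (\<lambda>(e, b). if b then tail G e else head G e),
       head = (\<lambda>(e, b). if b then head G e else tail G e) \<rparr>"

text \<open>
  The library's \<^const>\<open>tree\<close> only forbids directed cycles. Here cycles may traverse edges in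
  either direction, but no edge twice; loops and pairs of parallel edges are cycles.
\<close>

definition undirected_tree :: "('a, 'b) pre_digraph \<Rightarrow> bool" where
  "undirected_tree G \<longleftrightarrow> Digraph_Component.connected G \<and>
     \<not> (\<exists>p. pre_digraph.cycle (oriented G) p \<and> distinct (map fst p))"

definition fundamental_tree :: "('v, 'e, 'd::finite) zd_graph \<Rightarrow> ('v, 'e) pre_digraph \<Rightarrow> bool" where
  "fundamental_tree P T \<longleftrightarrow> subgraph T (gph P) \<and> undirected_tree T \<and>
     card (verts T) = nu P \<and>
     (\<forall>u\<in>verts T. \<forall>v\<in>verts T. u \<noteq> v \<longrightarrow> v \<notin> vorbit P u)"


section \<open>Indices and bridges\<close>

text \<open>In the following, \<open>V0\<close> is the fundamental vertex set.\<close>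

definition cell :: "('v, 'e, 'd::finite) zd_graph \<Rightarrow> 'v set \<Rightarrow> 'v \<Rightarrow> int ^ 'd" where
  "cell P V0 v = (THE m. \<exists>v0\<in>V0. v = vact P m v0)"

definition edge_index :: "('v, 'e, 'd::finite) zd_graph \<Rightarrow> 'v set \<Rightarrow> 'e \<Rightarrow> int ^ 'd" where
  "edge_index P V0 e = cell P V0 (head (gph P) e) - cell P V0 (tail (gph P) e)"

definition real_vec :: "int ^ 'd \<Rightarrow> real ^ 'd::finite" where
  "real_vec m = (\<chi> i. real_of_int (m $ i))"

definition tau :: "('v, 'e, 'd::finite) zd_graph \<Rightarrow> 'v set \<Rightarrow> 'e set \<Rightarrow> real ^ 'd" where
  "tau P V0 x = real_vec (edge_index P V0 (SOME e. e \<in> x))"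

definition tau_oriented ::
    "('v, 'e, 'd::finite) zd_graph \<Rightarrow> 'v set \<Rightarrow> 'e set \<times> bool \<Rightarrow> real ^ 'd" where
  "tau_oriented P V0 = (\<lambda>(x, b). if b then tau P V0 x else - tau P V0 x)"

definition bridges :: "('v, 'e, 'd::finite) zd_graph \<Rightarrow> 'v set \<Rightarrow> 'e set set" where
  "bridges P V0 = {x \<in> arcs (quotient_graph P). tau P V0 x \<noteq> 0}"

definition bridge_basis ::
    "('v, 'e, 'd::finite) zd_graph \<Rightarrow> 'v set \<Rightarrow> ('d \<Rightarrow> 'e set) \<Rightarrow> bool" where
  "bridge_basis P V0 b \<longleftrightarrow> range b \<subseteq> bridges P V0 \<and>
     inj (\<lambda>i. tau P V0 (b i)) \<and> independent (range (\<lambda>i. tau P V0 (b i)))"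

definition eigenvalues :: "real ^ 'd ^ 'd \<Rightarrow> real set" where
  "eigenvalues A = {l. \<exists>x. x \<noteq> 0 \<and> A *v x = l *s x}"

definition T0 ::
    "('v, 'e, 'd::finite) zd_graph \<Rightarrow> 'v set \<Rightarrow> ('d \<Rightarrow> 'e set) \<Rightarrow> real ^ 'd ^ 'd" where
  "T0 P V0 b = (\<chi> i. tau P V0 (b i))"

definition Lambda0 ::
    "('v, 'e, 'd::finite) zd_graph \<Rightarrow> 'v set \<Rightarrow> ('d \<Rightarrow> 'e set) \<Rightarrow> real" where
  "Lambda0 P V0 b = Min (eigenvalues (transpose (T0 P V0 b) ** T0 P V0 b))"

text \<open>
  The matrix whose rows are the indices of all bridges has its rows indexed by the finite set of
  bridges, hence it is represented by its entry function, and the product with its transpose is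
  spelled out entrywise.
\<close>

definition T1 :: "('v, 'e, 'd::finite) zd_graph \<Rightarrow> 'v set \<Rightarrow> 'e set \<Rightarrow> 'd \<Rightarrow> real" where
  "T1 P V0 x k = tau P V0 x $ k"

definition T1_transpose_T1 :: "('v, 'e, 'd::finite) zd_graph \<Rightarrow> 'v set \<Rightarrow> real ^ 'd ^ 'd" where
  "T1_transpose_T1 P V0 = (\<chi> k l. \<Sum>x\<in>bridges P V0. T1 P V0 x k * T1 P V0 x l)"

definition Lambda1 :: "('v, 'e, 'd::finite) zd_graph \<Rightarrow> 'v set \<Rightarrow> real" where
  "Lambda1 P V0 = Max (eigenvalues (T1_transpose_T1 P V0))"


section \<open>Discrete Laplacian\<close>

global_interpretation cfun: vector_space "\<lambda>(c::complex) (f::'a \<Rightarrow> complex) x. c * f x"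
  by unfold_locales (auto simp: fun_eq_iff algebra_simps)

text \<open>
  Functions on the torus are represented by their \<open>2\<pi>\<close>-periodic lifts to \<open>real ^ 'd\<close>.
\<close>

definition floquet_matrix ::
    "('v, 'e, 'd::finite) zd_graph \<Rightarrow> 'v set \<Rightarrow> real ^ 'd \<Rightarrow> 'v set \<Rightarrow> 'v set \<Rightarrow> complex" where
  "floquet_matrix P V0 \<theta> u v =
     (if u = v then 1 else 0) -
     (\<Sum>a \<in> {a \<in> arcs (oriented (quotient_graph P)).
               tail (oriented (quotient_graph P)) a = u \<and>
               head (oriented (quotient_graph P)) a = v}.
        exp (\<i> * complex_of_real (tau_oriented P V0 a \<bullet> \<theta>)))
     / complex_of_real (sqrt (real (degree (quotient_graph P) u) *
                              real (degree (quotient_graph P) v)))"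

text \<open>Functions on the vertices of the quotient are extended by \<open>0\<close>.\<close>

definition discrete_eigenspace ::
    "('v, 'e, 'd::finite) zd_graph \<Rightarrow> 'v set \<Rightarrow> real ^ 'd \<Rightarrow> real \<Rightarrow> ('v set \<Rightarrow> complex) set" where
  "discrete_eigenspace P V0 \<theta> c =
     {f. (\<forall>u. u \<notin> verts (quotient_graph P) \<longrightarrow> f u = 0) \<and>
         (\<forall>u\<in>verts (quotient_graph P).
            (\<Sum>v\<in>verts (quotient_graph P). floquet_matrix P V0 \<theta> u v * f v)
            = complex_of_real c * f u)}"

definition discrete_mult ::
    "('v, 'e, 'd::finite) zd_graph \<Rightarrow> 'v set \<Rightarrow> real ^ 'd \<Rightarrow> real \<Rightarrow> nat" where
  "discrete_mult P V0 \<theta> c = cfun.dim (discrete_eigenspace P V0 \<theta> c)"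

text \<open>
  The number of flat bands with value \<open>c\<close> is the largest \<open>k\<close> such that \<open>c\<close> is an eigenvalue of
  multiplicity at least \<open>k\<close> for every quasimomentum; at exceptional quasimomenta non-constant
  bands may attain the value \<open>c\<close> in addition.
\<close>

definition flat_mult :: "('v, 'e, 'd::finite) zd_graph \<Rightarrow> 'v set \<Rightarrow> real \<Rightarrow> nat" where
  "flat_mult P V0 c = (INF \<theta>. discrete_mult P V0 \<theta> c)"

definition mset_of_mult :: "(real \<Rightarrow> nat) \<Rightarrow> real multiset" where
  "mset_of_mult m = (\<Sum>c\<in>{c. 0 < m c}. replicate_mset (m c) c)"

definition flat_count :: "('v, 'e, 'd::finite) zd_graph \<Rightarrow> 'v set \<Rightarrow> nat" where
  "flat_count P V0 = size (mset_of_mult (flat_mult P V0))"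

text \<open>Only meaningful for \<open>1 \<le> n \<le> nu P - flat_count P V0\<close>: the \<open>n\<close>-th non-flat eigenvalue.\<close>

definition band :: "('v, 'e, 'd::finite) zd_graph \<Rightarrow> 'v set \<Rightarrow> nat \<Rightarrow> real ^ 'd \<Rightarrow> real" where
  "band P V0 n \<theta> =
     sorted_list_of_multiset
       (mset_of_mult (discrete_mult P V0 \<theta>) - mset_of_mult (flat_mult P V0)) ! (n - 1)"


section \<open>Metric Laplacian\<close>

definition zband :: "('v, 'e, 'd::finite) zd_graph \<Rightarrow> 'v set \<Rightarrow> nat \<Rightarrow> nat \<Rightarrow> real ^ 'd \<Rightarrow> real" where
  "zband P V0 n j \<theta> =
     (let z = arccos (1 - band P V0 n \<theta>)
      in if even j then z + pi * real j else (pi - z) + pi * real j)"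

definition metric_band ::
    "('v, 'e, 'd::finite) zd_graph \<Rightarrow> 'v set \<Rightarrow> nat \<Rightarrow> nat \<Rightarrow> real ^ 'd \<Rightarrow> real" where
  "metric_band P V0 n j \<theta> = (zband P V0 n j \<theta>)\<^sup>2"

text \<open>
  \<open>f\<close> belongs to the Sobolev space of order two on the unit interval, with (continuous) first
  derivative \<open>p\<close> and square-integrable second derivative \<open>w\<close>.
\<close>

definition sobolev2 :: "(real \<Rightarrow> complex) \<Rightarrow> (real \<Rightarrow> complex) \<Rightarrow> (real \<Rightarrow> complex) \<Rightarrow> bool" where
  "sobolev2 f p w \<longleftrightarrow>
     w \<in> borel_measurable (lebesgue_on {0..1}) \<and>
     integrable (lebesgue_on {0..1}) (\<lambda>t. (cmod (w t))\<^sup>2) \<and>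
     (\<forall>t\<in>{0..1}. (f has_vector_derivative p t) (at t within {0..1})) \<and>
     (\<forall>t\<in>{0..1}. (w has_integral (p t - p 0)) {0..t})"

text \<open>
  The graph of the Floquet operator of the metric Laplacian: \<open>y\<close> lies in its domain and is mapped
  to \<open>g\<close>. A function on the metric graph is given by its values at \<open>(e, t)\<close>, where \<open>t\<close> is the
  coordinate on the edge \<open>e\<close>. As \<open>y\<close> is quasi-periodic, it is square-integrable over
  representatives of the edge orbits as soon as it is square-integrable over each edge. The image \<open>g\<close>
  is determined up to null sets.
\<close>

definition metric_floquet ::
    "('v, 'e, 'd::finite) zd_graph \<Rightarrow> real ^ 'd \<Rightarrow>
     ('e \<times> real \<Rightarrow> complex) \<Rightarrow> ('e \<times> real \<Rightarrow> complex) \<Rightarrow> bool" where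
  "metric_floquet P \<theta> y g \<longleftrightarrow>
     (\<exists>p. (\<forall>e\<in>arcs (gph P). sobolev2 (\<lambda>t. y (e, t)) (p e) (\<lambda>t. - g (e, t))) \<and>
          (\<exists>h. \<forall>e\<in>arcs (gph P). y (e, 0) = h (tail (gph P) e) \<and> y (e, 1) = h (head (gph P) e)) \<and>
          (\<forall>v\<in>verts (gph P).
             (\<Sum>e\<in>out_arcs (gph P) v. p e 0) + (\<Sum>e\<in>in_arcs (gph P) v. - p e 1) = 0) \<and>
          (\<forall>m. \<forall>e\<in>arcs (gph P). \<forall>t\<in>{0..1}.
             y (eact P m e, t) = exp (\<i> * complex_of_real (real_vec m \<bullet> \<theta>)) * y (e, t)))"

definition metric_eigenspace ::
    "('v, 'e, 'd::finite) zd_graph \<Rightarrow> real ^ 'd \<Rightarrow> real \<Rightarrow> ('e \<times> real \<Rightarrow> complex) set" where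
  "metric_eigenspace P \<theta> E =
     {y. (\<forall>e t. e \<notin> arcs (gph P) \<or> t \<notin> {0..1} \<longrightarrow> y (e, t) = 0) \<and>
         metric_floquet P \<theta> y (\<lambda>x. complex_of_real E * y x)}"

definition simple_metric_eigenvalue ::
    "('v, 'e, 'd::finite) zd_graph \<Rightarrow> real ^ 'd \<Rightarrow> real \<Rightarrow> bool" where
  "simple_metric_eigenvalue P \<theta> E \<longleftrightarrow> cfun.dim (metric_eigenspace P \<theta> E) = 1"


section \<open>Effective forms\<close>

definition local_min_at :: "('a::topological_space \<Rightarrow> real) \<Rightarrow> 'a \<Rightarrow> bool" where
  "local_min_at f x \<longleftrightarrow> (\<forall>\<^sub>F y in nhds x. f x \<le> f y)"

definition local_max_at :: "('a::topological_space \<Rightarrow> real) \<Rightarrow> 'a \<Rightarrow> bool" where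
  "local_max_at f x \<longleftrightarrow> (\<forall>\<^sub>F y in nhds x. f y \<le> f x)"

definition twice_differentiable_at :: "(real \<Rightarrow> real) \<Rightarrow> real \<Rightarrow> bool" where
  "twice_differentiable_at g x \<longleftrightarrow>
     (\<forall>\<^sub>F t in nhds x. g differentiable (at t)) \<and> deriv g differentiable (at x)"

text \<open>
  The value of \<open>effective_form\<close> is only meaningful together with \<open>effective_form_exists\<close>.
\<close>

definition effective_form :: "(real ^ 'd \<Rightarrow> real) \<Rightarrow> real ^ 'd \<Rightarrow> real ^ 'd \<Rightarrow> real" where
  "effective_form f \<theta>0 \<omega> = 1 / 2 * (deriv ^^ 2) (\<lambda>\<epsilon>. f (\<theta>0 + \<epsilon> *\<^sub>R \<omega>)) 0"

definition effective_form_exists :: "(real ^ 'd \<Rightarrow> real) \<Rightarrow> real ^ 'd \<Rightarrow> real ^ 'd \<Rightarrow> bool" where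
  "effective_form_exists f \<theta>0 \<omega> \<longleftrightarrow> twice_differentiable_at (\<lambda>\<epsilon>. f (\<theta>0 + \<epsilon> *\<^sub>R \<omega>)) 0"

text \<open>A quadratic form, given on the unit sphere, with invertible symmetric matrix.\<close>

definition nondegenerate_form :: "(real ^ 'd \<Rightarrow> real) \<Rightarrow> bool" where
  "nondegenerate_form q \<longleftrightarrow>
     (\<exists>M :: real ^ 'd ^ 'd. transpose M = M \<and> invertible M \<and>
        (\<forall>\<omega>. norm \<omega> = 1 \<longrightarrow> q \<omega> = \<omega> \<bullet> (M *v \<omega>)))"

end

theory Submission
  imports Defs "HOL-Computational_Algebra.Fundamental_Theorem_Algebra"
begin

text \<open>
  Along a line \<open>\<theta>0 + t \<omega>\<close> the Floquet matrices \<open>B t\<close> form a smooth curve of Hermitian matrices. The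
  plan is to follow one simple eigenvalue along this curve, to compute its second derivative, and to
  transport the result to the metric graph through \<open>E = z\<^sup>2\<close>, \<open>cos z = 1 - \<lambda>\<close>.

  Perturbation theory. Choose for each \<open>t\<close> an orthonormal eigenbasis with sorted eigenvalues. Weyl's
  inequality (\<open>eigenvalue_perturbation\<close>) makes the sorted eigenvalues continuous. If \<open>f\<close> is an
  eigenvector of \<open>B t\<close> for the eigenvalue \<open>l\<close>, and \<open>e j\<close>, \<open>l j\<close> are the eigenvectors and eigenvalues of
  \<open>B 0\<close>, then \<open>(l - l j) \<langle>f, e j\<rangle> = \<langle>(B t - B 0) f, e j\<rangle>\<close>. Near a simple eigenvalue the factor
  \<open>l - l j\<close> stays away from zero for all \<open>j\<close> but one, so this single identity gives continuity and
  differentiability of the suitably scaled eigenvector and the first derivative of the eigenvalue;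
  differentiating once more yields the second-order formula in \<open>simple_eigenvalue_second_deriv\<close>.
  A band function agrees near \<open>\<theta>0\<close> with one sorted eigenvalue, because removing the flat eigenvalues
  shifts the rank of a simple, non-flat eigenvalue by a locally constant amount
  (\<open>remaining_simple_eigenvalue_continuation\<close>).

  Away from the bottom (\<open>effective_form_at_extremum\<close>). As long as \<open>E\<close> avoids the values \<open>(\<pi> k)\<^sup>2\<close>, it is a
  smooth function of \<open>\<lambda>\<close> with derivative \<open>2 z / sin z \<noteq> 0\<close>. At an extremum the first derivative of \<open>\<lambda>\<close>
  vanishes with that of \<open>E\<close>, so in the chain rule for the second derivative only the term
  \<open>(2 z / sin z) \<lambda>''\<close> survives. A discrete eigenfunction interpolated along the edges by sines is a
  metric eigenfunction from which the vertex values can be read off; hence simplicity of the metric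
  eigenvalue is inherited by the discrete one (\<open>simple_metric_imp_simple_discrete\<close>).

  The bottom of the spectrum (\<open>effective_form_at_bottom\<close>). The quadratic form of the Floquet matrix is
  a sum of squares over the edges of the quotient graph, \<open>\<Sum>\<bar>g(tail) - e\<^sup>i\<^sup>\<tau>\<^sup>\<theta> g(head)\<bar>\<^sup>2\<close>, so at \<open>\<theta> = 0\<close> the
  kernel consists of the vectors with constant \<open>g\<close>. For the lowest eigenvalue the correction in the
  second-order formula is not positive, and what remains is the sum over the bridges: this is the
  upper bound. For the lower bound, a bridge together with a path of zero-index edges in the tree is a
  cycle of at most \<open>\<nu>\<close> edges; the Cauchy-Schwarz inequality along it bounds
  \<open>\<bar>1 - e\<^sup>i\<^sup>\<tau>\<^sup>\<theta>\<bar>\<^sup>2 \<bar>g\<bar>\<^sup>2\<close> by \<open>\<nu>\<close> times the eigenvalue (\<open>bridge_energy\<close>). Dividing by \<open>t\<^sup>2\<close>, letting \<open>t\<close> tend to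
  zero and adding over \<open>d\<close> bridges with independent indices bounds the curvature below. Its positivity
  also shows that \<open>0\<close> is not a flat band. The second-order formula is visibly a quadratic form in \<open>\<omega>\<close>,
  whence the non-degeneracy.
\<close>

section \<open>Hermitian matrices over a finite index set\<close>

text \<open>
  Gaussian elimination, one equation at a time. Applied to suitable coefficients it supplies
  annihilating polynomials, vectors orthogonal to given ones, the completeness of orthonormal systems,
  and vectors in the intersection of two spectral subspaces.
\<close>

lemma underdetermined_system:
  fixes a :: "'i \<Rightarrow> 'j \<Rightarrow> 'k::field"
  assumes "finite I" "finite J" "card I < card J"
  shows "\<exists>x. (\<exists>j\<in>J. x j \<noteq> 0) \<and> (\<forall>i\<in>I. (\<Sum>j\<in>J. a i j * x j) = 0)"
  using assms
proof (induction I arbitrary: J a rule: finite_induct)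
  case empty
  then have "J \<noteq> {}" by auto
  then show ?case by (intro exI[of _ "\<lambda>_. 1"]) auto
next
  case (insert i I)
  show ?case
  proof (cases "\<forall>j\<in>J. a i j = 0")
    case True
    have "card I < card J" using insert by simp
    then obtain x where "\<exists>j\<in>J. x j \<noteq> 0" "\<forall>i\<in>I. (\<Sum>j\<in>J. a i j * x j) = 0"
      using insert.IH[OF insert.prems(1), of a] by auto
    with True show ?thesis by (intro exI[of _ x]) auto
  next
    case False
    then obtain j0 where j0: "j0 \<in> J" "a i j0 \<noteq> 0" by auto
    \<comment> \<open>The equation \<open>i\<close> is solved for the unknown \<open>j0\<close> and substituted into the others.\<close>
    let ?J = "J - {j0}"
    let ?a = "\<lambda>k j. a k j - a k j0 * a i j / a i j0"
    have "card I < card ?J" using insert j0 by simp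
    then obtain x where x: "\<exists>j\<in>?J. x j \<noteq> 0" "\<forall>k\<in>I. (\<Sum>j\<in>?J. ?a k j * x j) = 0"
      using insert.IH[of ?J ?a] insert.prems(1) by auto
    define s where "s = (\<Sum>j\<in>?J. a i j * x j)"
    let ?x = "x(j0 := - s / a i j0)"
    have split: "(\<Sum>j\<in>J. a k j * ?x j) = (\<Sum>j\<in>?J. a k j * x j) - a k j0 * s / a i j0" for k
    proof -
      have "(\<Sum>j\<in>J. a k j * ?x j) = a k j0 * ?x j0 + (\<Sum>j\<in>?J. a k j * ?x j)"
        using insert.prems(1) j0(1) by (simp add: sum.remove)
      also have "(\<Sum>j\<in>?J. a k j * ?x j) = (\<Sum>j\<in>?J. a k j * x j)"
        by (rule sum.cong) auto
      finally show ?thesis by simp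
    qed
    have "(\<Sum>j\<in>J. a k j * ?x j) = 0" if "k \<in> I" for k
    proof -
      have "0 = (\<Sum>j\<in>?J. ?a k j * x j)" using x(2) that by simp
      also have "\<dots> = (\<Sum>j\<in>?J. a k j * x j) - a k j0 * s / a i j0"
        unfolding s_def sum_distrib_left sum_divide_distrib sum_subtractf[symmetric]
        by (intro sum.cong) (auto simp: algebra_simps)
      finally show ?thesis using split[of k] by simp
    qed
    moreover have "(\<Sum>j\<in>J. a i j * ?x j) = 0"
      using split[of i] j0(2) unfolding s_def by simp
    moreover have "\<exists>j\<in>J. ?x j \<noteq> 0" using x(1) by auto
    ultimately show ?thesis by (intro exI[of _ ?x]) auto
  qed
qed

text \<open>
  Matrices and vectors are functions on a whole type, restricted to a finite index set: the vertices
  of a quotient graph form a set that depends on the graph, not a type.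
\<close>

definition inner_on :: "'a set \<Rightarrow> ('a \<Rightarrow> complex) \<Rightarrow> ('a \<Rightarrow> complex) \<Rightarrow> complex" where
  "inner_on S f g = (\<Sum>v\<in>S. f v * cnj (g v))"

definition apply_on :: "'a set \<Rightarrow> ('a \<Rightarrow> 'a \<Rightarrow> complex) \<Rightarrow> ('a \<Rightarrow> complex) \<Rightarrow> 'a \<Rightarrow> complex" where
  "apply_on S A f u = (\<Sum>v\<in>S. A u v * f v)"

definition hermitian_on :: "'a set \<Rightarrow> ('a \<Rightarrow> 'a \<Rightarrow> complex) \<Rightarrow> bool" where
  "hermitian_on S A \<longleftrightarrow> (\<forall>u\<in>S. \<forall>v\<in>S. A v u = cnj (A u v))"

lemma inner_on_cnj: "inner_on S g f = cnj (inner_on S f g)"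
  by (simp add: inner_on_def mult.commute)

lemma inner_on_self: "inner_on S f f = complex_of_real (\<Sum>v\<in>S. (cmod (f v))\<^sup>2)"
  by (simp add: inner_on_def complex_norm_square del: of_real_power)

lemma inner_on_self_eq_0: "finite S \<Longrightarrow> inner_on S f f = 0 \<longleftrightarrow> (\<forall>v\<in>S. f v = 0)"
  unfolding inner_on_self of_real_eq_0_iff by (subst sum_nonneg_eq_0_iff) auto

lemma inner_on_sum_left: "inner_on S (\<lambda>u. \<Sum>j\<in>J. c j * F j u) g = (\<Sum>j\<in>J. c j * inner_on S (F j) g)"
  unfolding inner_on_def sum_distrib_left sum_distrib_right
  by (subst sum.swap) (simp add: mult.assoc)

lemma inner_on_sum_right:
  "inner_on S g (\<lambda>u. \<Sum>j\<in>J. c j * F j u) = (\<Sum>j\<in>J. cnj (c j) * inner_on S g (F j))"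
  using arg_cong[OF inner_on_sum_left[of S c F J g], of cnj]
  by (subst (1 2) inner_on_cnj) simp

lemma inner_on_scale_left: "inner_on S (\<lambda>u. c * f u) g = c * inner_on S f g"
  by (simp add: inner_on_def sum_distrib_left mult.assoc)

lemma inner_on_scale_right: "inner_on S f (\<lambda>u. c * g u) = cnj c * inner_on S f g"
  by (simp add: inner_on_def sum_distrib_left mult_ac)

lemma inner_on_diff_left: "inner_on S (\<lambda>u. f u - g u) h = inner_on S f h - inner_on S g h"
  by (simp add: inner_on_def sum_subtractf algebra_simps)

lemma inner_on_cong:
  "(\<And>u. u \<in> S \<Longrightarrow> f u = f' u) \<Longrightarrow> (\<And>u. u \<in> S \<Longrightarrow> g u = g' u) \<Longrightarrow> inner_on S f g = inner_on S f' g'"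
  by (simp add: inner_on_def)

lemma apply_on_cong:
  "(\<And>u. u \<in> S \<Longrightarrow> f u = f' u) \<Longrightarrow> apply_on S A f v = apply_on S A f' v"
  by (simp add: apply_on_def)

lemma apply_on_sum: "apply_on S A (\<lambda>u. \<Sum>j\<in>J. c j * F j u) v = (\<Sum>j\<in>J. c j * apply_on S A (F j) v)"
  unfolding apply_on_def sum_distrib_left by (subst sum.swap) (simp add: mult_ac)

lemma apply_on_scale: "apply_on S A (\<lambda>u. c * f u) v = c * apply_on S A f v"
  by (simp add: apply_on_def sum_distrib_left mult_ac)

lemma hermitian_on_adjoint:
  assumes "hermitian_on S A"
  shows "inner_on S (apply_on S A f) g = inner_on S f (apply_on S A g)"
proof -
  have "inner_on S (apply_on S A f) g = (\<Sum>u\<in>S. \<Sum>v\<in>S. A u v * f v * cnj (g u))"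
    by (simp add: inner_on_def apply_on_def sum_distrib_right)
  also have "\<dots> = (\<Sum>v\<in>S. \<Sum>u\<in>S. A u v * f v * cnj (g u))" by (rule sum.swap)
  also have "\<dots> = (\<Sum>v\<in>S. \<Sum>u\<in>S. f v * (cnj (A v u) * cnj (g u)))"
  proof (intro sum.cong refl)
    fix v u assume "v \<in> S" "u \<in> S"
    then have "A u v = cnj (A v u)" using assms unfolding hermitian_on_def by blast
    then show "A u v * f v * cnj (g u) = f v * (cnj (A v u) * cnj (g u))" by (simp only: mult_ac)
  qed
  finally show ?thesis by (simp add: inner_on_def apply_on_def sum_distrib_left)
qed

text \<open>
  The vectors \<open>w, A w, A\<^sup>2 w, \<dots>\<close> are linearly dependent, so some polynomial in \<open>A\<close> annihilates \<open>w\<close>. If it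
  has minimal degree and \<open>z\<close> is one of its roots, dividing by the factor of \<open>z\<close> leaves a polynomial
  \<open>q\<close> for which \<open>q(A) w\<close> is nonzero and is annihilated by \<open>A - z\<close>.
\<close>

lemma eigenvector_in_invariant_subspace:
  assumes fin: "finite S" and w: "W w" "v0 \<in> S" "w v0 \<noteq> 0"
    and W_A: "\<And>f. W f \<Longrightarrow> W (apply_on S A f)"
    and W_sum: "\<And>n c F. (\<And>i. W (F i)) \<Longrightarrow> W (\<lambda>u. \<Sum>i\<le>(n::nat). c i * F i u)"
  shows "\<exists>f z. W f \<and> (\<exists>v\<in>S. f v \<noteq> 0) \<and> (\<forall>u\<in>S. apply_on S A f u = z * f u)"
proof -
  define x where "x i = (apply_on S A ^^ i) w" for i
  have x0: "x 0 = w" and xS: "x (Suc i) = apply_on S A (x i)" for i by (simp_all add: x_def)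
  have Wx: "W (x i)" for i by (induction i) (auto simp: x0 xS w W_A)
  define F where "F p u = (\<Sum>i\<le>Polynomial.degree p. coeff p i * x i u)" for p :: "complex poly" and u
  have F_ge: "F p u = (\<Sum>i\<le>n. coeff p i * x i u)" if "Polynomial.degree p \<le> n" for p u n
    unfolding F_def using that by (intro sum.mono_neutral_left) (auto simp: coeff_eq_0)
  define Q where "Q p \<longleftrightarrow> p \<noteq> 0 \<and> (\<forall>u\<in>S. F p u = 0)" for p
  have "\<exists>p. Q p"
  proof -
    obtain c where c: "\<exists>j\<in>{..card S}. c j \<noteq> 0"
      "\<forall>u\<in>S. (\<Sum>j\<in>{..card S}. x j u * c j) = 0"
      using underdetermined_system[of S "{..card S}" "\<lambda>u j. x j u"] fin by auto
    define p where "p = (\<Sum>j\<le>card S. monom (c j) j)"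
    have co: "coeff p i = (if i \<le> card S then c i else 0)" for i
      by (simp add: p_def coeff_sum)
    have "Polynomial.degree p \<le> card S" by (rule degree_le) (simp add: co)
    then have "F p u = (\<Sum>j\<le>card S. x j u * c j)" for u
      by (subst F_ge[of _ "card S"]) (auto simp: co mult.commute)
    moreover have "p \<noteq> 0" using c(1) co by (metis atMost_iff coeff_0)
    ultimately show ?thesis using c(2) unfolding Q_def by auto
  qed
  then obtain p where p: "Q p" "\<And>q. Q q \<Longrightarrow> Polynomial.degree p \<le> Polynomial.degree q"
    by (metis ex_has_least_nat)
  have "Polynomial.degree p \<noteq> 0"
  proof
    assume d: "Polynomial.degree p = 0"
    then have "F p v0 = coeff p 0 * w v0" by (simp add: F_def x0)
    moreover have "coeff p 0 \<noteq> 0" using p(1) d unfolding Q_def by (metis leading_coeff_0_iff)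
    ultimately show False using p(1) w unfolding Q_def by auto
  qed
  then obtain z where "poly p z = 0"
    using fundamental_theorem_of_algebra[of p] by (auto simp: constant_degree)
  then obtain q where q: "p = [:-z, 1:] * q" by (metis dvdE poly_eq_0_iff_dvd)
  have q0: "q \<noteq> 0" using p(1) q unfolding Q_def by auto
  have "Polynomial.degree p = Polynomial.degree [:-z, 1:] + Polynomial.degree q"
    unfolding q by (rule degree_mult_eq) (use q0 in auto)
  then have dq: "Polynomial.degree p = Suc (Polynomial.degree q)" by simp
  then have "\<not> Q q" using p(2)[of q] by auto
  then have nz: "\<exists>v\<in>S. F q v \<noteq> 0" using q0 by (auto simp: Q_def)
  have "apply_on S A (F q) u = z * F q u" if "u \<in> S" for u
  proof -
    have pq: "p = pCons 0 q - smult z q" unfolding q by simp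
    have "0 = F p u" using p(1) that by (simp add: Q_def)
    also have "\<dots> = (\<Sum>i\<le>Suc (Polynomial.degree q). coeff (pCons 0 q) i * x i u)
        - (\<Sum>i\<le>Suc (Polynomial.degree q). z * coeff q i * x i u)"
      unfolding F_def dq unfolding pq by (simp only: coeff_diff coeff_smult left_diff_distrib sum_subtractf)
    also have "(\<Sum>i\<le>Suc (Polynomial.degree q). coeff (pCons 0 q) i * x i u) =
       (\<Sum>i\<le>Polynomial.degree q. coeff q i * x (Suc i) u)"
      by (subst sum.atMost_Suc_shift) simp
    also have "\<dots> = apply_on S A (F q) u" unfolding xS F_def[abs_def] by (subst apply_on_sum) simp
    also have "(\<Sum>i\<le>Suc (Polynomial.degree q). z * coeff q i * x i u) = z * F q u"
      using F_ge[of q "Suc (Polynomial.degree q)" u] by (simp only: sum_distrib_left mult.assoc) 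
    finally show ?thesis by simp
  qed
  moreover have "W (F q)" unfolding F_def[abs_def] by (rule W_sum) (rule Wx)
  ultimately show ?thesis using nz by blast
qed

text \<open>
  Vectors vanish off the index set, so that they are elements of the eigenspaces of functions
  extended by zero. The eigenvalues are listed in increasing order: the \<open>k\<close>-th one is then a
  continuous function of the matrix, while the eigenvectors are an arbitrary choice.
\<close>

definition eigenbasis ::
    "'a set \<Rightarrow> ('a \<Rightarrow> 'a \<Rightarrow> complex) \<Rightarrow> (nat \<Rightarrow> real) \<Rightarrow> (nat \<Rightarrow> 'a \<Rightarrow> complex) \<Rightarrow> bool" where
  "eigenbasis S A l e \<longleftrightarrow>
     (\<forall>j<card S. (\<forall>u. u \<notin> S \<longrightarrow> e j u = 0) \<and> (\<forall>u\<in>S. apply_on S A (e j) u = of_real (l j) * e j u)) \<and>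
     (\<forall>i<card S. \<forall>j<card S. inner_on S (e i) (e j) = (if i = j then 1 else 0)) \<and>
     (\<forall>i j. i \<le> j \<longrightarrow> j < card S \<longrightarrow> l i \<le> l j)"

text \<open>
  The orthogonal complement of eigenvectors found so far is invariant, because the matrix is
  Hermitian, and it is nonzero as long as there are fewer than \<open>card S\<close> of them.
\<close>

lemma orthonormal_eigenvectors_exist:
  assumes fin: "finite S" and herm: "hermitian_on S A" and "m \<le> card S"
  shows "\<exists>(l :: nat \<Rightarrow> real) e. \<forall>i<m. (\<forall>u. u \<notin> S \<longrightarrow> e i u = 0) \<and>
      (\<forall>u\<in>S. apply_on S A (e i) u = of_real (l i) * e i u) \<and>
      (\<forall>j<m. inner_on S (e i) (e j) = (if i = j then 1 else 0))"
  using assms(3)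
proof (induction m)
  case 0
  show ?case by simp
next
  case (Suc m)
  obtain l :: "nat \<Rightarrow> real" and e where le: "\<forall>i<m. (\<forall>u. u \<notin> S \<longrightarrow> e i u = 0) \<and>
      (\<forall>u\<in>S. apply_on S A (e i) u = of_real (l i) * e i u) \<and>
      (\<forall>j<m. inner_on S (e i) (e j) = (if i = j then 1 else 0))"
    using Suc.IH[OF Suc_leD[OF Suc.prems]] by blast
  have
    supp: "\<And>i u. i < m \<Longrightarrow> u \<notin> S \<Longrightarrow> e i u = 0"
    and eig: "\<And>i u. i < m \<Longrightarrow> u \<in> S \<Longrightarrow> apply_on S A (e i) u = of_real (l i) * e i u"
    and on: "\<And>i j. i < m \<Longrightarrow> j < m \<Longrightarrow> inner_on S (e i) (e j) = (if i = j then 1 else 0)"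
    using le by blast+
  define W where "W f \<longleftrightarrow> (\<forall>i<m. inner_on S f (e i) = 0)" for f
  obtain w where w: "\<exists>v\<in>S. w v \<noteq> 0" "\<forall>i\<in>{..<m}. (\<Sum>v\<in>S. cnj (e i v) * w v) = 0"
    using underdetermined_system[of "{..<m}" S "\<lambda>i v. cnj (e i v)"] fin Suc.prems by auto
  obtain v0 where v0: "v0 \<in> S" "w v0 \<noteq> 0" using w(1) by auto
  have Ww: "W w" using w(2) by (auto simp: W_def inner_on_def mult.commute)
  have WA: "W (apply_on S A f)" if "W f" for f
    unfolding W_def
  proof (intro allI impI)
    fix i assume i: "i < m"
    have "inner_on S (apply_on S A f) (e i) = inner_on S f (apply_on S A (e i))"
      by (rule hermitian_on_adjoint[OF herm])
    also have "\<dots> = inner_on S f (\<lambda>u. of_real (l i) * e i u)"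
      by (rule inner_on_cong) (auto simp: eig i)
    also have "\<dots> = 0" using that i by (simp add: inner_on_scale_right W_def)
    finally show "inner_on S (apply_on S A f) (e i) = 0" .
  qed
  have Wsum: "W (\<lambda>u. \<Sum>i\<le>n. c i * F i u)" if "\<And>i. W (F i)" for n :: nat and c F
    using that by (simp add: W_def inner_on_sum_left)
  obtain f z where f: "W f" "\<exists>v\<in>S. f v \<noteq> 0" "\<forall>u\<in>S. apply_on S A f u = z * f u"
    using eigenvector_in_invariant_subspace[where W = W, OF fin Ww v0 WA Wsum] by blast
  have ff: "inner_on S f f \<noteq> 0" using f(2) inner_on_self_eq_0[OF fin] by auto
  have "z * inner_on S f f = inner_on S (apply_on S A f) f"
    by (subst inner_on_scale_left[symmetric], rule inner_on_cong) (use f(3) in auto)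
  also have "\<dots> = inner_on S f (apply_on S A f)" by (rule hermitian_on_adjoint[OF herm])
  also have "\<dots> = cnj z * inner_on S f f"
    by (subst inner_on_scale_right[symmetric], rule inner_on_cong) (use f(3) in auto)
  finally have zc: "z = cnj z" using ff by simp
  have "Im z = - Im z" using arg_cong[OF zc, of Im] cnj.sel(2)[of z] by linarith
  then have zr: "z = of_real (Re z)" by (simp add: complex_eq_iff)
  define N where "N = (\<Sum>v\<in>S. (cmod (f v))\<^sup>2)"
  have N: "N \<ge> 0" "N \<noteq> 0" "inner_on S f f = of_real N"
  proof -
    show N3: "inner_on S f f = of_real N" by (simp add: N_def inner_on_self)
    show "N \<ge> 0" by (simp add: N_def sum_nonneg)
    show "N \<noteq> 0" using ff unfolding N3 by simp
  qed
  define c where "c = 1 / sqrt N"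
  have c: "c * c * N = 1" using N(1,2) by (simp add: c_def)
  define g where "g u = (if u \<in> S then of_real c * f u else 0)" for u
  have g_S: "g u = of_real c * f u" if "u \<in> S" for u using that by (simp add: g_def)
  have "inner_on S g g = inner_on S (\<lambda>u. of_real c * f u) (\<lambda>u. of_real c * f u)"
    by (rule inner_on_cong) (auto simp: g_S)
  also have "\<dots> = of_real (c * c * N)" by (simp add: inner_on_scale_left inner_on_scale_right N(3))
  finally have gg: "inner_on S g g = 1" using c by simp
  have ge: "inner_on S g (e i) = 0" if "i < m" for i
  proof -
    have "inner_on S g (e i) = inner_on S (\<lambda>u. of_real c * f u) (e i)"
      by (rule inner_on_cong) (auto simp: g_S)
    with f(1) that show ?thesis by (simp add: inner_on_scale_left W_def)
  qed
  have eg: "inner_on S (e i) g = 0" if "i < m" for i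
    using ge[OF that] by (subst inner_on_cnj) simp
  have Ag: "apply_on S A g u = of_real (Re z) * g u" if "u \<in> S" for u
  proof -
    have "apply_on S A g u = apply_on S A (\<lambda>u. of_real c * f u) u"
      by (rule apply_on_cong) (auto simp: g_S)
    also have "\<dots> = z * g u" using f(3) that by (simp add: apply_on_scale g_S)
    finally show ?thesis using zr by simp
  qed
  show ?case
  proof (intro exI allI impI conjI)
    fix i assume "i < Suc m"
    then have i: "i < m \<or> i = m" by auto
    show "(e(m := g)) i u = 0" if "u \<notin> S" for u using i that by (auto simp: supp g_def)
    show "\<forall>u\<in>S. apply_on S A ((e(m := g)) i) u = of_real ((l(m := Re z)) i) * (e(m := g)) i u"
      using i by (auto simp: eig Ag)
    fix j assume "j < Suc m"
    then have "j < m \<or> j = m" by auto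
    with i show "inner_on S ((e(m := g)) i) ((e(m := g)) j) = (if i = j then 1 else 0)"
      by (auto simp: on gg ge eg)
  qed
qed

lemma eigenbasis_exists:
  assumes fin: "finite S" and herm: "hermitian_on S A"
  shows "\<exists>l e. eigenbasis S A l e"
proof -
  let ?n = "card S"
  obtain l :: "nat \<Rightarrow> real" and e where le: "\<forall>i<?n. (\<forall>u. u \<notin> S \<longrightarrow> e i u = 0) \<and>
      (\<forall>u\<in>S. apply_on S A (e i) u = of_real (l i) * e i u) \<and>
      (\<forall>j<?n. inner_on S (e i) (e j) = (if i = j then 1 else 0))"
    using orthonormal_eigenvectors_exist[OF fin herm order_refl] by blast
  have
    supp: "\<And>i u. i < ?n \<Longrightarrow> u \<notin> S \<Longrightarrow> e i u = 0"
    and eig: "\<And>i u. i < ?n \<Longrightarrow> u \<in> S \<Longrightarrow> apply_on S A (e i) u = of_real (l i) * e i u"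
    and on: "\<And>i j. i < ?n \<Longrightarrow> j < ?n \<Longrightarrow> inner_on S (e i) (e j) = (if i = j then 1 else 0)"
    using le by blast+
  define js where "js = sort_key l [0..<?n]"
  have len: "length js = ?n" and dist: "distinct js" and set: "set js = {..<?n}"
    by (auto simp: js_def)
  have sorted: "sorted (map l js)" by (simp add: js_def)
  have lt: "js ! i < ?n" if "i < ?n" for i using that set len by (metis lessThan_iff nth_mem)
  have "l (js ! i) \<le> l (js ! j)" if "i \<le> j" "j < ?n" for i j
    using sorted_nth_mono[OF sorted that(1)] that len by simp
  moreover have "js ! i = js ! j \<longleftrightarrow> i = j" if "i < ?n" "j < ?n" for i j
    using that dist len by (simp add: nth_eq_iff_index_eq)
  ultimately have "eigenbasis S A (\<lambda>i. l (js ! i)) (\<lambda>i. e (js ! i))"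
    unfolding eigenbasis_def by (auto simp: lt supp eig on)
  then show ?thesis by blast
qed

lemma eigenbasisD:
  assumes "eigenbasis S A l e"
  shows "\<And>j u. j < card S \<Longrightarrow> u \<notin> S \<Longrightarrow> e j u = 0"
    and "\<And>j u. j < card S \<Longrightarrow> u \<in> S \<Longrightarrow> apply_on S A (e j) u = of_real (l j) * e j u"
    and "\<And>i j. i < card S \<Longrightarrow> j < card S \<Longrightarrow> inner_on S (e i) (e j) = (if i = j then 1 else 0)"
    and "\<And>i j. i \<le> j \<Longrightarrow> j < card S \<Longrightarrow> l i \<le> l j"
  using assms unfolding eigenbasis_def by blast+

text \<open>
  A nonzero remainder orthogonal to all basis vectors would give \<open>card S + 1\<close> nonzero pairwise
  orthogonal vectors, but so many vectors are linearly dependent.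
\<close>

lemma eigenbasis_expansion:
  assumes fin: "finite S" and eb: "eigenbasis S A l e" and u: "u \<in> S"
  shows "f u = (\<Sum>j<card S. inner_on S f (e j) * e j u)"
proof (rule ccontr)
  let ?n = "card S"
  note on = eigenbasisD(3)[OF eb]
  define r where "r u = f u - (\<Sum>j<?n. inner_on S f (e j) * e j u)" for u
  assume "f u \<noteq> (\<Sum>j<?n. inner_on S f (e j) * e j u)"
  then have "r u \<noteq> 0" by (simp add: r_def)
  then have rr: "inner_on S r r \<noteq> 0" using u inner_on_self_eq_0[OF fin] by auto
  have re: "inner_on S r (e i) = 0" if "i < ?n" for i
    unfolding r_def inner_on_diff_left inner_on_sum_left using that
    by (simp add: on if_distrib[of "\<lambda>x. _ * x"] cong: if_cong)
  have er: "inner_on S (e i) r = 0" if "i < ?n" for i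
    using re[OF that] by (subst inner_on_cnj) simp
  define F where "F j = (if j = ?n then r else e j)" for j
  obtain x where x: "\<exists>j\<in>{..?n}. x j \<noteq> 0" "\<forall>v\<in>S. (\<Sum>j\<le>?n. F j v * x j) = 0"
    using underdetermined_system[of S "{..?n}" "\<lambda>v j. F j v"] fin by auto
  have orth: "inner_on S (F i) (F j) = 0" if "i \<le> ?n" "j \<le> ?n" "i \<noteq> j" for i j
    using that by (auto simp: F_def re er on)
  have nz: "inner_on S (F j) (F j) \<noteq> 0" if "j \<le> ?n" for j
    using that rr by (auto simp: F_def on)
  obtain k where k: "k \<le> ?n" "x k \<noteq> 0" using x(1) by auto
  have "0 = inner_on S (\<lambda>v. \<Sum>j\<le>?n. x j * F j v) (F k)"
    using x(2) by (simp add: inner_on_def mult.commute)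
  also have "\<dots> = (\<Sum>j\<le>?n. x j * inner_on S (F j) (F k))" by (rule inner_on_sum_left)
  also have "\<dots> = (\<Sum>j\<le>?n. if j = k then x k * inner_on S (F k) (F k) else 0)"
    using k(1) by (intro sum.cong) (auto simp: orth)
  also have "\<dots> = x k * inner_on S (F k) (F k)" using k(1) by simp
  finally show False using k nz by simp
qed

lemma eigenbasis_quadratic_form:
  assumes fin: "finite S" and eb: "eigenbasis S A l e"
  shows "inner_on S (apply_on S A f) f =
    of_real (\<Sum>j<card S. l j * (cmod (inner_on S f (e j)))\<^sup>2)" (is ?A)
    and "inner_on S f f = of_real (\<Sum>j<card S. (cmod (inner_on S f (e j)))\<^sup>2)" (is ?B)
proof -
  let ?n = "card S"
  let ?c = "\<lambda>j. inner_on S f (e j)"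
  have eA: "inner_on S f f' = (\<Sum>j<?n. ?c j * inner_on S (e j) f')" for f'
  proof -
    have "inner_on S f f' = inner_on S (\<lambda>u. \<Sum>j<?n. ?c j * e j u) f'"
      by (rule inner_on_cong) (auto intro: eigenbasis_expansion[OF fin eb])
    then show ?thesis by (simp add: inner_on_sum_left)
  qed
  have sq: "?c j * inner_on S (e j) f = of_real ((cmod (?c j))\<^sup>2)" for j
    by (subst inner_on_cnj[of S "e j" f]) (simp add: complex_norm_square del: of_real_power)
  show ?B unfolding eA[of f] sq by simp
  have "inner_on S (apply_on S A f) f = inner_on S (\<lambda>u. \<Sum>j<?n. (?c j * l j) * e j u) f"
  proof (rule inner_on_cong)
    fix u assume u: "u \<in> S"
    have "apply_on S A f u = apply_on S A (\<lambda>u. \<Sum>j<?n. ?c j * e j u) u"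
      by (rule apply_on_cong) (auto intro: eigenbasis_expansion[OF fin eb])
    then show "apply_on S A f u = (\<Sum>j<?n. (?c j * l j) * e j u)"
      by (simp add: apply_on_sum eigenbasisD(2)[OF eb] u mult.assoc)
  qed simp
  also have "\<dots> = (\<Sum>j<?n. l j * (?c j * inner_on S (e j) f))"
    unfolding inner_on_sum_left by (simp add: mult_ac)
  finally show ?A unfolding sq by simp
qed

text \<open>
  Weyl's inequality, by the min-max argument: some nonzero \<open>f\<close> lies in the span of the first \<open>k + 1\<close>
  eigenvectors of \<open>A\<close> and is orthogonal to the first \<open>k\<close> eigenvectors of \<open>A'\<close>. On it the form of \<open>A\<close> is at
  most \<open>l k\<close> and the form of \<open>A'\<close> is at least \<open>l' k\<close>. The indices start at \<open>0\<close>.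
\<close>

lemma eigenvalue_perturbation:
  assumes fin: "finite S" and eb: "eigenbasis S A l e" and eb': "eigenbasis S A' l' e'"
    and k: "k < card S"
  shows "l' k \<le> l k + (\<Sum>u\<in>S. \<Sum>v\<in>S. cmod (A' u v - A u v))"
proof -
  let ?n = "card S"
  define d where "d = (\<Sum>u\<in>S. \<Sum>v\<in>S. cmod (A' u v - A u v))"
  obtain x where x: "\<exists>i\<in>{..k}. x i \<noteq> 0" "\<forall>j\<in>{..<k}. (\<Sum>i\<le>k. inner_on S (e i) (e' j) * x i) = 0"
    using underdetermined_system[of "{..<k}" "{..k}" "\<lambda>j i. inner_on S (e i) (e' j)"] by auto
  define f where "f u = (\<Sum>i\<le>k. x i * e i u)" for u
  have fe: "inner_on S f (e j) = (if j \<le> k then x j else 0)" if "j < ?n" for j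
  proof -
    have "inner_on S f (e j) = (\<Sum>i\<le>k. if i = j then x i else 0)"
      unfolding f_def inner_on_sum_left using that k by (intro sum.cong) (auto simp: eigenbasisD(3)[OF eb])
    then show ?thesis by simp
  qed
  have fe': "inner_on S f (e' j) = 0" if "j < k" for j
    unfolding f_def inner_on_sum_left using x(2) that by (auto simp: mult.commute)
  define N where "N = (\<Sum>v\<in>S. (cmod (f v))\<^sup>2)"
  have NN: "inner_on S f f = of_real N" by (simp add: N_def inner_on_self)
  have N1: "N = (\<Sum>j<?n. (cmod (inner_on S f (e j)))\<^sup>2)"
    using eigenbasis_quadratic_form(2)[OF fin eb, of f] NN by (simp only: of_real_eq_iff)
  have N2: "N = (\<Sum>j<?n. (cmod (inner_on S f (e' j)))\<^sup>2)"
    using eigenbasis_quadratic_form(2)[OF fin eb', of f] NN by (simp only: of_real_eq_iff)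
  obtain i where i: "i \<le> k" "x i \<noteq> 0" using x(1) by auto
  have "0 < (cmod (inner_on S f (e i)))\<^sup>2" using i k fe[of i] by simp
  also have "\<dots> \<le> N" unfolding N1 using i k by (intro member_le_sum) auto
  finally have Npos: "0 < N" .
  have le: "(\<Sum>j<?n. l j * (cmod (inner_on S f (e j)))\<^sup>2) \<le> l k * N"
    unfolding N1 sum_distrib_left
    using k eigenbasisD(4)[OF eb] by (intro sum_mono) (auto simp: fe intro: mult_right_mono)
  have ge: "l' k * N \<le> (\<Sum>j<?n. l' j * (cmod (inner_on S f (e' j)))\<^sup>2)"
    unfolding N2 sum_distrib_left
  proof (intro sum_mono)
    fix j assume "j \<in> {..<?n}"
    then show "l' k * (cmod (inner_on S f (e' j)))\<^sup>2 \<le> l' j * (cmod (inner_on S f (e' j)))\<^sup>2"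
      using fe'[of j] eigenbasisD(4)[OF eb', of k j] by (cases "j < k") (auto intro: mult_right_mono)
  qed
  have "of_real ((\<Sum>j<?n. l' j * (cmod (inner_on S f (e' j)))\<^sup>2) -
      (\<Sum>j<?n. l j * (cmod (inner_on S f (e j)))\<^sup>2)) =
      inner_on S (apply_on S A' f) f - inner_on S (apply_on S A f) f"
    by (simp only: eigenbasis_quadratic_form(1)[OF fin eb] eigenbasis_quadratic_form(1)[OF fin eb'] of_real_diff)
  also have "\<dots> = (\<Sum>u\<in>S. \<Sum>v\<in>S. (A' u v - A u v) * f v * cnj (f u))"
    by (simp add: inner_on_def apply_on_def sum_distrib_right sum_subtractf[symmetric] left_diff_distrib)
  finally have "(\<Sum>j<?n. l' j * (cmod (inner_on S f (e' j)))\<^sup>2) -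
      (\<Sum>j<?n. l j * (cmod (inner_on S f (e j)))\<^sup>2) =
      Re (\<Sum>u\<in>S. \<Sum>v\<in>S. (A' u v - A u v) * f v * cnj (f u))"
    by (metis Re_complex_of_real)
  also have "\<dots> \<le> cmod (\<Sum>u\<in>S. \<Sum>v\<in>S. (A' u v - A u v) * f v * cnj (f u))"
    by (rule complex_Re_le_cmod)
  also have "\<dots> \<le> (\<Sum>u\<in>S. cmod (\<Sum>v\<in>S. (A' u v - A u v) * f v * cnj (f u)))"
    by (rule norm_sum)
  also have "\<dots> \<le> (\<Sum>u\<in>S. \<Sum>v\<in>S. cmod ((A' u v - A u v) * f v * cnj (f u)))"
    by (intro sum_mono norm_sum)
  also have "\<dots> \<le> (\<Sum>u\<in>S. \<Sum>v\<in>S. cmod (A' u v - A u v) * N)"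
  proof (intro sum_mono)
    fix u v assume uv: "u \<in> S" "v \<in> S"
    have b: "(cmod (f w))\<^sup>2 \<le> N" if "w \<in> S" for w
      unfolding N_def using that fin by (intro member_le_sum) auto
    have "2 * (cmod (f v) * cmod (f u)) \<le> (cmod (f v))\<^sup>2 + (cmod (f u))\<^sup>2"
      using sum_squares_bound[of "cmod (f v)" "cmod (f u)"] by (simp add: mult.assoc)
    then have "cmod (f v) * cmod (f u) \<le> N" using b[OF uv(1)] b[OF uv(2)] by linarith
    then have "cmod (A' u v - A u v) * (cmod (f v) * cmod (f u)) \<le> cmod (A' u v - A u v) * N"
      by (rule mult_left_mono) simp
    then show "cmod ((A' u v - A u v) * f v * cnj (f u)) \<le> cmod (A' u v - A u v) * N"
      by (simp add: norm_mult mult.assoc)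
  qed
  also have "\<dots> = d * N" by (simp add: d_def sum_distrib_right)
  finally have "l' k * N \<le> (l k + d) * N" using le ge by (simp add: distrib_right)
  then show ?thesis using Npos by (simp add: d_def)
qed

lemma eigenvalue_tendsto:
  assumes fin: "finite S" and eb: "\<And>t. eigenbasis S (A t) (l t) (e t)"
    and k: "k < card S"
    and lim: "\<And>u v. u \<in> S \<Longrightarrow> v \<in> S \<Longrightarrow> ((\<lambda>t. A t u v) \<longlongrightarrow> A t0 u v) F"
  shows "((\<lambda>t. l t k) \<longlongrightarrow> l t0 k) F"
proof -
  define d where "d t = (\<Sum>u\<in>S. \<Sum>v\<in>S. cmod (A t u v - A t0 u v))" for t
  have "(d \<longlongrightarrow> (\<Sum>u\<in>S. \<Sum>v\<in>S. cmod (A t0 u v - A t0 u v))) F"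
    unfolding d_def by (intro tendsto_intros lim)
  then have d0: "(d \<longlongrightarrow> 0) F" by simp
  have "l t k \<le> l t0 k + d t" for t
    unfolding d_def by (rule eigenvalue_perturbation[OF fin eb eb k])
  moreover have "l t0 k \<le> l t k + d t" for t
    using eigenvalue_perturbation[OF fin eb[of t] eb[of t0] k] by (simp add: d_def norm_minus_commute)
  ultimately have "norm (l t k - l t0 k) \<le> d t" for t
    by (simp add: abs_le_iff add.commute diff_le_eq)
  then have "((\<lambda>t. l t k - l t0 k) \<longlongrightarrow> 0) F" by (intro Lim_null_comparison[OF _ d0] always_eventually) auto
  then show ?thesis by (simp add: LIM_zero_iff)
qed

section \<open>Perturbation of a simple eigenvalue\<close>

lemma has_vector_derivative_iff_quotient:
  fixes f :: "real \<Rightarrow> complex"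
  shows "(f has_vector_derivative D) (at x) \<longleftrightarrow>
    ((\<lambda>t. (f t - f x) / of_real (t - x)) \<longlongrightarrow> D) (at x)"
proof -
  have eq: "norm ((f y - (f x + (y - x) *\<^sub>R D)) /\<^sub>R norm (y - x)) =
      norm ((f y - f x) / of_real (y - x) - D)" if "y \<noteq> x" for y
  proof -
    have "(f y - f x) / of_real (y - x) - D = (f y - (f x + (y - x) *\<^sub>R D)) / of_real (y - x)"
      using that by (simp add: field_simps scaleR_conv_of_real)
    moreover have "cmod (complex_of_real (y - x)) = \<bar>y - x\<bar>" by (rule norm_of_real)
    ultimately show ?thesis by (simp only: norm_mult norm_divide norm_scaleR norm_inverse real_norm_def abs_inverse
          abs_abs divide_inverse mult.commute)
  qed
  have "(f has_vector_derivative D) (at x) \<longleftrightarrow>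
      ((\<lambda>y. (f y - (f x + (y - x) *\<^sub>R D)) /\<^sub>R norm (y - x)) \<longlongrightarrow> 0) (at x)"
    by (simp add: has_vector_derivative_def has_derivative_within bounded_linear_scaleR_left divide_inverse_commute)
  also have "\<dots> \<longleftrightarrow> ((\<lambda>y. norm ((f y - (f x + (y - x) *\<^sub>R D)) /\<^sub>R norm (y - x))) \<longlongrightarrow> 0) (at x)"
    by (rule tendsto_norm_zero_iff[symmetric])
  also have "\<dots> \<longleftrightarrow> ((\<lambda>y. norm ((f y - f x) / of_real (y - x) - D)) \<longlongrightarrow> 0) (at x)"
    by (intro filterlim_cong refl eventually_at_filter[THEN iffD2] always_eventually) (use eq in auto)
  also have "\<dots> \<longleftrightarrow> ((\<lambda>y. (f y - f x) / of_real (y - x) - D) \<longlongrightarrow> 0) (at x)"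
    by (rule tendsto_norm_zero_iff)
  also have "\<dots> \<longleftrightarrow> ((\<lambda>t. (f t - f x) / of_real (t - x)) \<longlongrightarrow> D) (at x)"
    by (rule LIM_zero_iff)
  finally show ?thesis .
qed

lemma tendsto_inner_on:
  "(\<And>u. u \<in> S \<Longrightarrow> ((\<lambda>t. f t u) \<longlongrightarrow> f0 u) F) \<Longrightarrow> (\<And>u. u \<in> S \<Longrightarrow> ((\<lambda>t. g t u) \<longlongrightarrow> g0 u) F) \<Longrightarrow>
   ((\<lambda>t. inner_on S (f t) (g t)) \<longlongrightarrow> inner_on S f0 g0) F"
  unfolding inner_on_def by (intro tendsto_intros)

lemma tendsto_apply_on:
  "(\<And>v. v \<in> S \<Longrightarrow> ((\<lambda>t. A t u v) \<longlongrightarrow> A0 u v) F) \<Longrightarrow> (\<And>v. v \<in> S \<Longrightarrow> ((\<lambda>t. f t v) \<longlongrightarrow> f0 v) F) \<Longrightarrow>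
   ((\<lambda>t. apply_on S (A t) (f t) u) \<longlongrightarrow> apply_on S A0 f0 u) F"
  unfolding apply_on_def by (intro tendsto_intros)

text \<open>
  The eigenvectors \<open>e t k\<close> are chosen independently for each \<open>t\<close>; dividing by the component along
  \<open>e t0 k\<close> removes the arbitrary phase. The other components satisfy
  \<open>(l t k - l t0 j) \<langle>e t k, e t0 j\<rangle> = \<langle>(B t - B t0) e t k, e t0 j\<rangle>\<close>, where the first factor tends to a
  nonzero limit. They are therefore small, and dividing the identity by \<open>t - t0\<close> gives their derivatives;
  for \<open>j = k\<close> the same identity gives the derivative of the eigenvalue.
\<close>

lemma simple_eigenpair_derivative:
  fixes B :: "real \<Rightarrow> 'a \<Rightarrow> 'a \<Rightarrow> complex"
  assumes fin: "finite S" and herm: "\<And>t. hermitian_on S (B t)"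
    and eb: "\<And>t. eigenbasis S (B t) (l t) (e t)"
    and k: "k < card S"
    and simple: "\<And>j. j < card S \<Longrightarrow> j \<noteq> k \<Longrightarrow> l t0 j \<noteq> l t0 k"
    and B1: "\<And>u v. u \<in> S \<Longrightarrow> v \<in> S \<Longrightarrow> ((\<lambda>t. B t u v) has_vector_derivative B1 u v) (at t0)"
  defines "f \<equiv> \<lambda>t u. e t k u / inner_on S (e t k) (e t0 k)"
  shows "\<forall>\<^sub>F t in at t0. inner_on S (e t k) (e t0 k) \<noteq> 0"
    and "\<And>u. u \<in> S \<Longrightarrow> ((\<lambda>t. f t u) has_vector_derivative
          (\<Sum>j\<in>{..<card S} - {k}. inner_on S (apply_on S B1 (e t0 k)) (e t0 j) /
             of_real (l t0 k - l t0 j) * e t0 j u)) (at t0)"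
    and "((\<lambda>t. l t k) has_real_derivative Re (inner_on S (apply_on S B1 (e t0 k)) (e t0 k))) (at t0)"
proof -
  let ?n = "card S" and ?J = "{..<card S} - {k}"
  note eb0 = eb[of t0]
  define D where "D t u v = B t u v - B t0 u v" for t u v
  define c where "c j t = inner_on S (e t k) (e t0 j)" for j t
  have Bt: "((\<lambda>t. B t u v) \<longlongrightarrow> B t0 u v) (at t0)" if "u \<in> S" "v \<in> S" for u v
    using has_vector_derivative_continuous[OF B1[OF that]] by (simp add: isCont_def)
  have lk: "((\<lambda>t. l t k) \<longlongrightarrow> l t0 k) (at t0)"
    by (rule eigenvalue_tendsto[OF fin eb k Bt])
  have key: "of_real (l t k - l t0 j) * c j t = inner_on S (apply_on S (D t) (e t k)) (e t0 j)"
    if j: "j < ?n" for j t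
  proof -
    have "inner_on S (apply_on S (D t) (e t k)) (e t0 j) =
       inner_on S (apply_on S (B t) (e t k)) (e t0 j) - inner_on S (apply_on S (B t0) (e t k)) (e t0 j)"
      unfolding inner_on_diff_left[symmetric]
      by (rule inner_on_cong) (simp_all add: D_def apply_on_def left_diff_distrib sum_subtractf)
    also have "inner_on S (apply_on S (B t) (e t k)) (e t0 j) = inner_on S (\<lambda>u. of_real (l t k) * e t k u) (e t0 j)"
      by (rule inner_on_cong) (auto simp: eigenbasisD(2)[OF eb k])
    also have "\<dots> = of_real (l t k) * c j t" by (simp add: inner_on_scale_left c_def)
    also have "inner_on S (apply_on S (B t0) (e t k)) (e t0 j) = inner_on S (e t k) (apply_on S (B t0) (e t0 j))"
      by (rule hermitian_on_adjoint[OF herm])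
    also have "\<dots> = inner_on S (e t k) (\<lambda>u. of_real (l t0 j) * e t0 j u)"
      by (rule inner_on_cong) (auto simp: eigenbasisD(2)[OF eb j])
    also have "\<dots> = of_real (l t0 j) * c j t" by (simp add: inner_on_scale_right c_def)
    finally show ?thesis by (simp add: left_diff_distrib)
  qed
  have le1: "cmod (e t j u) \<le> 1" if "j < ?n" "u \<in> S" for t j u
  proof -
    have "complex_of_real (\<Sum>v\<in>S. (cmod (e t j v))\<^sup>2) = of_real 1"
      using eigenbasisD(3)[OF eb that(1) that(1), of t] by (simp only: inner_on_self) simp
    then have "(\<Sum>v\<in>S. (cmod (e t j v))\<^sup>2) = 1" by (simp only: of_real_eq_iff)
    moreover have "(cmod (e t j u))\<^sup>2 \<le> (\<Sum>v\<in>S. (cmod (e t j v))\<^sup>2)"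
      using that fin by (intro member_le_sum) auto
    ultimately show ?thesis by (simp add: power2_le_imp_le abs_square_le_1)
  qed
  have D0: "((\<lambda>t. inner_on S (apply_on S (D t) (e t k)) (e t0 j)) \<longlongrightarrow> 0) (at t0)" if j: "j < ?n" for j
  proof -
    have "((\<lambda>t. \<Sum>u\<in>S. \<Sum>v\<in>S. cmod (B t u v - B t0 u v)) \<longlongrightarrow> (\<Sum>u\<in>S. \<Sum>v\<in>S. cmod (B t0 u v - B t0 u v))) (at t0)"
      by (intro tendsto_intros Bt)
    then have lim: "((\<lambda>t. \<Sum>u\<in>S. \<Sum>v\<in>S. cmod (D t u v)) \<longlongrightarrow> 0) (at t0)" by (simp add: D_def)
    have "cmod (inner_on S (apply_on S (D t) (e t k)) (e t0 j)) \<le> (\<Sum>u\<in>S. \<Sum>v\<in>S. cmod (D t u v))" for t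
      unfolding inner_on_def apply_on_def sum_distrib_right
    proof (intro order_trans[OF norm_sum] sum_mono)
      fix u v assume uv: "u \<in> S" "v \<in> S"
      have "cmod (D t u v) * cmod (e t k v) * cmod (e t0 j u) \<le> cmod (D t u v) * 1 * 1"
        by (intro mult_mono le1 k j uv) auto
      then show "cmod (D t u v * e t k v * cnj (e t0 j u)) \<le> cmod (D t u v)" by (simp add: norm_mult)
    qed
    then show ?thesis by (intro Lim_null_comparison[OF _ lim] always_eventually) auto
  qed
  have ne: "\<forall>\<^sub>F t in at t0. l t k \<noteq> l t0 j" if "j \<in> ?J" for j
    using tendsto_imp_eventually_ne[OF lk, of "l t0 j"] simple[of j] that by auto
  have cj: "\<forall>\<^sub>F t in at t0. c j t = inner_on S (apply_on S (D t) (e t k)) (e t0 j) / of_real (l t k - l t0 j)"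
    if "j \<in> ?J" for j
    using ne[OF that]
  proof eventually_elim
    case (elim t)
    then have "complex_of_real (l t k - l t0 j) \<noteq> 0" unfolding of_real_eq_0_iff by simp
    then show ?case using key[of j t] that by (metis DiffD1 lessThan_iff nonzero_mult_div_cancel_left)
  qed
  have cj0: "(c j \<longlongrightarrow> 0) (at t0)" if "j \<in> ?J" for j
  proof -
    have "((\<lambda>t. inner_on S (apply_on S (D t) (e t k)) (e t0 j) / of_real (l t k - l t0 j)) \<longlongrightarrow>
        0 / of_real (l t0 k - l t0 j)) (at t0)"
      using that simple[of j] by (intro tendsto_intros D0 lk) auto
    then show ?thesis using filterlim_cong[OF refl refl cj[OF that]] by simp
  qed
  \<comment> \<open>Since \<open>e t k\<close> has norm one, its component along \<open>e t0 k\<close> has modulus tending to one.\<close>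
  have ck: "(cmod (c k t))\<^sup>2 = 1 - (\<Sum>j\<in>?J. (cmod (c j t))\<^sup>2)" for t
  proof -
    have "complex_of_real 1 = of_real (\<Sum>j<?n. (cmod (c j t))\<^sup>2)"
      using eigenbasis_quadratic_form(2)[OF fin eb0, of "e t k"] eigenbasisD(3)[OF eb k k, of t]
      by (simp only: c_def if_True refl) simp
    then have "1 = (\<Sum>j<?n. (cmod (c j t))\<^sup>2)" by (simp only: of_real_eq_iff)
    then show ?thesis using k by (simp add: sum.remove[of "{..<?n}" k])
  qed
  have "((\<lambda>t. 1 - (\<Sum>j\<in>?J. (cmod (c j t))\<^sup>2)) \<longlongrightarrow> 1 - (\<Sum>j\<in>?J. (cmod 0)\<^sup>2)) (at t0)"
    by (intro tendsto_intros cj0)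
  then have "((\<lambda>t. (cmod (c k t))\<^sup>2) \<longlongrightarrow> 1) (at t0)" by (simp add: ck)
  then have "((\<lambda>t. sqrt ((cmod (c k t))\<^sup>2)) \<longlongrightarrow> sqrt 1) (at t0)" by (rule tendsto_real_sqrt)
  then have ck1: "((\<lambda>t. cmod (c k t)) \<longlongrightarrow> 1) (at t0)" by simp
  show ck_ne: "\<forall>\<^sub>F t in at t0. inner_on S (e t k) (e t0 k) \<noteq> 0"
    using tendsto_imp_eventually_ne[OF ck1, of 0] by (auto simp: c_def elim: eventually_mono)
  define d where "d j t = c j t / c k t" for j t
  have d: "inner_on S (f t) (e t0 j) = d j t" for j t
    using inner_on_scale_left[of S "1 / c k t" "e t k" "e t0 j"] by (simp add: f_def d_def c_def)
  have dk: "\<forall>\<^sub>F t in at t0. d k t = 1" using ck_ne by eventually_elim (simp add: d_def c_def)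
  have dj0: "(d j \<longlongrightarrow> 0) (at t0)" if "j \<in> ?J" for j
  proof -
    have "((\<lambda>t. cmod (c j t) / cmod (c k t)) \<longlongrightarrow> 0 / 1) (at t0)"
      by (intro tendsto_divide tendsto_norm_zero cj0 ck1 that) simp
    then show ?thesis by (intro tendsto_norm_zero_cancel[of "d j"]) (simp add: d_def norm_divide)
  qed
  have fsum: "f t u = d k t * e t0 k u + (\<Sum>j\<in>?J. d j t * e t0 j u)" if "u \<in> S" for t u
    using eigenbasis_expansion[OF fin eb0 that, of "f t"] k by (simp add: d sum.remove[of "{..<?n}" k])
  have f0: "f t0 u = e t0 k u" for u using eigenbasisD(3)[OF eb k k] by (simp add: f_def)
  have ft: "((\<lambda>t. f t u) \<longlongrightarrow> e t0 k u) (at t0)" if "u \<in> S" for u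
  proof -
    have "((\<lambda>t. d k t * e t0 k u + (\<Sum>j\<in>?J. d j t * e t0 j u)) \<longlongrightarrow>
        1 * e t0 k u + (\<Sum>j\<in>?J. 0 * e t0 j u)) (at t0)"
      by (intro tendsto_intros dj0 tendsto_eventually[OF dk])
    then show ?thesis by (simp add: fsum that)
  qed
  define q where "q t u v = (B t u v - B t0 u v) / of_real (t - t0)" for t u v
  have qt: "((\<lambda>t. q t u v) \<longlongrightarrow> B1 u v) (at t0)" if "u \<in> S" "v \<in> S" for u v
    using B1[OF that] by (simp add: has_vector_derivative_iff_quotient q_def)
  have keyf: "of_real (l t k - l t0 j) * d j t / of_real (t - t0) = inner_on S (apply_on S (q t) (f t)) (e t0 j)"
    if j: "j < ?n" for j t
  proof -
    have "inner_on S (apply_on S (q t) (f t)) (e t0 j) =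
       inner_on S (\<lambda>u. (1 / (of_real (t - t0) * c k t)) * apply_on S (D t) (e t k) u) (e t0 j)"
      by (rule inner_on_cong) (simp_all add: apply_on_def q_def D_def f_def c_def sum_distrib_left)
    also have "\<dots> = (1 / (of_real (t - t0) * c k t)) * (of_real (l t k - l t0 j) * c j t)"
      unfolding inner_on_scale_left key[OF j] ..
    finally show ?thesis by (simp add: d_def)
  qed
  have it: "((\<lambda>t. inner_on S (apply_on S (q t) (f t)) (e t0 j)) \<longlongrightarrow>
      inner_on S (apply_on S B1 (e t0 k)) (e t0 j)) (at t0)" for j
    by (intro tendsto_inner_on tendsto_apply_on qt ft tendsto_const)
  have dq: "((\<lambda>t. d j t / of_real (t - t0)) \<longlongrightarrow>
      inner_on S (apply_on S B1 (e t0 k)) (e t0 j) / of_real (l t0 k - l t0 j)) (at t0)" if "j \<in> ?J" for j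
  proof -
    have "\<forall>\<^sub>F t in at t0. inner_on S (apply_on S (q t) (f t)) (e t0 j) / of_real (l t k - l t0 j) =
        d j t / of_real (t - t0)"
      using ne[OF that]
    proof eventually_elim
      case (elim t)
      then have "complex_of_real (l t k - l t0 j) \<noteq> 0" unfolding of_real_eq_0_iff by simp
      then show ?case using that by (simp add: keyf[symmetric] del: of_real_diff)
    qed
    moreover have "((\<lambda>t. inner_on S (apply_on S (q t) (f t)) (e t0 j) / of_real (l t k - l t0 j)) \<longlongrightarrow>
        inner_on S (apply_on S B1 (e t0 k)) (e t0 j) / of_real (l t0 k - l t0 j)) (at t0)"
      using that simple[of j] by (intro tendsto_divide it tendsto_of_real tendsto_diff lk tendsto_const) auto
    ultimately show ?thesis by (rule Lim_transform_eventually[rotated])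
  qed
  show "((\<lambda>t. f t u) has_vector_derivative
          (\<Sum>j\<in>?J. inner_on S (apply_on S B1 (e t0 k)) (e t0 j) /
             of_real (l t0 k - l t0 j) * e t0 j u)) (at t0)" if u: "u \<in> S" for u
    unfolding has_vector_derivative_iff_quotient
  proof (rule Lim_transform_eventually)
    show "((\<lambda>t. \<Sum>j\<in>?J. d j t / of_real (t - t0) * e t0 j u) \<longlongrightarrow>
        (\<Sum>j\<in>?J. inner_on S (apply_on S B1 (e t0 k)) (e t0 j) /
             of_real (l t0 k - l t0 j) * e t0 j u)) (at t0)"
      by (intro tendsto_sum tendsto_mult dq tendsto_const)
    show "\<forall>\<^sub>F t in at t0. (\<Sum>j\<in>?J. d j t / of_real (t - t0) * e t0 j u) = (f t u - f t0 u) / of_real (t - t0)"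
      using dk by eventually_elim (simp add: fsum u f0 sum_divide_distrib)
  qed
  have "((\<lambda>t. Re (inner_on S (apply_on S (q t) (f t)) (e t0 k))) \<longlongrightarrow>
      Re (inner_on S (apply_on S B1 (e t0 k)) (e t0 k))) (at t0)"
    by (intro tendsto_Re it)
  moreover have "\<forall>\<^sub>F t in at t0. Re (inner_on S (apply_on S (q t) (f t)) (e t0 k)) = (l t k - l t0 k) / (t - t0)"
    using dk
  proof eventually_elim
    case (elim t)
    have "inner_on S (apply_on S (q t) (f t)) (e t0 k) = of_real ((l t k - l t0 k) / (t - t0))"
      using keyf[OF k, of t] elim by simp
    then show ?case by simp
  qed
  ultimately show "((\<lambda>t. l t k) has_real_derivative Re (inner_on S (apply_on S B1 (e t0 k)) (e t0 k))) (at t0)"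
    unfolding has_field_derivative_iff by (rule Lim_transform_eventually)
qed


text \<open>
  Twofold differentiability at \<open>x\<close> together with the values of both derivatives. In contrast to a
  statement about iterated \<open>deriv\<close>, it is easily transported along local equality and compositions.
\<close>

definition second_deriv :: "(real \<Rightarrow> real) \<Rightarrow> real \<Rightarrow> real \<Rightarrow> real \<Rightarrow> bool" where
  "second_deriv g x a b \<longleftrightarrow>
     (\<exists>g'. (\<forall>\<^sub>F t in nhds x. (g has_real_derivative g' t) (at t)) \<and> g' x = a \<and>
           (g' has_real_derivative b) (at x))"

lemma second_deriv_cong:
  assumes "second_deriv f x a b" "\<forall>\<^sub>F t in nhds x. f t = g t"
  shows "second_deriv g x a b"
proof -
  obtain g' where g': "\<forall>\<^sub>F t in nhds x. (f has_real_derivative g' t) (at t)" "g' x = a"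
    "(g' has_real_derivative b) (at x)"
    using assms(1) unfolding second_deriv_def by blast
  have "\<forall>\<^sub>F t in nhds x. \<forall>\<^sub>F s in nhds t. f s = g s"
    using assms(2) by (simp add: eventually_eventually)
  with g'(1) have "\<forall>\<^sub>F t in nhds x. (g has_real_derivative g' t) (at t)"
    by eventually_elim (use DERIV_cong_ev[OF refl _ refl] in blast)
  with g' show ?thesis unfolding second_deriv_def by blast
qed

lemma second_derivD:
  assumes "second_deriv g x a b"
  shows "(g has_real_derivative a) (at x)" "twice_differentiable_at g x" "(deriv ^^ 2) g x = b"
proof -
  obtain g' where g': "\<forall>\<^sub>F t in nhds x. (g has_real_derivative g' t) (at t)" "g' x = a"
    "(g' has_real_derivative b) (at x)"
    using assms unfolding second_deriv_def by blast
  show "(g has_real_derivative a) (at x)" using eventually_nhds_x_imp_x[OF g'(1)] g'(2) by simp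
  have ev: "\<forall>\<^sub>F t in nhds x. deriv g t = g' t"
    using g'(1) by eventually_elim (rule DERIV_imp_deriv)
  have dd: "(deriv g has_real_derivative b) (at x)"
    using DERIV_cong_ev[OF refl ev refl] g'(3) by blast
  show "(deriv ^^ 2) g x = b" using DERIV_imp_deriv[OF dd] by (simp add: numeral_2_eq_2)
  have "\<forall>\<^sub>F t in nhds x. g differentiable (at t)"
    using g'(1) by eventually_elim (auto simp: real_differentiable_def)
  then show "twice_differentiable_at g x"
    using dd unfolding twice_differentiable_at_def by (auto simp: real_differentiable_def)
qed

lemma second_deriv_chain:
  assumes g: "second_deriv g x a b"
    and G: "\<forall>\<^sub>F y in nhds (g x). (G has_real_derivative G' y) (at y)"
    and G': "(G' has_real_derivative c) (at (g x))"
  shows "second_deriv (\<lambda>t. G (g t)) x (G' (g x) * a) (c * a * a + G' (g x) * b)"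
proof -
  obtain g' where g': "\<forall>\<^sub>F t in nhds x. (g has_real_derivative g' t) (at t)" "g' x = a"
    "(g' has_real_derivative b) (at x)"
    using g unfolding second_deriv_def by blast
  have gx: "(g has_real_derivative a) (at x)" by (rule second_derivD(1)[OF g])
  then have "(g \<longlongrightarrow> g x) (nhds x)"
    using DERIV_isCont by (metis isCont_def tendsto_at_iff_tendsto_nhds)
  then have "\<forall>\<^sub>F t in nhds x. (G has_real_derivative G' (g t)) (at (g t))"
    using G by (auto simp: filterlim_iff)
  with g'(1) have "\<forall>\<^sub>F t in nhds x. ((\<lambda>t. G (g t)) has_real_derivative G' (g t) * g' t) (at t)"
    by eventually_elim (rule DERIV_chain2)
  moreover have "((\<lambda>t. G' (g t) * g' t) has_real_derivative (c * a * a + G' (g x) * b)) (at x)"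
  proof -
    have "((\<lambda>t. G' (g t)) has_real_derivative c * a) (at x)"
      using G' gx by (rule DERIV_chain2)
    from DERIV_mult[OF this g'(3)] show ?thesis by (simp add: g'(2) algebra_simps)
  qed
  ultimately show ?thesis unfolding second_deriv_def using g'(2)
    by (intro exI[of _ "\<lambda>t. G' (g t) * g' t"]) auto
qed

lemma has_vector_derivative_cnj_complex:
  "(f has_vector_derivative D) F \<Longrightarrow> ((\<lambda>t. cnj (f t)) has_vector_derivative cnj D) F"
  by (rule bounded_linear.has_vector_derivative[OF bounded_linear_cnj])

lemma has_vector_derivative_inner_on:
  assumes "\<And>u. u \<in> S \<Longrightarrow> ((\<lambda>t. f t u) has_vector_derivative f' u) (at x)"
    and "\<And>u. u \<in> S \<Longrightarrow> ((\<lambda>t. g t u) has_vector_derivative g' u) (at x)"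
  shows "((\<lambda>t. inner_on S (f t) (g t)) has_vector_derivative inner_on S f' (g x) + inner_on S (f x) g') (at x)"
  unfolding inner_on_def sum.distrib[symmetric]
  by (rule has_vector_derivative_sum)
    (rule has_vector_derivative_eq_rhs, rule has_vector_derivative_mult assms has_vector_derivative_cnj_complex | assumption | simp)+

lemma has_vector_derivative_apply_on:
  assumes "\<And>v. v \<in> S \<Longrightarrow> ((\<lambda>t. A t u v) has_vector_derivative A' u v) (at x)"
    and "\<And>v. v \<in> S \<Longrightarrow> ((\<lambda>t. f t v) has_vector_derivative f' v) (at x)"
  shows "((\<lambda>t. apply_on S (A t) (f t) u) has_vector_derivative
      (apply_on S A' (f x) u + apply_on S (A x) f' u)) (at x)"
  unfolding apply_on_def sum.distrib[symmetric]
  by (rule has_vector_derivative_sum)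
    (rule has_vector_derivative_eq_rhs, rule has_vector_derivative_mult assms | assumption | simp)+

lemma has_real_derivative_Re:
  assumes "(f has_vector_derivative D) (at x)"
  shows "((\<lambda>t. Re (f t)) has_real_derivative Re D) (at x)"
  unfolding has_real_derivative_iff_has_vector_derivative
  by (rule bounded_linear.has_vector_derivative[OF bounded_linear_Re assms])

text \<open>
  Second-order perturbation theory. The eigenvalue \<open>l t k\<close> is still simple for \<open>t\<close> near \<open>t0\<close>, so its first
  derivative is \<open>\<langle>B1 t f, f\<rangle> / \<langle>f, f\<rangle>\<close> for any eigenvector \<open>f\<close>. Inserting the differentiable eigenvector
  with \<open>\<langle>f, e t0 k\<rangle> = 1\<close>, whose derivative is orthogonal to \<open>e t0 k\<close>, this quotient can be differentiated
  at \<open>t0\<close>.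
\<close>

lemma simple_eigenvalue_second_deriv:
  fixes B B1 :: "real \<Rightarrow> 'a \<Rightarrow> 'a \<Rightarrow> complex"
  assumes fin: "finite S" and herm: "\<And>t. hermitian_on S (B t)"
    and eb: "\<And>t. eigenbasis S (B t) (l t) (e t)"
    and k: "k < card S"
    and simple: "\<And>j. j < card S \<Longrightarrow> j \<noteq> k \<Longrightarrow> l t0 j \<noteq> l t0 k"
    and B1: "\<And>t u v. u \<in> S \<Longrightarrow> v \<in> S \<Longrightarrow> ((\<lambda>t. B t u v) has_vector_derivative B1 t u v) (at t)"
    and B2: "\<And>u v. u \<in> S \<Longrightarrow> v \<in> S \<Longrightarrow> ((\<lambda>t. B1 t u v) has_vector_derivative B2 u v) (at t0)"
    and herm1: "hermitian_on S (B1 t0)"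
  shows "second_deriv (\<lambda>t. l t k) t0 (Re (inner_on S (apply_on S (B1 t0) (e t0 k)) (e t0 k)))
      (Re (inner_on S (apply_on S B2 (e t0 k)) (e t0 k)) +
       2 * (\<Sum>j\<in>{..<card S} - {k}. (cmod (inner_on S (apply_on S (B1 t0) (e t0 k)) (e t0 j)))\<^sup>2 /
               (l t0 k - l t0 j)))"
proof -
  let ?n = "card S" and ?J = "{..<card S} - {k}"
  let ?f0 = "e t0 k"
  let ?b = "\<lambda>j. inner_on S (apply_on S (B1 t0) ?f0) (e t0 j)"
  define f where "f t u = e t k u / inner_on S (e t k) ?f0" for t u
  define f1 where "f1 u = (\<Sum>j\<in>?J. ?b j / of_real (l t0 k - l t0 j) * e t0 j u)" for u
  note der = simple_eigenpair_derivative[OF fin herm eb k]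
  have ne0: "\<forall>\<^sub>F t in at t0. inner_on S (e t k) ?f0 \<noteq> 0" by (rule der(1)[OF simple B1])
  have f1: "((\<lambda>t. f t u) has_vector_derivative f1 u) (at t0)" if "u \<in> S" for u
    unfolding f_def f1_def using der(2)[OF simple B1 that] .
  have f0: "f t0 = ?f0" using eigenbasisD(3)[OF eb k k] by (simp add: f_def fun_eq_iff)
  have lim: "((\<lambda>t. l t j) \<longlongrightarrow> l t0 j) (nhds t0)" if "j < ?n" for j
  proof (rule eigenvalue_tendsto[OF fin eb that])
    fix u v assume "u \<in> S" "v \<in> S"
    from has_vector_derivative_continuous[OF B1[OF this, of t0]]
    show "((\<lambda>t. B t u v) \<longlongrightarrow> B t0 u v) (nhds t0)"
      unfolding isCont_def using tendsto_at_iff_tendsto_nhds[of "\<lambda>t. B t u v" t0] by blast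
  qed
  have "\<forall>\<^sub>F t in nhds t0. \<forall>j\<in>?J. l t j \<noteq> l t k"
  proof (intro eventually_ball_finite ballI)
    fix j assume j: "j \<in> ?J"
    have "((\<lambda>t. l t j - l t k) \<longlongrightarrow> l t0 j - l t0 k) (nhds t0)" using j k by (intro tendsto_diff lim) auto
    then show "\<forall>\<^sub>F t in nhds t0. l t j \<noteq> l t k"
      using tendsto_imp_eventually_ne[of _ "l t0 j - l t0 k" _ 0] simple[of j] j
      by (force elim: eventually_mono)
  qed auto
  then have d1: "\<forall>\<^sub>F t in nhds t0. ((\<lambda>t. l t k) has_real_derivative
      Re (inner_on S (apply_on S (B1 t) (e t k)) (e t k))) (at t)"
    by eventually_elim (rule der(3)[OF _ B1], auto)
  define N where "N t = Re (inner_on S (apply_on S (B1 t) (f t)) (f t))" for t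
  define M where "M t = Re (inner_on S (f t) (f t))" for t
  have ne: "\<forall>\<^sub>F t in nhds t0. inner_on S (e t k) ?f0 \<noteq> 0"
    using ne0 eigenbasisD(3)[OF eb k k, of t0] by (simp add: eventually_nhds_conv_at)
  have "\<forall>\<^sub>F t in nhds t0. Re (inner_on S (apply_on S (B1 t) (e t k)) (e t k)) = N t / M t"
    using ne
  proof eventually_elim
    case (elim t)
    define c where "c = inner_on S (e t k) ?f0"
    have c: "c \<noteq> 0" using elim by (simp add: c_def)
    have fc: "f t = (\<lambda>u. (1 / c) * e t k u)" by (simp add: f_def c_def fun_eq_iff)
    have cc: "(1 / c) * cnj (1 / c) = of_real ((cmod (1 / c))\<^sup>2)"
      by (simp only: complex_norm_square)
    have "inner_on S (apply_on S (B1 t) (f t)) (f t) =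
        (1 / c) * cnj (1 / c) * inner_on S (apply_on S (B1 t) (e t k)) (e t k)"
      unfolding fc apply_on_scale inner_on_scale_left inner_on_scale_right
      by (simp only: mult_ac)
    then have 1: "N t = (cmod (1 / c))\<^sup>2 * Re (inner_on S (apply_on S (B1 t) (e t k)) (e t k))"
      unfolding N_def cc by (simp del: of_real_power)
    have "inner_on S (f t) (f t) = (1 / c) * cnj (1 / c) * inner_on S (e t k) (e t k)"
      unfolding fc inner_on_scale_left inner_on_scale_right by (simp only: mult_ac)
    then have 2: "M t = (cmod (1 / c))\<^sup>2"
      unfolding M_def cc using eigenbasisD(3)[OF eb k k, of t] by (simp del: of_real_power)
    show ?case using c unfolding 1 2 by simp
  qed
  with d1 have ev: "\<forall>\<^sub>F t in nhds t0. ((\<lambda>t. l t k) has_real_derivative N t / M t) (at t)"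
    by eventually_elim simp
  have N': "(N has_real_derivative Re (inner_on S (\<lambda>u. apply_on S B2 ?f0 u + apply_on S (B1 t0) f1 u) ?f0 +
      inner_on S (apply_on S (B1 t0) ?f0) f1)) (at t0)"
    unfolding N_def
    by (rule has_real_derivative_Re, rule has_vector_derivative_eq_rhs, rule has_vector_derivative_inner_on,
        rule has_vector_derivative_apply_on, rule B2, assumption, assumption, rule f1, assumption, rule f1,
        assumption, simp add: f0)
  have M': "(M has_real_derivative Re (inner_on S f1 ?f0 + inner_on S ?f0 f1)) (at t0)"
    unfolding M_def
    by (rule has_real_derivative_Re, rule has_vector_derivative_eq_rhs, rule has_vector_derivative_inner_on,
        rule f1, assumption, rule f1, assumption, simp add: f0)
  have f1f0: "inner_on S f1 ?f0 = 0"
    unfolding f1_def inner_on_sum_left using k by (intro sum.neutral) (auto simp: eigenbasisD(3)[OF eb])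
  then have f0f1: "inner_on S ?f0 f1 = 0" by (subst inner_on_cnj) simp
  have M0: "M t0 = 1" by (simp add: M_def f0 eigenbasisD(3)[OF eb k k])
  have N0: "N t0 = Re (inner_on S (apply_on S (B1 t0) ?f0) ?f0)" by (simp add: N_def f0)
  have a: "inner_on S (apply_on S (B1 t0) ?f0) f1 =
     of_real (\<Sum>j\<in>?J. (cmod (?b j))\<^sup>2 / (l t0 k - l t0 j))"
    unfolding f1_def inner_on_sum_right of_real_sum
  proof (rule sum.cong[OF refl])
    fix j
    have "cnj (?b j / of_real (l t0 k - l t0 j)) * ?b j = (?b j * cnj (?b j)) / of_real (l t0 k - l t0 j)"
      by (simp add: mult.commute)
    also have "\<dots> = of_real ((cmod (?b j))\<^sup>2 / (l t0 k - l t0 j))"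
      by (simp only: complex_norm_square[symmetric] of_real_divide)
    finally show "cnj (?b j / of_real (l t0 k - l t0 j)) * ?b j = of_real ((cmod (?b j))\<^sup>2 / (l t0 k - l t0 j))" .
  qed
  have "inner_on S (apply_on S (B1 t0) f1) ?f0 = inner_on S f1 (apply_on S (B1 t0) ?f0)"
    by (rule hermitian_on_adjoint[OF herm1])
  also have "\<dots> = cnj (inner_on S (apply_on S (B1 t0) ?f0) f1)" by (rule inner_on_cnj)
  finally have b: "inner_on S (apply_on S (B1 t0) f1) ?f0 = of_real (\<Sum>j\<in>?J. (cmod (?b j))\<^sup>2 / (l t0 k - l t0 j))"
    unfolding a by simp
  have add: "inner_on S (\<lambda>u. g u + h u) ?f0 = inner_on S g ?f0 + inner_on S h ?f0" for g h
    by (simp add: inner_on_def sum.distrib distrib_right)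
  have "((\<lambda>t. N t / M t) has_real_derivative
      (Re (inner_on S (\<lambda>u. apply_on S B2 ?f0 u + apply_on S (B1 t0) f1 u) ?f0 +
      inner_on S (apply_on S (B1 t0) ?f0) f1) * M t0 - N t0 * Re (inner_on S f1 ?f0 + inner_on S ?f0 f1)) /
      (M t0 * M t0)) (at t0)"
    by (rule DERIV_divide[OF N' M']) (simp add: M0)
  then have "((\<lambda>t. N t / M t) has_real_derivative
      (Re (inner_on S (apply_on S B2 ?f0) ?f0) + 2 * (\<Sum>j\<in>?J. (cmod (?b j))\<^sup>2 / (l t0 k - l t0 j)))) (at t0)"
    unfolding M0 f1f0 f0f1 add a b by (simp add: add.commute del: of_real_power of_real_divide of_real_sum)
  then show ?thesis using ev unfolding second_deriv_def
    by (intro exI[of _ "\<lambda>t. N t / M t"]) (simp add: M0 N0)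
qed

section \<open>Eigenvalue lists without the flat part\<close>

lemma sum_fun_apply: "(\<Sum>v\<in>B. F v) x = (\<Sum>v\<in>B. F v x)" for F :: "'b \<Rightarrow> 'a \<Rightarrow> complex"
  by (induction B rule: infinite_finite_induct) auto

lemma eigenspace_dim:
  assumes fin: "finite S" and herm: "hermitian_on S A" and eb: "eigenbasis S A l e"
  shows "cfun.dim {f. (\<forall>u. u \<notin> S \<longrightarrow> f u = 0) \<and>
       (\<forall>u\<in>S. (\<Sum>v\<in>S. A u v * f v) = complex_of_real c * f u)} = card {j. j < card S \<and> l j = c}"
proof -
  let ?V = "{f. (\<forall>u. u \<notin> S \<longrightarrow> f u = 0) \<and> (\<forall>u\<in>S. (\<Sum>v\<in>S. A u v * f v) = complex_of_real c * f u)}"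
  define J where "J = {j. j < card S \<and> l j = c}"
  have J: "finite J" "\<And>j. j \<in> J \<Longrightarrow> j < card S" "\<And>j. j \<in> J \<Longrightarrow> l j = c" by (auto simp: J_def)
  note on = eigenbasisD(3)[OF eb]
  have inj: "inj_on e J"
  proof (rule inj_onI)
    fix i j assume ij: "i \<in> J" "j \<in> J" "e i = e j"
    then have "inner_on S (e i) (e j) = 1" using on[of j j] J by simp
    then show "i = j" using on[of i j] J ij by (metis zero_neq_one)
  qed
  have "cfun.dim ?V = card J"
  proof (rule cfun.dim_unique)
    show "e ` J \<subseteq> ?V"
      using eigenbasisD(1,2)[OF eb] J by (auto simp: apply_on_def)
    show "?V \<subseteq> cfun.span (e ` J)"
    proof
      fix f assume f: "f \<in> ?V"
      have z: "inner_on S f (e j) = 0" if "j < card S" "j \<notin> J" for j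
      proof -
        have "of_real c * inner_on S f (e j) = inner_on S (apply_on S A f) (e j)"
          unfolding inner_on_scale_left[symmetric]
          by (rule inner_on_cong) (use f in \<open>auto simp: apply_on_def\<close>)
        also have "\<dots> = inner_on S f (apply_on S A (e j))" by (rule hermitian_on_adjoint[OF herm])
        also have "\<dots> = inner_on S f (\<lambda>u. of_real (l j) * e j u)"
          by (rule inner_on_cong) (auto simp: eigenbasisD(2)[OF eb that(1)])
        also have "\<dots> = of_real (l j) * inner_on S f (e j)" by (simp add: inner_on_scale_right)
        finally show ?thesis using that by (auto simp: J_def)
      qed
      have "f = (\<Sum>j\<in>J. (\<lambda>x. inner_on S f (e j) * e j x))"
      proof
        fix u
        show "f u = (\<Sum>j\<in>J. (\<lambda>x. inner_on S f (e j) * e j x)) u"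
        proof (cases "u \<in> S")
          case True
          have "f u = (\<Sum>j<card S. inner_on S f (e j) * e j u)"
            by (rule eigenbasis_expansion[OF fin eb True])
          also have "\<dots> = (\<Sum>j\<in>J. inner_on S f (e j) * e j u)"
            using z J by (intro sum.mono_neutral_right) auto
          finally show ?thesis by (simp add: sum_fun_apply)
        next
          case False
          then show ?thesis using f eigenbasisD(1)[OF eb] J by (simp add: sum_fun_apply)
        qed
      qed
      also have "\<dots> \<in> cfun.span (e ` J)"
        by (intro cfun.span_sum cfun.span_scale cfun.span_base) auto
      finally show "f \<in> cfun.span (e ` J)" .
    qed
    show "\<not> cfun.dependent (e ` J)"
    proof
      assume "cfun.dependent (e ` J)"
      then obtain x where x: "\<exists>v\<in>e ` J. x v \<noteq> 0" "(\<Sum>v\<in>e ` J. (\<lambda>y. x v * v y)) = 0"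
        using cfun.dependent_finite[of "e ` J"] J(1) by auto
      obtain k where k: "k \<in> J" "x (e k) \<noteq> 0" using x(1) by auto
      have "(\<Sum>j\<in>J. x (e j) * e j u) = 0" for u
        using x(2) unfolding sum.reindex[OF inj] by (simp add: fun_eq_iff sum_fun_apply)
      then have "0 = inner_on S (\<lambda>u. \<Sum>j\<in>J. x (e j) * e j u) (e k)" by (simp add: inner_on_def)
      also have "\<dots> = (\<Sum>j\<in>J. if j = k then x (e k) else 0)"
        unfolding inner_on_sum_left using on J k by (intro sum.cong) auto
      also have "\<dots> = x (e k)" using J k by simp
      finally show False using k by simp
    qed
    show "card (e ` J) = card J" by (rule card_image[OF inj])
  qed
  then show ?thesis by (simp add: J_def)
qed

lemma count_mset_of_mult:
  assumes "finite {c. 0 < m c}"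
  shows "count (mset_of_mult m) c = m c"
proof -
  have "count (mset_of_mult m) c = (\<Sum>c'\<in>{c. 0 < m c}. if c' = c then m c else 0)"
    unfolding mset_of_mult_def count_sum by (intro sum.cong) auto
  also have "\<dots> = m c" using assms by simp
  finally show ?thesis .
qed

lemma count_image_mset_set:
  "finite A \<Longrightarrow> count (image_mset f (mset_set A)) c = card {j\<in>A. f j = c}"
  by (simp add: count_image_mset Int_def vimage_def conj_commute cong: conj_cong)
  
text \<open>
  The elements of a sorted list that satisfy a downward closed predicate form an initial segment.
\<close>

lemma sorted_nth_down_closed:
  assumes "sorted xs" and P: "\<And>a b. a \<le> b \<Longrightarrow> P b \<Longrightarrow> P a" and i: "i < length xs"
  shows "P (xs ! i) \<longleftrightarrow> i < length (filter P xs)"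
proof -
  let ?I = "{j. j < length xs \<and> P (xs ! j)}"
  have len: "length (filter P xs) = card ?I" by (rule length_filter_conv_card)
  show ?thesis
  proof
    assume "P (xs ! i)"
    then have "{..i} \<subseteq> ?I" using P sorted_nth_mono[OF assms(1) _ i] i by auto
    then have "card {..i} \<le> card ?I" by (intro card_mono) auto
    then show "i < length (filter P xs)" by (simp add: len)
  next
    assume a: "i < length (filter P xs)"
    show "P (xs ! i)"
    proof (rule ccontr)
      assume n: "\<not> P (xs ! i)"
      have "?I \<subseteq> {..<i}"
      proof
        fix j assume j: "j \<in> ?I"
        show "j \<in> {..<i}"
        proof (rule ccontr)
          assume "j \<notin> {..<i}"
          then have "xs ! i \<le> xs ! j" using sorted_nth_mono[OF assms(1), of i j] j by auto
          then show False using P n j by auto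
        qed
      qed
      then have "card ?I \<le> card {..<i}" by (intro card_mono) auto
      then show False using a by (simp add: len)
    qed
  qed
qed

lemma sorted_list_of_multiset_nth_eq_iff:
  fixes X :: "real multiset"
  assumes "i < size X"
  shows "sorted_list_of_multiset X ! i = x \<longleftrightarrow>
    size (filter_mset (\<lambda>y. y < x) X) \<le> i \<and> i < size (filter_mset (\<lambda>y. y \<le> x) X)"
proof -
  let ?xs = "sorted_list_of_multiset X"
  have sz: "length (filter Q ?xs) = size (filter_mset Q X)" for Q
    by (metis mset_filter mset_sorted_list_of_multiset size_mset)
  have i: "i < length ?xs" using assms by (metis mset_sorted_list_of_multiset size_mset)
  have s: "sorted ?xs" by simp
  have "?xs ! i < x \<longleftrightarrow> i < size (filter_mset (\<lambda>y. y < x) X)"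
    using sorted_nth_down_closed[OF s _ i, of "\<lambda>y. y < x"] unfolding sz by force
  moreover have "?xs ! i \<le> x \<longleftrightarrow> i < size (filter_mset (\<lambda>y. y \<le> x) X)"
    using sorted_nth_down_closed[OF s _ i, of "\<lambda>y. y \<le> x"] unfolding sz by force
  ultimately show ?thesis by auto
qed

lemma size_filter_image_mset_set:
  "finite A \<Longrightarrow> size (filter_mset Q (image_mset f (mset_set A))) = card {j\<in>A. Q (f j)}"
  by (simp add: filter_mset_image_mset filter_mset_mset_set o_def)

text \<open>
  Of the eigenvalues below \<open>l k\<close> there are \<open>k\<close>, and those that belong to \<open>F\<close> are removed from the list.
\<close>

lemma remaining_simple_eigenvalue_rank:
  fixes l :: "nat \<Rightarrow> real"
  assumes M: "M = image_mset l (mset_set {..<n})" and FM: "F \<subseteq># M"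
    and i: "i < n - size F" and k: "k < n"
    and lt: "\<And>j. j < k \<Longrightarrow> l j < l k" and gt: "\<And>j. k < j \<Longrightarrow> j < n \<Longrightarrow> l k < l j"
    and F: "l k \<notin># F"
  shows "sorted_list_of_multiset (M - F) ! i = l k \<longleftrightarrow> i + size (filter_mset (\<lambda>y. y < l k) F) = k"
proof -
  have sM: "size M = n" by (simp add: M)
  have dm: "size (filter_mset Q (M - F)) = size (filter_mset Q M) - size (filter_mset Q F)" for Q
    unfolding filter_diff_mset by (rule size_Diff_submset) (rule multiset_filter_mono[OF FM])
  have le: "size (filter_mset Q F) \<le> size (filter_mset Q M)" for Q
    by (intro size_mset_mono multiset_filter_mono FM)
  have "{j \<in> {..<n}. l j < l k} = {..<k}" using k lt gt
    by (auto simp: not_less[symmetric]) (metis less_irrefl less_trans linorder_neqE_nat)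
  then have 1: "size (filter_mset (\<lambda>y. y < l k) M) = k"
    unfolding M by (subst size_filter_image_mset_set) auto
  have "{j \<in> {..<n}. l j \<le> l k} = {..k}"
  proof (intro set_eqI iffI)
    fix j assume "j \<in> {j \<in> {..<n}. l j \<le> l k}"
    then show "j \<in> {..k}" using gt[of j] by force
  next
    fix j assume "j \<in> {..k}"
    then show "j \<in> {j \<in> {..<n}. l j \<le> l k}" using lt[of j] k by (cases "j = k") auto
  qed
  then have 2: "size (filter_mset (\<lambda>y. y \<le> l k) M) = Suc k"
    unfolding M by (subst size_filter_image_mset_set) auto
  have 3: "filter_mset (\<lambda>y. y \<le> l k) F = filter_mset (\<lambda>y. y < l k) F"
    using F by (intro filter_mset_cong refl) (auto simp: le_less)
  have sz: "i < size (M - F)" using i FM by (simp add: size_Diff_submset sM)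
  show ?thesis
    unfolding sorted_list_of_multiset_nth_eq_iff[OF sz] dm 1 2 3
    using le[of "\<lambda>y. y < l k"] unfolding 1 by auto
qed

text \<open>
  For \<open>p\<close> near \<open>p0\<close> the eigenvalue \<open>l p k\<close> has crossed neither another eigenvalue nor an element of \<open>F\<close>.
  Hence the number of elements of \<open>F\<close> below it, and with it its rank in the remaining list, is the
  same as at \<open>p0\<close>.
\<close>

lemma remaining_simple_eigenvalue_continuation:
  fixes l :: "'p::topological_space \<Rightarrow> nat \<Rightarrow> real"
  assumes mono: "\<And>p i j. i \<le> j \<Longrightarrow> j < n \<Longrightarrow> l p i \<le> l p j"
    and M: "\<And>p. M p = image_mset (l p) (mset_set {..<n})" and FM: "\<And>p. F \<subseteq># M p"
    and i: "i < n - size F" and k: "k < n"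
    and lim: "\<And>j. j < n \<Longrightarrow> ((\<lambda>p. l p j) \<longlongrightarrow> l p0 j) (nhds p0)"
    and simple: "\<And>j. j < n \<Longrightarrow> j \<noteq> k \<Longrightarrow> l p0 j \<noteq> l p0 k"
    and F: "l p0 k \<notin># F"
    and start: "sorted_list_of_multiset (M p0 - F) ! i = l p0 k"
  shows "\<forall>\<^sub>F p in nhds p0. sorted_list_of_multiset (M p - F) ! i = l p k"
proof -
  have lt0: "l p0 j < l p0 k" if "j < k" for j
    using mono[of j k p0] simple[of j] that k by (simp add: le_less)
  have gt0: "l p0 k < l p0 j" if "k < j" "j < n" for j
    using mono[of k j p0] simple[of j] that by (simp add: le_less)
  have lt: "\<forall>\<^sub>F p in nhds p0. \<forall>j\<in>{..<k}. l p j < l p k"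
  proof (intro eventually_ball_finite ballI)
    fix j assume j: "j \<in> {..<k}"
    have "((\<lambda>p. l p k - l p j) \<longlongrightarrow> l p0 k - l p0 j) (nhds p0)" using j k by (intro tendsto_diff lim) auto
    then show "\<forall>\<^sub>F p in nhds p0. l p j < l p k"
      using order_tendstoD(1)[of _ "l p0 k - l p0 j" _ 0] lt0 j by (force elim: eventually_mono)
  qed auto
  have gt: "\<forall>\<^sub>F p in nhds p0. \<forall>j\<in>{k<..<n}. l p k < l p j"
  proof (intro eventually_ball_finite ballI)
    fix j assume j: "j \<in> {k<..<n}"
    have "((\<lambda>p. l p j - l p k) \<longlongrightarrow> l p0 j - l p0 k) (nhds p0)" using j k by (intro tendsto_diff lim) auto
    then show "\<forall>\<^sub>F p in nhds p0. l p k < l p j"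
      using order_tendstoD(1)[of _ "l p0 j - l p0 k" _ 0] gt0 j by (force elim: eventually_mono)
  qed auto
  have FF: "\<forall>\<^sub>F p in nhds p0. \<forall>c\<in>set_mset F. (c < l p k \<longleftrightarrow> c < l p0 k) \<and> c \<noteq> l p k"
  proof (intro eventually_ball_finite ballI)
    fix c assume "c \<in># F"
    then have "c \<noteq> l p0 k" using F by auto
    then consider "c < l p0 k" | "l p0 k < c" by linarith
    then show "\<forall>\<^sub>F p in nhds p0. (c < l p k \<longleftrightarrow> c < l p0 k) \<and> c \<noteq> l p k"
    proof cases
      case 1
      show ?thesis using order_tendstoD(1)[OF lim[OF k] 1] by eventually_elim (use 1 in auto)
    next
      case 2
      show ?thesis using order_tendstoD(2)[OF lim[OF k] 2] by eventually_elim (use 2 in auto)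
    qed
  qed auto
  have rank0: "i + size (filter_mset (\<lambda>y. y < l p0 k) F) = k"
    using remaining_simple_eigenvalue_rank[OF M FM i k lt0 gt0 F] start by simp
  show ?thesis using lt gt FF
  proof eventually_elim
    case (elim p)
    have "filter_mset (\<lambda>y. y < l p k) F = filter_mset (\<lambda>y. y < l p0 k) F"
      using elim(3) by (intro filter_mset_cong refl) auto
    moreover have "l p k \<notin># F" using elim(3) by auto
    ultimately show ?case
      using remaining_simple_eigenvalue_rank[OF M FM i k, of p] elim(1,2) rank0 by auto
  qed
qed

section \<open>Periodic graphs and their quotients\<close>

lemma shortest_path:
  assumes "(u, v) \<in> r\<^sup>*"
  shows "\<exists>m w. w 0 = u \<and> w m = v \<and> (\<forall>i<m. (w i, w (Suc i)) \<in> r) \<and> inj_on w {..m :: nat}"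
proof -
  obtain m where m: "(u, v) \<in> r ^^ m" "\<And>m'. (u, v) \<in> r ^^ m' \<Longrightarrow> m \<le> m'"
  proof -
    have "\<exists>m. (u, v) \<in> r ^^ m" using rtrancl_imp_relpow[OF assms] by blast
    then have "(u, v) \<in> r ^^ (LEAST m. (u, v) \<in> r ^^ m)" by (rule LeastI_ex)
    then show ?thesis by (rule that) (rule Least_le)
  qed
  obtain w where w: "w 0 = u" "w m = v" "\<forall>i<m. (w i, w (Suc i)) \<in> r"
    using m(1) unfolding relpow_fun_conv by blast
  \<comment> \<open>A repeated vertex could be short-cut.\<close>
  have "False" if "i < j" "j \<le> m" "w i = w j" for i j
  proof -
    have "(u, w i) \<in> r ^^ i" unfolding relpow_fun_conv
      by (rule exI[of _ w]) (use w that in auto)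
    moreover have "(w j, v) \<in> r ^^ (m - j)" unfolding relpow_fun_conv
      by (rule exI[of _ "\<lambda>i. w (j + i)"]) (use w that in auto)
    ultimately have "(u, v) \<in> r ^^ (i + (m - j))" using that(3) by (auto simp: relpow_add)
    then show False using m(2)[of "i + (m - j)"] that by simp
  qed
  then have "inj_on w {..m}" by (intro inj_onI) (metis atMost_iff linorder_neqE_nat)
  then show ?thesis using w by blast
qed

lemma connected_imp_rtrancl:
  assumes "Digraph_Component.connected G" "u \<in> verts G" "v \<in> verts G"
  shows "(u, v) \<in> {(a, b). \<exists>e\<in>arcs G. (a = tail G e \<and> b = head G e) \<or> (a = head G e \<and> b = tail G e)}\<^sup>*"
proof -
  have "(u, v) \<in> rtrancl_on (verts G) (parcs (mk_symmetric G))"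
    using assms unfolding connected_def strongly_connected_def reachable_def
    by (simp add: mk_symmetric_def)
  then show ?thesis
  proof (induction rule: rtrancl_on_induct)
    case (step y z)
    then show ?case by (intro rtrancl_into_rtrancl[OF step(5)]) (auto simp: mk_symmetric_def)
  qed auto
qed

text \<open>
  The Floquet matrix and its directional derivatives all arise from weights on the oriented edges in
  this way, up to the identity matrix.
\<close>

definition arc_matrix ::
    "('v, 'e, 'd::finite) zd_graph \<Rightarrow> ('e set \<times> bool \<Rightarrow> complex) \<Rightarrow> 'v set \<Rightarrow> 'v set \<Rightarrow> complex" where
  "arc_matrix P w u v =
     (\<Sum>a \<in> {a \<in> arcs (oriented (quotient_graph P)).
               tail (oriented (quotient_graph P)) a = u \<and>
               head (oriented (quotient_graph P)) a = v}. w a)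
     / complex_of_real (sqrt (real (degree (quotient_graph P) u) *
                              real (degree (quotient_graph P) v)))"

text \<open>
  In terms of these rescaled functions the forms of all such matrices are sums over oriented edges,
  without degrees.
\<close>

definition normalized :: "('v, 'e, 'd::finite) zd_graph \<Rightarrow> ('v set \<Rightarrow> complex) \<Rightarrow> 'v set \<Rightarrow> complex" where
  "normalized P f v = f v / complex_of_real (sqrt (real (degree (quotient_graph P) v)))"

locale periodic_graph_with_tree = periodic_graph P
  for P :: "('v, 'e, 'd::finite) zd_graph" +
  fixes T :: "('v, 'e) pre_digraph"
  assumes tree: "fundamental_tree P T"
begin

abbreviation "G \<equiv> gph P"
abbreviation "Q \<equiv> quotient_graph P"
abbreviation "S \<equiv> verts (quotient_graph P)"
abbreviation "V0 \<equiv> verts T"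
abbreviation "A \<equiv> arcs (quotient_graph P)"
abbreviation "\<kappa> u \<equiv> degree (quotient_graph P) u"
abbreviation "src \<equiv> tail (oriented (quotient_graph P))"
abbreviation "tgt \<equiv> head (oriented (quotient_graph P))"

section \<open>Orbits\<close>

lemma vact_inv: "v \<in> verts G \<Longrightarrow> vact P (- m) (vact P m v) = v"
  using vact_add[of v "- m" m] vact_zero by simp

lemma vorbit_vact: "v \<in> verts G \<Longrightarrow> vorbit P (vact P m v) = vorbit P v"
proof -
  assume v: "v \<in> verts G"
  have "vact P n (vact P m v) \<in> vorbit P v" for n
    unfolding vorbit_def vact_add[OF v, of n m, symmetric] by (rule rangeI)
  moreover have "vact P n v \<in> vorbit P (vact P m v)" for n
    unfolding vorbit_def using vact_add[OF v, of "n - m" m] by (simp add: image_iff) metis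
  ultimately show ?thesis by (auto simp: vorbit_def)
qed

lemma eorbit_eact: "e \<in> arcs G \<Longrightarrow> eorbit P (eact P m e) = eorbit P e"
proof -
  assume v: "e \<in> arcs G"
  have "eact P n (eact P m e) \<in> eorbit P e" for n
    unfolding eorbit_def eact_add[OF v, of n m, symmetric] by (rule rangeI)
  moreover have "eact P n e \<in> eorbit P (eact P m e)" for n
    unfolding eorbit_def using eact_add[OF v, of "n - m" m] by (simp add: image_iff) metis
  ultimately show ?thesis by (auto simp: eorbit_def)
qed

lemma self_in_vorbit: "v \<in> verts G \<Longrightarrow> v \<in> vorbit P v"
  unfolding vorbit_def by (metis vact_zero rangeI)

lemma self_in_eorbit: "e \<in> arcs G \<Longrightarrow> e \<in> eorbit P e"
  unfolding eorbit_def by (metis eact_zero rangeI)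

lemma vorbit_eqD: "v \<in> verts G \<Longrightarrow> w \<in> verts G \<Longrightarrow> vorbit P v = vorbit P w \<Longrightarrow> \<exists>m. v = vact P m w"
  using self_in_vorbit[of v] unfolding vorbit_def by auto

lemma eorbit_eqD: "v \<in> arcs G \<Longrightarrow> w \<in> arcs G \<Longrightarrow> eorbit P v = eorbit P w \<Longrightarrow> \<exists>m. v = eact P m w"
  using self_in_eorbit[of v] unfolding eorbit_def by auto

lemma S_eq: "S = vorbit P ` verts G" by (simp add: quotient_graph_def)
lemma A_eq: "A = eorbit P ` arcs G" by (simp add: quotient_graph_def)

lemma tail_in [simp]: "e \<in> arcs G \<Longrightarrow> tail G e \<in> verts G"
  and head_in [simp]: "e \<in> arcs G \<Longrightarrow> head G e \<in> verts G"
  using wf by (auto simp: wf_digraph_def)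

lemma some_eorbit: "e \<in> arcs G \<Longrightarrow> \<exists>m. (SOME e'. e' \<in> eorbit P e) = eact P m e"
  using someI[of "\<lambda>e'. e' \<in> eorbit P e" e] self_in_eorbit[of e] by (auto simp: eorbit_def)

lemma tail_Q: "e \<in> arcs G \<Longrightarrow> tail Q (eorbit P e) = vorbit P (tail G e)"
  using some_eorbit[of e] by (auto simp: quotient_graph_def tail_eact vorbit_vact)

lemma head_Q: "e \<in> arcs G \<Longrightarrow> head Q (eorbit P e) = vorbit P (head G e)"
  using some_eorbit[of e] by (auto simp: quotient_graph_def head_eact vorbit_vact)

lemma tail_Q_in [simp]: "x \<in> A \<Longrightarrow> tail Q x \<in> S"
  by (auto simp: A_eq tail_Q) (auto simp: S_eq)

lemma head_Q_in [simp]: "x \<in> A \<Longrightarrow> head Q x \<in> S"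
  by (auto simp: A_eq head_Q) (auto simp: S_eq)

section \<open>Cells and indices\<close>

lemma T_facts:
  "V0 \<subseteq> verts G" "arcs T \<subseteq> arcs G" "tail T = tail G" "head T = head G"
  "\<And>e. e \<in> arcs T \<Longrightarrow> tail G e \<in> V0" "\<And>e. e \<in> arcs T \<Longrightarrow> head G e \<in> V0"
  "Digraph_Component.connected T" "card V0 = card S"
  "\<And>u v. u \<in> V0 \<Longrightarrow> v \<in> V0 \<Longrightarrow> u \<noteq> v \<Longrightarrow> v \<notin> vorbit P u"
  using tree unfolding fundamental_tree_def subgraph_def undirected_tree_def compatible_def nu_def
  by (auto simp: wf_digraph_def)

text \<open>
  Non-equivalent vertices have different orbits, and the tree has as many vertices as there are orbits.
\<close>

lemma vorbit_bij: "bij_betw (vorbit P) V0 S"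
proof -
  have inj: "inj_on (vorbit P) V0"
    by (rule inj_onI) (metis T_facts(1) T_facts(9) self_in_vorbit subsetD)
  have sub: "vorbit P ` V0 \<subseteq> S" using T_facts(1) by (auto simp: S_eq)
  have "card (vorbit P ` V0) = card S" using card_image[OF inj] T_facts(8) by simp
  then have "vorbit P ` V0 = S" by (rule card_subset_eq[OF finite_quotient_verts sub])
  with inj show ?thesis by (simp add: bij_betw_def)
qed

lemma vertex_decomposition:
  assumes v: "v \<in> verts G" shows "\<exists>m. \<exists>v0\<in>V0. v = vact P m v0"
proof -
  have "vorbit P v \<in> vorbit P ` V0" using vorbit_bij v by (auto simp: bij_betw_def S_eq)
  then obtain v0 where "v0 \<in> V0" "vorbit P v = vorbit P v0" by auto
  then show ?thesis using vorbit_eqD[of v v0] v T_facts(1) by blast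
qed

lemma cell_vact_V0: "v0 \<in> V0 \<Longrightarrow> cell P V0 (vact P m v0) = m"
  unfolding cell_def
proof (rule the_equality)
  assume v0: "v0 \<in> V0"
  then have v0G: "v0 \<in> verts G" using T_facts(1) by auto
  show "\<exists>v1\<in>V0. vact P m v0 = vact P m v1" using v0 by blast
  fix n assume "\<exists>v1\<in>V0. vact P m v0 = vact P n v1"
  then obtain v1 where v1: "v1 \<in> V0" "vact P m v0 = vact P n v1" by blast
  then have v1G: "v1 \<in> verts G" using T_facts(1) by auto
  have "vorbit P v0 = vorbit P v1" by (metis v1(2) vorbit_vact v0G v1G)
  then have "v0 = v1" using vorbit_bij v0 v1(1) by (auto simp: bij_betw_def dest: inj_onD)
  then have "vact P (- n + m) v0 = vact P (- n) (vact P n v0)"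
    using vact_add[OF v0G, of "- n" m] v1(2) by simp
  then have "vact P (- n + m) v0 = v0" using vact_inv[OF v0G] by simp
  then have "- n + m = 0" by (rule free[OF v0G])
  then show "n = m" by simp
qed

lemma cell_V0: "v0 \<in> V0 \<Longrightarrow> cell P V0 v0 = 0"
  using cell_vact_V0[of v0 0] vact_zero T_facts(1) by auto

lemma cell_vact: "v \<in> verts G \<Longrightarrow> cell P V0 (vact P m v) = m + cell P V0 v"
proof -
  assume "v \<in> verts G"
  then obtain n v0 where v: "v0 \<in> V0" "v = vact P n v0" using vertex_decomposition by blast
  then have "vact P m v = vact P (m + n) v0" using vact_add[of v0] T_facts(1) by auto
  then show ?thesis using v cell_vact_V0 by simp
qed

lemma edge_index_eact: "e \<in> arcs G \<Longrightarrow> edge_index P V0 (eact P m e) = edge_index P V0 e"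
  by (simp add: edge_index_def head_eact tail_eact cell_vact)

lemma tau_eorbit: "e \<in> arcs G \<Longrightarrow> tau P V0 (eorbit P e) = real_vec (edge_index P V0 e)"
  using some_eorbit[of e] by (auto simp: tau_def edge_index_eact)

lemma tau_tree: "e \<in> arcs T \<Longrightarrow> tau P V0 (eorbit P e) = 0"
  using tau_eorbit[of e] T_facts by (auto simp: edge_index_def cell_V0 real_vec_def vec_eq_iff)

text \<open>
  The projection to the quotient is a bijection on the edges leaving a vertex because the action is
  free on vertices.
\<close>

lemma eorbit_out_arcs: "v \<in> verts G \<Longrightarrow> bij_betw (eorbit P) (out_arcs G v) (out_arcs Q (vorbit P v))"
proof -
  assume v: "v \<in> verts G"
  have "inj_on (eorbit P) (out_arcs G v)"
  proof (rule inj_onI)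
    fix e e' assume e: "e \<in> out_arcs G v" "e' \<in> out_arcs G v" "eorbit P e = eorbit P e'"
    then obtain m where m: "e = eact P m e'" using eorbit_eqD[of e e'] by auto
    then have "vact P m v = v" using e tail_eact[of e' m] by auto
    then have "m = 0" by (rule free[OF v])
    then show "e = e'" using m eact_zero e by auto
  qed
  moreover have "eorbit P ` out_arcs G v = out_arcs Q (vorbit P v)"
  proof (intro set_eqI iffI)
    fix x assume "x \<in> out_arcs Q (vorbit P v)"
    then obtain e where e: "e \<in> arcs G" "x = eorbit P e" "vorbit P v = vorbit P (tail G e)"
      by (auto simp: out_arcs_def A_eq tail_Q)
    obtain m where "v = vact P m (tail G e)" using vorbit_eqD[OF v _ e(3)] e(1) by auto
    then have "eact P m e \<in> out_arcs G v" using e(1) by (auto simp: eact_closed tail_eact)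
    then show "x \<in> eorbit P ` out_arcs G v" using e eorbit_eact by (metis image_eqI)
  qed (auto simp: out_arcs_def A_eq tail_Q)
  ultimately show ?thesis by (simp add: bij_betw_def)
qed

lemma eorbit_in_arcs: "v \<in> verts G \<Longrightarrow> bij_betw (eorbit P) (in_arcs G v) (in_arcs Q (vorbit P v))"
proof -
  assume v: "v \<in> verts G"
  have "inj_on (eorbit P) (in_arcs G v)"
  proof (rule inj_onI)
    fix e e' assume e: "e \<in> in_arcs G v" "e' \<in> in_arcs G v" "eorbit P e = eorbit P e'"
    then obtain m where m: "e = eact P m e'" using eorbit_eqD[of e e'] by auto
    then have "vact P m v = v" using e head_eact[of e' m] by auto
    then have "m = 0" by (rule free[OF v])
    then show "e = e'" using m eact_zero e by auto
  qed
  moreover have "eorbit P ` in_arcs G v = in_arcs Q (vorbit P v)"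
  proof (intro set_eqI iffI)
    fix x assume "x \<in> in_arcs Q (vorbit P v)"
    then obtain e where e: "e \<in> arcs G" "x = eorbit P e" "vorbit P v = vorbit P (head G e)"
      by (auto simp: in_arcs_def A_eq head_Q)
    obtain m where "v = vact P m (head G e)" using vorbit_eqD[OF v _ e(3)] e(1) by auto
    then have "eact P m e \<in> in_arcs G v" using e(1) by (auto simp: eact_closed head_eact)
    then show "x \<in> eorbit P ` in_arcs G v" using e eorbit_eact by (metis image_eqI)
  qed (auto simp: in_arcs_def A_eq head_Q)
  ultimately show ?thesis by (simp add: bij_betw_def)
qed

text \<open>
  The graph is infinite and connected, so every vertex is joined to another one.
\<close>

lemma incident_arc: "v \<in> verts G \<Longrightarrow> \<exists>e\<in>arcs G. tail G e = v \<or> head G e = v"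
proof -
  assume v: "v \<in> verts G"
  have "verts G \<noteq> {v}" using inf by auto
  then obtain w where w: "w \<in> verts G" "w \<noteq> v" using v by auto
  from connected_imp_rtrancl[OF conn v w(1)]
  show ?thesis
  proof (cases rule: converse_rtranclE)
    case base
    then show ?thesis using w(2) by simp
  next
    case (step y)
    then show ?thesis by auto
  qed
qed

lemma fin_arcs: "finite (out_arcs Q u)" "finite (in_arcs Q u)"
  using finite_quotient_arcs by (auto simp: out_arcs_def in_arcs_def)

lemma degree_pos: "u \<in> S \<Longrightarrow> 0 < \<kappa> u"
proof -
  assume "u \<in> S"
  then obtain v where v: "v \<in> verts G" "u = vorbit P v" by (auto simp: S_eq)
  obtain e where "e \<in> arcs G" "tail G e = v \<or> head G e = v" using incident_arc[OF v(1)] by auto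
  then have "eorbit P e \<in> out_arcs Q u \<or> eorbit P e \<in> in_arcs Q u"
    using v by (auto simp: out_arcs_def in_arcs_def A_eq tail_Q head_Q)
  then show ?thesis using fin_arcs[of u] unfolding degree_def out_degree_def in_degree_def
    by (metis add_gr_0 card_gt_0_iff empty_iff)
qed

lemma card_S_pos: "0 < card S"
  using inf finite_quotient_verts by (auto simp: card_gt_0_iff S_eq)

section \<open>Sums over oriented edges\<close>

lemma sum_oriented_tail:
  "(\<Sum>a\<in>{a \<in> arcs (oriented Q). src a = u}. F a) =
   (\<Sum>x\<in>out_arcs Q u. F (x, True)) + (\<Sum>x\<in>in_arcs Q u. F (x, False))" for F :: "_ \<Rightarrow> 'b::comm_monoid_add"
proof -
  have "{a \<in> arcs (oriented Q). src a = u} =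
      (\<lambda>x. (x, True)) ` out_arcs Q u \<union> (\<lambda>x. (x, False)) ` in_arcs Q u"
    by (auto simp: oriented_def out_arcs_def in_arcs_def image_iff split: if_splits)
  moreover have "sum F ((\<lambda>x. (x, True)) ` out_arcs Q u \<union> (\<lambda>x. (x, False)) ` in_arcs Q u) =
     sum F ((\<lambda>x. (x, True)) ` out_arcs Q u) + sum F ((\<lambda>x. (x, False)) ` in_arcs Q u)"
    using fin_arcs[of u] by (intro sum.union_disjoint) auto
  ultimately show ?thesis by (simp add: sum.reindex inj_on_def)
qed

lemma sum_oriented: "(\<Sum>a\<in>arcs (oriented Q). F a) = (\<Sum>x\<in>A. F (x, True) + F (x, False))"
  for F :: "_ \<Rightarrow> 'b::comm_monoid_add"
proof -
  have "(\<Sum>a\<in>arcs (oriented Q). F a) = (\<Sum>x\<in>A. \<Sum>b\<in>UNIV. F (x, b))"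
    by (simp add: oriented_def sum.cartesian_product)
  then show ?thesis by (simp add: UNIV_bool add.commute)
qed

lemma fin_oriented [simp]: "finite (arcs (oriented Q))"
  using finite_quotient_arcs by (simp add: oriented_def)

lemma oriented_in [simp]: "a \<in> arcs (oriented Q) \<Longrightarrow> src a \<in> S"
  "a \<in> arcs (oriented Q) \<Longrightarrow> tgt a \<in> S"
  by (auto simp: oriented_def split: prod.splits)

lemma sum_by_tail: "(\<Sum>a\<in>arcs (oriented Q). F a) =
    (\<Sum>u\<in>S. \<Sum>a\<in>{a \<in> arcs (oriented Q). src a = u}. F a)" for F :: "_ \<Rightarrow> 'b::comm_monoid_add"
  by (rule sum.group[symmetric]) (use finite_quotient_verts in auto)

lemma card_oriented_tail: "card {a \<in> arcs (oriented Q). src a = u} = \<kappa> u"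
  using sum_oriented_tail[of "\<lambda>_. 1::nat" u] by (simp add: degree_def out_degree_def in_degree_def)

lemma apply_arc_matrix:
  assumes u: "u \<in> S"
  shows "apply_on S (arc_matrix P w) f u =
    (\<Sum>a\<in>{a \<in> arcs (oriented Q). src a = u}. w a * normalized P f (tgt a)) /
      of_real (sqrt (\<kappa> u))"
proof -
  let ?B = "{a \<in> arcs (oriented Q). src a = u}"
  have "apply_on S (arc_matrix P w) f u =
     (\<Sum>v\<in>S. \<Sum>a\<in>{a \<in> ?B. tgt a = v}. w a * normalized P f (tgt a) / of_real (sqrt (\<kappa> u)))"
    unfolding apply_on_def
  proof (rule sum.cong[OF refl])
    fix v
    have "{a \<in> ?B. tgt a = v} = {a \<in> arcs (oriented Q). src a = u \<and> tgt a = v}"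
      by auto
    then show "arc_matrix P w u v * f v = (\<Sum>a\<in>{a \<in> ?B. tgt a = v}. w a * normalized P f (tgt a) / of_real (sqrt (\<kappa> u)))"
      by (simp only: arc_matrix_def sum_divide_distrib sum_distrib_right)
        (auto simp: normalized_def real_sqrt_mult mult_ac intro!: sum.cong)
  qed
  also have "\<dots> = (\<Sum>a\<in>?B. w a * normalized P f (tgt a) / of_real (sqrt (\<kappa> u)))"
    by (rule sum.group) (use finite_quotient_verts in auto)
  finally show ?thesis by (simp add: sum_divide_distrib)
qed

lemma arc_matrix_form:
  "inner_on S (apply_on S (arc_matrix P w) f) h =
    (\<Sum>a\<in>arcs (oriented Q). w a * normalized P f (tgt a) * cnj (normalized P h (src a)))"
  unfolding sum_by_tail inner_on_def
proof (rule sum.cong[OF refl])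
  fix u assume u: "u \<in> S"
  show "apply_on S (arc_matrix P w) f u * cnj (h u) =
    (\<Sum>a\<in>{a \<in> arcs (oriented Q). src a = u}. w a * normalized P f (tgt a) * cnj (normalized P h (src a)))"
    by (simp add: apply_arc_matrix[OF u] normalized_def[of P h] sum_distrib_right sum_divide_distrib)
qed

text \<open>
  Each vertex is the source of as many oriented edges as its degree, loops being counted twice.
\<close>

lemma norm_eq_sum_arcs:
  "(\<Sum>u\<in>S. (cmod (f u))\<^sup>2) = (\<Sum>a\<in>arcs (oriented Q). (cmod (normalized P f (src a)))\<^sup>2)"
  unfolding sum_by_tail
proof (rule sum.cong[OF refl])
  fix u assume u: "u \<in> S"
  have "(\<Sum>a\<in>{a \<in> arcs (oriented Q). src a = u}. (cmod (normalized P f (src a)))\<^sup>2) =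
     real (\<kappa> u) * (cmod (normalized P f u))\<^sup>2"
    by (simp add: card_oriented_tail[symmetric])
  also have "\<dots> = (cmod (f u))\<^sup>2"
    using degree_pos[OF u] by (simp add: normalized_def norm_divide power_divide)
  finally show "(cmod (f u))\<^sup>2 = (\<Sum>a\<in>{a \<in> arcs (oriented Q). src a = u}. (cmod (normalized P f (src a)))\<^sup>2)" ..
qed

lemma arc_matrix_hermitian:
  assumes "\<And>x b. x \<in> A \<Longrightarrow> w (x, \<not> b) = cnj (w (x, b))"
  shows "hermitian_on S (arc_matrix P w)"
  unfolding hermitian_on_def
proof (intro ballI)
  fix u v
  let ?R = "\<lambda>u v. {a \<in> arcs (oriented Q). src a = u \<and> tgt a = v}"
  have "(\<Sum>a\<in>?R v u. w a) = (\<Sum>a\<in>?R u v. cnj (w a))"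
    by (rule sum.reindex_bij_witness[of _ "\<lambda>(x, b). (x, \<not> b)" "\<lambda>(x, b). (x, \<not> b)"])
      (auto simp: oriented_def assms split: if_splits)
  then show "arc_matrix P w v u = cnj (arc_matrix P w u v)"
    by (simp add: arc_matrix_def mult.commute)
qed

section \<open>The Floquet matrices\<close>

definition phase :: "real ^ 'd \<Rightarrow> 'e set \<times> bool \<Rightarrow> complex" where
  "phase \<theta> a = exp (\<i> * complex_of_real (tau_oriented P V0 a \<bullet> \<theta>))"

abbreviation "floquet \<theta> \<equiv> floquet_matrix P V0 \<theta>"

lemma floquet_eq: "floquet \<theta> u v = (if u = v then 1 else 0) - arc_matrix P (phase \<theta>) u v"
  by (simp add: floquet_matrix_def arc_matrix_def phase_def)

lemma phase_flip: "phase \<theta> (x, \<not> b) = cnj (phase \<theta> (x, b))"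
  by (simp add: phase_def tau_oriented_def exp_cnj)

lemma norm_phase [simp]: "cmod (phase \<theta> a) = 1"
  by (simp add: phase_def)

lemma floquet_hermitian: "hermitian_on S (floquet \<theta>)"
  unfolding hermitian_on_def
proof (intro ballI)
  fix u v assume "u \<in> S" "v \<in> S"
  then have arc: "arc_matrix P (phase \<theta>) v u = cnj (arc_matrix P (phase \<theta>) u v)"
    using arc_matrix_hermitian[of "phase \<theta>"] phase_flip unfolding hermitian_on_def by blast
  show "floquet \<theta> v u = cnj (floquet \<theta> u v)"
    unfolding floquet_eq arc by simp
qed

lemma apply_floquet:
  assumes "u \<in> S"
  shows "apply_on S (floquet \<theta>) f u = f u - apply_on S (arc_matrix P (phase \<theta>)) f u"
proof -
  have "apply_on S (floquet \<theta>) f u = (\<Sum>v\<in>S. (if u = v then f v else 0)) - apply_on S (arc_matrix P (phase \<theta>)) f u"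
    unfolding apply_on_def sum_subtractf[symmetric]
    by (intro sum.cong) (auto simp: floquet_eq left_diff_distrib)
  then show ?thesis using assms finite_quotient_verts by simp
qed

text \<open>
  The form of the Floquet matrix as a sum of squares, see \<open>floquet_form\<close>. One orientation of each edge
  is enough, since the term of the reversed edge is obtained by multiplication with a phase.
\<close>

definition energy :: "real ^ 'd \<Rightarrow> ('v set \<Rightarrow> complex) \<Rightarrow> real" where
  "energy \<theta> f = (\<Sum>x\<in>A. (cmod (normalized P f (tail Q x) - phase \<theta> (x, True) * normalized P f (head Q x)))\<^sup>2)"

lemma floquet_form: "inner_on S (apply_on S (floquet \<theta>) f) f = of_real (energy \<theta> f)"
proof -
  let ?g = "normalized P f"
  have "inner_on S (apply_on S (floquet \<theta>) f) f =
      inner_on S f f - inner_on S (apply_on S (arc_matrix P (phase \<theta>)) f) f"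
    unfolding inner_on_diff_left[symmetric] by (rule inner_on_cong) (auto simp: apply_floquet)
  also have "inner_on S f f = (\<Sum>a\<in>arcs (oriented Q). ?g (src a) * cnj (?g (src a)))"
    unfolding inner_on_self norm_eq_sum_arcs by (simp add: complex_norm_square del: of_real_power)
  also have "\<dots> - inner_on S (apply_on S (arc_matrix P (phase \<theta>)) f) f =
      (\<Sum>a\<in>arcs (oriented Q). ?g (src a) * cnj (?g (src a)) -
        phase \<theta> a * ?g (tgt a) * cnj (?g (src a)))"
    unfolding arc_matrix_form sum_subtractf ..
  also have "\<dots> = (\<Sum>x\<in>A. (?g (tail Q x) - phase \<theta> (x, True) * ?g (head Q x)) *
      cnj (?g (tail Q x) - phase \<theta> (x, True) * ?g (head Q x)))"
    unfolding sum_oriented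
  proof (rule sum.cong[OF refl])
    fix x
    have p: "phase \<theta> (x, False) = cnj (phase \<theta> (x, True))" using phase_flip[of \<theta> x True] by simp
    have q: "phase \<theta> (x, True) * cnj (phase \<theta> (x, True)) = 1"
      using complex_norm_square[of "phase \<theta> (x, True)"] by simp
    \<comment> \<open>The phase has modulus one, so it can be inserted into the square of the modulus at the head.\<close>
    have "?g (head Q x) * cnj (?g (head Q x)) =
        (phase \<theta> (x, True) * cnj (phase \<theta> (x, True))) * (?g (head Q x) * cnj (?g (head Q x)))"
      by (simp add: q)
    then show "?g (src (x, True)) * cnj (?g (src (x, True))) -
         phase \<theta> (x, True) * ?g (tgt (x, True)) * cnj (?g (src (x, True))) +
         (?g (src (x, False)) * cnj (?g (src (x, False))) -
          phase \<theta> (x, False) * ?g (tgt (x, False)) * cnj (?g (src (x, False)))) =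
         (?g (tail Q x) - phase \<theta> (x, True) * ?g (head Q x)) *
         cnj (?g (tail Q x) - phase \<theta> (x, True) * ?g (head Q x))"
      unfolding p by (simp add: oriented_def algebra_simps)
  qed
  also have "\<dots> = of_real (energy \<theta> f)"
    by (simp add: energy_def complex_norm_square del: of_real_power complex_cnj_diff)
  finally show ?thesis .
qed

lemma energy_nonneg: "0 \<le> energy \<theta> f" by (simp add: energy_def sum_nonneg)

lemma energy_le: "energy \<theta> f \<le> 2 * (\<Sum>u\<in>S. (cmod (f u))\<^sup>2)"
  unfolding norm_eq_sum_arcs sum_oriented energy_def sum_distrib_left
proof (rule sum_mono)
  fix x
  let ?a = "normalized P f (tail Q x)" and ?b = "normalized P f (head Q x)"
  have "cmod (?a - phase \<theta> (x, True) * ?b) \<le> cmod ?a + cmod ?b"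
    using norm_triangle_ineq4[of ?a "phase \<theta> (x, True) * ?b"] by (simp add: norm_mult)
  then have "(cmod (?a - phase \<theta> (x, True) * ?b))\<^sup>2 \<le> (cmod ?a + cmod ?b)\<^sup>2" by (rule power_mono) simp
  also have "\<dots> \<le> 2 * ((cmod ?a)\<^sup>2 + (cmod ?b)\<^sup>2)"
    using sum_squares_bound[of "cmod ?a" "cmod ?b"] by (simp add: power2_sum)
  finally show "(cmod (?a - phase \<theta> (x, True) * ?b))\<^sup>2 \<le>
      2 * ((cmod (normalized P f (src (x, True))))\<^sup>2 + (cmod (normalized P f (src (x, False))))\<^sup>2)"
    by (simp add: oriented_def)
qed

section \<open>Paths in the tree\<close>

text \<open>
  A shortest path in the tree visits each vertex at most once, so it has fewer than \<open>\<nu>\<close> edges. Distinct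
  edges of the path have different pairs of endpoints and therefore lie in different orbits.
\<close>

lemma tree_path:
  assumes "u \<in> S" "v \<in> S"
  shows "\<exists>X\<subseteq>A. card X < card S \<and> (\<forall>x\<in>X. tau P V0 x = 0) \<and>
     (\<forall>g :: 'v set \<Rightarrow> complex. cmod (g u - g v) \<le> (\<Sum>x\<in>X. cmod (g (tail Q x) - g (head Q x))))"
proof -
  obtain u0 v0 where uv: "u0 \<in> V0" "v0 \<in> V0" "u = vorbit P u0" "v = vorbit P v0"
    using assms unfolding bij_betw_imp_surj_on[OF vorbit_bij, symmetric] by blast
  let ?r = "{(a, b). \<exists>e\<in>arcs T. (a = tail T e \<and> b = head T e) \<or> (a = head T e \<and> b = tail T e)}"
  have uvr: "(u0, v0) \<in> ?r\<^sup>*" by (rule connected_imp_rtrancl[OF T_facts(7) uv(1,2)])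
  obtain m w where w: "w 0 = u0" "w m = v0" "\<forall>i<m. (w i, w (Suc i)) \<in> ?r" "inj_on w {..m :: nat}"
    using shortest_path[OF uvr] by blast
  have "\<forall>i. \<exists>e. i < m \<longrightarrow> e \<in> arcs T \<and> ((w i = tail G e \<and> w (Suc i) = head G e) \<or> (w i = head G e \<and> w (Suc i) = tail G e))"
    using w(3) T_facts(3,4) by auto
  then obtain a where a: "\<And>i. i < m \<Longrightarrow> a i \<in> arcs T"
    "\<And>i. i < m \<Longrightarrow> (w i = tail G (a i) \<and> w (Suc i) = head G (a i)) \<or> (w i = head G (a i) \<and> w (Suc i) = tail G (a i))"
    by metis
  have aG: "a i \<in> arcs G" if "i < m" for i using a(1)[OF that] T_facts(2) by auto
  have wV: "w i \<in> V0" if "i \<le> m" for i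
  proof (cases i)
    case 0
    then show ?thesis using w uv by simp
  next
    case (Suc j)
    then show ?thesis using a[of j] that T_facts(5,6) by fastforce
  qed
  define x where "x i = eorbit P (a i)" for i
  have ends: "{tail Q (x i), head Q (x i)} = vorbit P ` {w i, w (Suc i)}" if "i < m" for i
    using a(2)[OF that] aG[OF that] by (auto simp: x_def tail_Q head_Q)
  have inj: "inj_on x {..<m}"
  proof (rule inj_onI)
    fix i j assume ij: "i \<in> {..<m}" "j \<in> {..<m}" "x i = x j"
    then have img: "vorbit P ` {w i, w (Suc i)} = vorbit P ` {w j, w (Suc j)}"
      using ends[of i] ends[of j] by simp
    have sub: "{w i, w (Suc i)} \<subseteq> V0" "{w j, w (Suc j)} \<subseteq> V0" using ij wV by auto
    have "{w i, w (Suc i)} = {w j, w (Suc j)}"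
      by (rule iffD1[OF inj_on_image_eq_iff[OF bij_betw_imp_inj_on[OF vorbit_bij] sub] img])
    then have img: "w ` {i, Suc i} = w ` {j, Suc j}" by simp
    have sub: "{i, Suc i} \<subseteq> {..m}" "{j, Suc j} \<subseteq> {..m}" using ij by auto
    have "{i, Suc i} = {j, Suc j}" by (rule iffD1[OF inj_on_image_eq_iff[OF w(4) sub] img])
    then show "i = j" by (auto simp: doubleton_eq_iff)
  qed
  have finV: "finite V0" using card_S_pos T_facts(8) by (metis card_gt_0_iff)
  have "card (w ` {..m}) \<le> card V0" using wV finV by (intro card_mono) auto
  then have m: "m < card S" using card_image[OF w(4)] T_facts(8) by simp
  have step: "cmod (g (vorbit P (w i)) - g (vorbit P (w (Suc i)))) = cmod (g (tail Q (x i)) - g (head Q (x i)))"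
    if "i < m" for g :: "'v set \<Rightarrow> complex" and i
    using a(2)[OF that] aG[OF that] by (auto simp: x_def tail_Q head_Q norm_minus_commute)
  have tele: "cmod (g (vorbit P (w 0)) - g (vorbit P (w i))) \<le> (\<Sum>j<i. cmod (g (tail Q (x j)) - g (head Q (x j))))"
    if "i \<le> m" for g :: "'v set \<Rightarrow> complex" and i
    using that
  proof (induction i)
    case (Suc i)
    have "cmod (g (vorbit P (w 0)) - g (vorbit P (w (Suc i)))) \<le>
       cmod (g (vorbit P (w 0)) - g (vorbit P (w i))) + cmod (g (vorbit P (w i)) - g (vorbit P (w (Suc i))))"
      using norm_triangle_ineq[of "g (vorbit P (w 0)) - g (vorbit P (w i))" "g (vorbit P (w i)) - g (vorbit P (w (Suc i)))"] by simp
    then show ?case using Suc step[of i g] by simp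
  qed simp
  have "cmod (g u - g v) \<le> (\<Sum>y\<in>x ` {..<m}. cmod (g (tail Q y) - g (head Q y)))" for g :: "'v set \<Rightarrow> complex"
    using tele[of m g] by (simp add: sum.reindex[OF inj] w uv)
  moreover have "x ` {..<m} \<subseteq> A" using aG by (auto simp: x_def A_eq)
  moreover have "\<forall>y\<in>x ` {..<m}. tau P V0 y = 0" using a(1) by (auto simp: x_def tau_tree)
  moreover have "card (x ` {..<m}) < card S" using card_image[OF inj] m by simp
  ultimately show ?thesis by (intro exI[of _ "x ` {..<m}"] conjI) auto
qed

text \<open>
  The bridge is closed to a cycle by tree edges, on which the phase is \<open>1\<close>. Going once around the cycle
  multiplies by the phase of the bridge, so \<open>\<bar>1 - e\<^sup>i\<^sup>\<tau>\<^sup>\<theta>\<bar> \<bar>g\<bar>\<close> is at most the sum of the edge differences. The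
  bridge itself is not among the tree edges as its index is nonzero, hence the cycle has at most \<open>\<nu>\<close>
  edges, all different.
\<close>

lemma bridge_energy:
  assumes x: "x \<in> bridges P V0"
  shows "(cmod (1 - phase \<theta> (x, True)))\<^sup>2 * (cmod (normalized P f (tail Q x)))\<^sup>2 \<le> card S * energy \<theta> f"
proof -
  let ?g = "normalized P f" and ?E = "\<lambda>y. phase \<theta> (y, True)"
  have xA: "x \<in> A" "tau P V0 x \<noteq> 0" using x by (auto simp: bridges_def)
  obtain X where X: "X \<subseteq> A" "card X < card S" "\<forall>y\<in>X. tau P V0 y = 0"
    "\<And>g :: 'v set \<Rightarrow> complex. cmod (g (head Q x) - g (tail Q x)) \<le> (\<Sum>y\<in>X. cmod (g (tail Q y) - g (head Q y)))"
    using tree_path[of "head Q x" "tail Q x"] xA by auto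
  have finX: "finite X" using X(1) finite_quotient_arcs finite_subset by blast
  have xX: "x \<notin> X" using X(3) xA by auto
  have E1: "?E y = 1" if "y \<in> X" for y using X(3) that by (simp add: phase_def tau_oriented_def)
  let ?d = "\<lambda>y. cmod (?g (tail Q y) - ?E y * ?g (head Q y))"
  have "cmod (1 - ?E x) * cmod (?g (tail Q x)) = cmod ((?g (tail Q x) - ?E x * ?g (head Q x)) + ?E x * (?g (head Q x) - ?g (tail Q x)))"
    by (simp add: norm_mult[symmetric] algebra_simps)
  also have "\<dots> \<le> ?d x + cmod (?E x * (?g (head Q x) - ?g (tail Q x)))" by (rule norm_triangle_ineq)
  also have "\<dots> \<le> ?d x + (\<Sum>y\<in>X. ?d y)" using X(4)[of ?g] E1 by (simp add: norm_mult)
  also have "\<dots> = (\<Sum>y\<in>insert x X. ?d y)" using xX finX by simp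
  finally have "(cmod (1 - ?E x) * cmod (?g (tail Q x)))\<^sup>2 \<le> (\<Sum>y\<in>insert x X. ?d y)\<^sup>2"
    by (intro power_mono) auto
  also have "\<dots> = (\<Sum>y\<in>insert x X. 1 * ?d y)\<^sup>2" by simp
  also have "\<dots> \<le> (\<Sum>y\<in>insert x X. 1\<^sup>2) * (\<Sum>y\<in>insert x X. (?d y)\<^sup>2)" by (rule Cauchy_Schwarz_ineq_sum)
  also have "\<dots> \<le> card S * energy \<theta> f"
  proof (rule mult_mono)
    show "(\<Sum>y\<in>insert x X. 1\<^sup>2) \<le> real (card S)" using X(2) xX finX by simp
    show "(\<Sum>y\<in>insert x X. (?d y)\<^sup>2) \<le> energy \<theta> f" unfolding energy_def
      using X(1) xA finite_quotient_arcs by (intro sum_mono2) auto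
  qed (auto simp: sum_nonneg)
  finally show ?thesis by (simp add: power_mult_distrib)
qed

end

section \<open>Lifting discrete eigenfunctions to the metric graph\<close>

lemma sobolev2_trigonometric:
  fixes a b :: complex and z :: real
  defines "\<phi> \<equiv> \<lambda>t. a * of_real (sin (z * (1 - t))) + b * of_real (sin (z * t))"
    and "\<phi>' \<equiv> \<lambda>t. of_real z * (b * of_real (cos (z * t)) - a * of_real (cos (z * (1 - t))))"
  assumes f: "\<And>t. t \<in> {0..1} \<Longrightarrow> f t = \<phi> t"
    and w: "\<And>t. t \<in> {0..1} \<Longrightarrow> w t = - (of_real (z\<^sup>2) * \<phi> t)"
  shows "sobolev2 f \<phi>' w"
proof -
  have d1: "(\<phi> has_vector_derivative \<phi>' t) (at t within X)" for t X
    unfolding \<phi>_def \<phi>'_def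
    by (rule has_vector_derivative_eq_rhs)
      (rule derivative_intros has_vector_derivative_real_field | rule derivative_eq_intros refl
        | simp add: algebra_simps)+
  have d2: "(\<phi>' has_vector_derivative - (of_real (z\<^sup>2) * \<phi> t)) (at t within X)" for t X
    unfolding \<phi>_def \<phi>'_def
    by (rule has_vector_derivative_eq_rhs)
      (rule derivative_intros has_vector_derivative_real_field | rule derivative_eq_intros refl
        | simp add: algebra_simps power2_eq_square)+
  have cont: "continuous_on {0..1} w"
  proof -
    have "continuous_on {0..1} (\<lambda>t. - (of_real (z\<^sup>2) * \<phi> t))"
      unfolding \<phi>_def by (intro continuous_intros)
    then show ?thesis by (rule continuous_on_eq) (simp add: w)
  qed
  have "w \<in> borel_measurable (lebesgue_on {0..1})"
    by (rule continuous_imp_measurable_on_sets_lebesgue[OF cont]) simp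
  moreover have "integrable (lebesgue_on {0..1}) (\<lambda>t. (cmod (w t))\<^sup>2)"
  proof -
    have "continuous_on (cbox 0 1) (\<lambda>t. (cmod (w t))\<^sup>2)" using cont by (intro continuous_intros) simp
    from continuous_imp_integrable[OF this] show ?thesis by simp
  qed
  moreover have "(f has_vector_derivative \<phi>' t) (at t within {0..1})" if "t \<in> {0..1}" for t
    by (rule has_vector_derivative_transform[OF that _ d1]) (use f in auto)
  moreover have "(w has_integral (\<phi>' t - \<phi>' 0)) {0..t}" if t: "t \<in> {0..1}" for t
  proof -
    have "((\<lambda>t. - (of_real (z\<^sup>2) * \<phi> t)) has_integral (\<phi>' t - \<phi>' 0)) {0..t}"
      by (rule fundamental_theorem_of_calculus) (use t d2 in auto)
    then show ?thesis by (rule has_integral_eq[rotated]) (use w t in auto)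
  qed
  ultimately show ?thesis unfolding sobolev2_def by blast
qed

lemma real_vec_add: "real_vec (m + n) = real_vec m + real_vec n"
  and real_vec_diff: "real_vec (m - n) = real_vec m - real_vec n"
  by (simp_all add: real_vec_def vec_eq_iff)

context periodic_graph_with_tree
begin

text \<open>
  The quasi-periodic function on the vertices of the periodic graph that corresponds to a function on
  the quotient, after division by the square roots of the degrees.
\<close>

definition vertex_lift :: "real ^ 'd \<Rightarrow> ('v set \<Rightarrow> complex) \<Rightarrow> 'v \<Rightarrow> complex" where
  "vertex_lift \<theta> f v = exp (\<i> * of_real (real_vec (cell P V0 v) \<bullet> \<theta>)) * normalized P f (vorbit P v)"

text \<open>
  On each edge, the solution of \<open>- y'' = z\<^sup>2 y\<close> with the prescribed values at both ends.
\<close>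

definition metric_lift :: "real ^ 'd \<Rightarrow> real \<Rightarrow> ('v set \<Rightarrow> complex) \<Rightarrow> 'e \<times> real \<Rightarrow> complex" where
  "metric_lift \<theta> z f = (\<lambda>(e, t). if e \<in> arcs G \<and> t \<in> {0..1} then
     vertex_lift \<theta> f (tail G e) / of_real (sin z) * of_real (sin (z * (1 - t))) +
     vertex_lift \<theta> f (head G e) / of_real (sin z) * of_real (sin (z * t)) else 0)"

lemma vertex_lift_vact:
  "v \<in> verts G \<Longrightarrow> vertex_lift \<theta> f (vact P m v) =
    exp (\<i> * of_real (real_vec m \<bullet> \<theta>)) * vertex_lift \<theta> f v"
  by (simp add: vertex_lift_def cell_vact vorbit_vact real_vec_add inner_add_left distrib_left exp_add)

text \<open>
  The eigenvalue equation of the Floquet matrix, read on the periodic graph: the sum over all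
  neighbours is \<open>c\<close> times the degree times the value at the vertex. With \<open>c = cos z\<close> this is exactly the
  Kirchhoff condition for the sine interpolation.
\<close>

lemma vertex_lift_neighbours:
  assumes v: "v \<in> verts G"
    and eig: "apply_on S (floquet \<theta>) f (vorbit P v) = of_real (1 - c) * f (vorbit P v)"
  shows "(\<Sum>e\<in>out_arcs G v. vertex_lift \<theta> f (head G e)) + (\<Sum>e\<in>in_arcs G v. vertex_lift \<theta> f (tail G e)) =
    of_nat (card (out_arcs G v) + card (in_arcs G v)) * of_real c * vertex_lift \<theta> f v"
proof -
  let ?u = "vorbit P v"
  let ?E = "exp (\<i> * of_real (real_vec (cell P V0 v) \<bullet> \<theta>))"
  let ?F = "\<lambda>a. phase \<theta> a * normalized P f (tgt a)"
  have u: "?u \<in> S" using v by (simp add: S_eq)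
  have out: "vertex_lift \<theta> f (head G e) = ?E * ?F (eorbit P e, True)" if "e \<in> out_arcs G v" for e
  proof -
    have e: "e \<in> arcs G" "tail G e = v" using that by auto
    have "real_vec (cell P V0 (head G e)) = real_vec (cell P V0 v) + tau P V0 (eorbit P e)"
      using e by (simp add: tau_eorbit edge_index_def real_vec_diff)
    then show ?thesis using e
      by (simp add: vertex_lift_def phase_def tau_oriented_def oriented_def head_Q inner_add_left distrib_left exp_add)
  qed
  have in': "vertex_lift \<theta> f (tail G e) = ?E * ?F (eorbit P e, False)" if "e \<in> in_arcs G v" for e
  proof -
    have e: "e \<in> arcs G" "head G e = v" using that by auto
    have "real_vec (cell P V0 (tail G e)) = real_vec (cell P V0 v) + - tau P V0 (eorbit P e)"
      using e by (simp add: tau_eorbit edge_index_def real_vec_diff)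
    then have "real_vec (cell P V0 (tail G e)) \<bullet> \<theta> =
        real_vec (cell P V0 v) \<bullet> \<theta> + - tau P V0 (eorbit P e) \<bullet> \<theta>"
      by (simp only: inner_add_left)
    then have "\<i> * complex_of_real (real_vec (cell P V0 (tail G e)) \<bullet> \<theta>) =
        \<i> * of_real (real_vec (cell P V0 v) \<bullet> \<theta>) + \<i> * of_real (- tau P V0 (eorbit P e) \<bullet> \<theta>)"
      by (simp only: of_real_add distrib_left)
    then show ?thesis using e
      by (simp only: vertex_lift_def phase_def tau_oriented_def oriented_def exp_add) (simp add: tail_Q)
  qed
  have "(\<Sum>e\<in>out_arcs G v. vertex_lift \<theta> f (head G e)) = (\<Sum>e\<in>out_arcs G v. ?E * ?F (eorbit P e, True))"
    by (rule sum.cong[OF refl out])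
  also have "\<dots> = (\<Sum>x\<in>out_arcs Q ?u. ?E * ?F (x, True))"
    by (rule sum.reindex_bij_betw[OF eorbit_out_arcs[OF v]])
  finally have 1: "(\<Sum>e\<in>out_arcs G v. vertex_lift \<theta> f (head G e)) = (\<Sum>x\<in>out_arcs Q ?u. ?E * ?F (x, True))" .
  have "(\<Sum>e\<in>in_arcs G v. vertex_lift \<theta> f (tail G e)) = (\<Sum>e\<in>in_arcs G v. ?E * ?F (eorbit P e, False))"
    by (rule sum.cong[OF refl in'])
  also have "\<dots> = (\<Sum>x\<in>in_arcs Q ?u. ?E * ?F (x, False))"
    by (rule sum.reindex_bij_betw[OF eorbit_in_arcs[OF v]])
  finally have 2: "(\<Sum>e\<in>in_arcs G v. vertex_lift \<theta> f (tail G e)) = (\<Sum>x\<in>in_arcs Q ?u. ?E * ?F (x, False))" .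
  have "(\<Sum>e\<in>out_arcs G v. vertex_lift \<theta> f (head G e)) + (\<Sum>e\<in>in_arcs G v. vertex_lift \<theta> f (tail G e)) =
      ?E * (\<Sum>a\<in>{a \<in> arcs (oriented Q). src a = ?u}. ?F a)"
    unfolding 1 2 sum_oriented_tail sum_distrib_left distrib_left ..
  also have "(\<Sum>a\<in>{a \<in> arcs (oriented Q). src a = ?u}. ?F a) =
      apply_on S (arc_matrix P (phase \<theta>)) f ?u * of_real (sqrt (\<kappa> ?u))"
    using degree_pos[OF u] by (simp add: apply_arc_matrix[OF u])
  also have "apply_on S (arc_matrix P (phase \<theta>)) f ?u = of_real c * f ?u"
    using eig apply_floquet[OF u, of \<theta> f] by (simp add: algebra_simps)
  also have "f ?u = normalized P f ?u * of_real (sqrt (\<kappa> ?u))"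
    using degree_pos[OF u] by (simp add: normalized_def)
  also have "?E * (of_real c * (normalized P f ?u * of_real (sqrt (\<kappa> ?u))) * of_real (sqrt (\<kappa> ?u))) =
      of_real (sqrt (\<kappa> ?u) * sqrt (\<kappa> ?u)) * of_real c * vertex_lift \<theta> f v"
    unfolding of_real_mult by (simp only: vertex_lift_def mult_ac)
  also have "sqrt (\<kappa> ?u) * sqrt (\<kappa> ?u) = real (card (out_arcs G v) + card (in_arcs G v))"
    using bij_betw_same_card[OF eorbit_out_arcs[OF v]] bij_betw_same_card[OF eorbit_in_arcs[OF v]]
    by (simp add: degree_def out_degree_def in_degree_def)
  finally show ?thesis by simp
qed

lemma metric_lift_eigenfunction:
  assumes z: "sin z \<noteq> 0"
    and eig: "\<And>u. u \<in> S \<Longrightarrow> apply_on S (floquet \<theta>) f u = of_real (1 - cos z) * f u"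
  shows "metric_lift \<theta> z f \<in> metric_eigenspace P \<theta> (z\<^sup>2)"
proof -
  let ?y = "metric_lift \<theta> z f" and ?h = "vertex_lift \<theta> f"
  let ?s = "complex_of_real (sin z)"
  have s: "?s \<noteq> 0" using z by simp
  define p where "p e t = of_real z * (?h (head G e) / ?s * of_real (cos (z * t)) -
      ?h (tail G e) / ?s * of_real (cos (z * (1 - t))))" for e t
  have p0: "p e 0 = of_real z / ?s * (?h (head G e) - of_real (cos z) * ?h (tail G e))" for e
    by (simp add: p_def algebra_simps diff_divide_distrib)
  have p1: "p e 1 = of_real z / ?s * (of_real (cos z) * ?h (head G e) - ?h (tail G e))" for e
    by (simp add: p_def algebra_simps diff_divide_distrib)
  have "sobolev2 (\<lambda>t. ?y (e, t)) (p e) (\<lambda>t. - (of_real (z\<^sup>2) * ?y (e, t)))" if "e \<in> arcs G" for e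
    unfolding p_def[abs_def]
    by (rule sobolev2_trigonometric) (use that in \<open>auto simp: metric_lift_def\<close>)
  moreover have "?y (e, 0) = ?h (tail G e) \<and> ?y (e, 1) = ?h (head G e)" if "e \<in> arcs G" for e
    using that s by (simp add: metric_lift_def)
  moreover have "(\<Sum>e\<in>out_arcs G v. p e 0) + (\<Sum>e\<in>in_arcs G v. - p e 1) = 0" if v: "v \<in> verts G" for v
  proof -
    have 1: "(\<Sum>e\<in>out_arcs G v. p e 0) =
        of_real z / ?s * ((\<Sum>e\<in>out_arcs G v. ?h (head G e)) - of_nat (card (out_arcs G v)) * (of_real (cos z) * ?h v))"
      unfolding p0 sum_distrib_left[symmetric] sum_subtractf by simp
    have 2: "(\<Sum>e\<in>in_arcs G v. - p e 1) =
        of_real z / ?s * ((\<Sum>e\<in>in_arcs G v. ?h (tail G e)) - of_nat (card (in_arcs G v)) * (of_real (cos z) * ?h v))"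
      unfolding p1 sum_negf sum_distrib_left[symmetric] sum_subtractf by (simp add: right_diff_distrib)
    have "vorbit P v \<in> S" using v by (simp add: S_eq)
    from vertex_lift_neighbours[OF v eig[OF this]]
    have "((\<Sum>e\<in>out_arcs G v. ?h (head G e)) - of_nat (card (out_arcs G v)) * (of_real (cos z) * ?h v)) +
        ((\<Sum>e\<in>in_arcs G v. ?h (tail G e)) - of_nat (card (in_arcs G v)) * (of_real (cos z) * ?h v)) = 0"
      by (simp add: algebra_simps)
    then show ?thesis unfolding 1 2 by (simp only: distrib_left[symmetric] mult_zero_right)
  qed
  moreover have "?y (eact P m e, t) = exp (\<i> * of_real (real_vec m \<bullet> \<theta>)) * ?y (e, t)"
    if "e \<in> arcs G" for m e t
    using that by (simp add: metric_lift_def eact_closed tail_eact head_eact vertex_lift_vact algebra_simps)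
  ultimately have "metric_floquet P \<theta> ?y (\<lambda>x. of_real (z\<^sup>2) * ?y x)"
    unfolding metric_floquet_def by (intro exI[of _ p] conjI exI[of _ ?h]) auto
  moreover have "?y (e, t) = 0" if "e \<notin> arcs G \<or> t \<notin> {0..1}" for e t
    using that by (auto simp: metric_lift_def)
  ultimately show ?thesis unfolding metric_eigenspace_def by blast
qed

text \<open>
  Evaluation at an end of an edge incident to the vertex. The factor \<open>K\<close> is independent of \<open>f\<close>, so linear
  relations between lifts pass to the functions that are lifted.
\<close>

lemma metric_lift_recovers_vertex_values:
  assumes z: "sin z \<noteq> 0" and u: "u \<in> S"
  shows "\<exists>x K. K \<noteq> 0 \<and> (\<forall>f. metric_lift \<theta> z f x = K * f u)"
proof -
  obtain v where v: "v \<in> verts G" "u = vorbit P v" using u by (auto simp: S_eq)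
  obtain e where e: "e \<in> arcs G" "tail G e = v \<or> head G e = v" using incident_arc[OF v(1)] by auto
  obtain t where t: "\<And>f. metric_lift \<theta> z f (e, t) = vertex_lift \<theta> f v"
  proof (cases "tail G e = v")
    case True
    then show ?thesis using e z by (intro that[of 0]) (simp add: metric_lift_def)
  next
    case False
    then show ?thesis using e z by (intro that[of 1]) (simp add: metric_lift_def)
  qed
  let ?K = "exp (\<i> * of_real (real_vec (cell P V0 v) \<bullet> \<theta>)) / of_real (sqrt (\<kappa> u))"
  have "?K \<noteq> 0" using degree_pos[OF u] by simp
  moreover have "metric_lift \<theta> z f (e, t) = ?K * f u" for f
    unfolding t by (simp add: vertex_lift_def normalized_def v(2))
  ultimately show ?thesis by blast
qed

lemma simple_metric_imp_simple_discrete: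
  assumes z: "sin z \<noteq> 0" and simple: "simple_metric_eigenvalue P \<theta> (z\<^sup>2)"
    and eb: "eigenbasis S (floquet \<theta>) l e"
    and j: "j < card S" "l j = 1 - cos z" and k: "k < card S" "l k = 1 - cos z"
  shows "j = k"
proof (rule ccontr)
  assume jk: "j \<noteq> k"
  let ?V = "metric_eigenspace P \<theta> (z\<^sup>2)"
  obtain B where B: "B \<subseteq> ?V" "?V \<subseteq> cfun.span B" "card B = cfun.dim ?V"
    by (rule cfun.basis_exists[of ?V])
  then have "card B = 1" using simple by (simp add: simple_metric_eigenvalue_def)
  then obtain w where w: "B = {w}" by (rule card_1_singletonE)
  have V: "\<exists>c. y = (\<lambda>x. c * w x)" if "y \<in> ?V" for y
    using B(2) that unfolding w cfun.span_singleton by blast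
  have lift: "metric_lift \<theta> z (e i) \<in> ?V" if "i < card S" "l i = 1 - cos z" for i
    by (rule metric_lift_eigenfunction[OF z]) (use eigenbasisD(2)[OF eb that(1)] that(2) in auto)
  obtain a where a: "metric_lift \<theta> z (e j) = (\<lambda>x. a * w x)" using V[OF lift[OF j]] by blast
  \<comment> \<open>Two lifts in a one-dimensional space are proportional, and so are the functions that are lifted.\<close>
  obtain b where b: "metric_lift \<theta> z (e k) = (\<lambda>x. b * w x)" using V[OF lift[OF k]] by blast
  have rel: "b * e j u = a * e k u" if u: "u \<in> S" for u
  proof -
    obtain x K where K: "K \<noteq> 0" "\<And>f. metric_lift \<theta> z f x = K * f u"
      using metric_lift_recovers_vertex_values[OF z u] by blast
    have "K * (b * e j u) = b * metric_lift \<theta> z (e j) x" by (simp add: K(2))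
    also have "\<dots> = a * metric_lift \<theta> z (e k) x" unfolding a b by simp
    also have "\<dots> = K * (a * e k u)" by (simp add: K(2))
    finally show ?thesis using K(1) by simp
  qed
  note on = eigenbasisD(3)[OF eb]
  have "b * inner_on S (e j) h = a * inner_on S (e k) h" for h
    unfolding inner_on_scale_left[symmetric] by (rule inner_on_cong) (use rel in auto)
  from this[of "e j"] this[of "e k"] have "b = 0" "a = 0" using on j k jk by auto
  have "e j u = 0" if u: "u \<in> S" for u
  proof -
    obtain x K where "K \<noteq> 0" "\<And>f. metric_lift \<theta> z f x = K * f u"
      using metric_lift_recovers_vertex_values[OF z u] by blast
    then show ?thesis using a \<open>a = 0\<close> by (metis mult_eq_0_iff)
  qed
  then have "inner_on S (e j) (e j) = 0" by (simp add: inner_on_def)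
  then show False using on[of j j] j by simp
qed

end

section \<open>Extreme eigenvalues of real symmetric matrices\<close>

lemma eq_0_if_parabola_nonneg:
  fixes a b :: real
  assumes b: "0 \<le> b" and "\<And>t. 0 \<le> 2 * t * a + t\<^sup>2 * b"
  shows "a = 0"
proof (rule ccontr)
  assume a: "a \<noteq> 0"
  \<comment> \<open>The minimiser of the parabola is \<open>- a / b\<close>; adding \<open>1\<close> avoids the case \<open>b = 0\<close>.\<close>
  define t where "t = - a / (b + 1)"
  have tc: "t * (b + 1) = - a" using b by (simp add: t_def)
  have "0 \<le> (b + 1)\<^sup>2 * (2 * t * a + t\<^sup>2 * b)" using assms(2)[of t] by simp
  also have "\<dots> = 2 * (b + 1) * (t * (b + 1)) * a + (t * (b + 1))\<^sup>2 * b"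
    by (simp add: power2_eq_square algebra_simps)
  also have "\<dots> = - (a\<^sup>2 * (b + 2))" unfolding tc by (simp add: power2_eq_square algebra_simps)
  finally have "a\<^sup>2 * (b + 2) \<le> 0" by simp
  moreover have "0 < a\<^sup>2 * (b + 2)" using a b by (intro mult_pos_pos) auto
  ultimately show False by simp
qed

lemma symmetric_dot:
  fixes M :: "real ^ 'd ^ 'd"
  assumes "transpose M = M"
  shows "x \<bullet> (M *v y) = (M *v x) \<bullet> y"
  using assms by (metis dot_lmul_matrix transpose_matrix_vector)

text \<open>
  The form attains its minimum \<open>m\<close> on the unit sphere, at \<open>x0\<close> say. Then \<open>M - m\<close> is positive semidefinite
  with vanishing form at \<open>x0\<close>, which forces \<open>M x0 = m x0\<close>: otherwise moving from \<open>x0\<close> in the direction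
  \<open>w = M x0 - m x0\<close> or against it would make the form negative.
\<close>

lemma least_eigenvalue_exists:
  fixes M :: "real ^ 'd::finite ^ 'd"
  assumes sym: "transpose M = M"
  shows "\<exists>m\<in>eigenvalues M. \<forall>x. m * (x \<bullet> x) \<le> x \<bullet> (M *v x)"
proof -
  let ?q = "\<lambda>x. x \<bullet> (M *v x)"
  have "continuous_on (sphere 0 1) ?q"
    by (intro continuous_on_inner continuous_on_id linear_continuous_on matrix_vector_mul_bounded_linear)
  moreover have "sphere (0 :: real ^ 'd) 1 \<noteq> {}"
    by (metis sphere_eq_empty not_one_less_zero)
  ultimately obtain x0 where x0: "x0 \<in> sphere 0 1" "\<And>x. x \<in> sphere 0 1 \<Longrightarrow> ?q x0 \<le> ?q x"
    using continuous_attains_inf[OF compact_sphere, of 0 1 ?q] by blast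
  define m where "m = ?q x0"
  have n0: "norm x0 = 1" "x0 \<bullet> x0 = 1" using x0(1) by (auto simp: norm_eq_sqrt_inner)
  have le: "m * (x \<bullet> x) \<le> ?q x" for x
  proof (cases "x = 0")
    case False
    then have "m \<le> ?q (x /\<^sub>R norm x)" unfolding m_def by (intro x0(2)) simp
    also have "\<dots> = ?q x / (norm x)\<^sup>2"
      by (simp add: scaleR_matrix_vector_assoc[symmetric] matrix_vector_mult_scaleR divide_inverse power2_eq_square)
    finally show ?thesis using False by (simp add: pos_le_divide_eq power2_norm_eq_inner)
  qed simp
  define w where "w = M *v x0 - m *\<^sub>R x0"
  have "w \<bullet> w = 0"
  proof (rule eq_0_if_parabola_nonneg)
    show "0 \<le> ?q w - m * (w \<bullet> w)" using le[of w] by simp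
    fix t :: real
    have "0 \<le> ?q (x0 + t *\<^sub>R w) - m * ((x0 + t *\<^sub>R w) \<bullet> (x0 + t *\<^sub>R w))"
      using le[of "x0 + t *\<^sub>R w"] by simp
    also have "\<dots> = (?q x0 - m * (x0 \<bullet> x0)) + t * (x0 \<bullet> (M *v w) + w \<bullet> (M *v x0) - 2 * m * (x0 \<bullet> w)) +
         t\<^sup>2 * (?q w - m * (w \<bullet> w))"
      by (simp add: matrix_vector_right_distrib matrix_vector_mult_scaleR inner_add_left inner_add_right
          power2_eq_square algebra_simps inner_commute)
    also have "x0 \<bullet> (M *v w) = w \<bullet> (M *v x0)" using symmetric_dot[OF sym, of x0 w] by (simp add: inner_commute)
    also have "w \<bullet> (M *v x0) + w \<bullet> (M *v x0) - 2 * m * (x0 \<bullet> w) = 2 * (w \<bullet> w)"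
      by (simp add: w_def inner_diff_left inner_diff_right inner_commute algebra_simps)
    finally show "0 \<le> 2 * t * (w \<bullet> w) + t\<^sup>2 * (?q w - m * (w \<bullet> w))"
      using n0 by (simp add: m_def mult_ac)
  qed
  then have "M *v x0 = m *s x0" by (simp add: w_def scalar_mult_eq_scaleR)
  moreover have "x0 \<noteq> 0" using n0 by auto
  ultimately have "m \<in> eigenvalues M" by (auto simp: eigenvalues_def)
  with le show ?thesis by blast
qed

lemma greatest_eigenvalue_exists:
  fixes M :: "real ^ 'd::finite ^ 'd"
  assumes sym: "transpose M = M"
  shows "\<exists>m\<in>eigenvalues M. \<forall>x. x \<bullet> (M *v x) \<le> m * (x \<bullet> x)"
proof -
  have neg: "(- M) *v x = - (M *v x)" for x :: "real ^ 'd"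
    by (simp add: matrix_vector_mult_def vec_eq_iff sum_negf)
  have "transpose (- M) = - M" using sym by (simp add: transpose_def vec_eq_iff)
  then obtain m where m: "m \<in> eigenvalues (- M)" "\<forall>x. m * (x \<bullet> x) \<le> x \<bullet> ((- M) *v x)"
    using least_eigenvalue_exists by blast
  obtain x where x: "x \<noteq> 0" "(- M) *v x = m *s x" using m(1) by (auto simp: eigenvalues_def)
  have "M *v x = (- m) *s x" using x(2) unfolding neg scalar_mult_eq_scaleR by (metis minus_equation_iff scaleR_minus_left)
  then have "- m \<in> eigenvalues M" using x(1) by (auto simp: eigenvalues_def)
  moreover have "x \<bullet> (M *v x) \<le> - m * (x \<bullet> x)" for x using m(2)[rule_format, of x] unfolding neg by simp
  ultimately show ?thesis by blast
qed

text \<open>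
  Eigenvectors for different eigenvalues are orthogonal, hence independent. Finiteness is what makes
  \<open>Min\<close> and \<open>Max\<close> of the set of eigenvalues meaningful.
\<close>

lemma finite_eigenvalues:
  fixes M :: "real ^ 'd::finite ^ 'd"
  assumes sym: "transpose M = M"
  shows "finite (eigenvalues M)"
proof -
  define x where "x l = (SOME x. x \<noteq> 0 \<and> M *v x = l *s x)" for l
  have x: "x l \<noteq> 0" "M *v x l = l *\<^sub>R x l" if "l \<in> eigenvalues M" for l
    using that someI_ex[of "\<lambda>x. x \<noteq> 0 \<and> M *v x = l *s x"] unfolding x_def[symmetric]
    by (auto simp: eigenvalues_def scalar_mult_eq_scaleR)
  have orth: "x l \<bullet> x k = 0" if "l \<in> eigenvalues M" "k \<in> eigenvalues M" "l \<noteq> k" for l k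
    using symmetric_dot[OF sym, of "x l" "x k"] x that by simp
  have "inj_on x (eigenvalues M)"
    by (rule inj_onI) (metis orth x(1) inner_eq_zero_iff)
  moreover have "pairwise orthogonal (x ` eigenvalues M)"
    unfolding pairwise_def orthogonal_def using orth by auto
  then have "independent (x ` eigenvalues M)"
    by (rule pairwise_orthogonal_independent) (use x(1) in auto)
  then have "finite (x ` eigenvalues M)" using independent_bound by blast
  ultimately show ?thesis by (rule finite_imageD[rotated])
qed

lemma Min_eigenvalues_le:
  fixes M :: "real ^ 'd::finite ^ 'd"
  assumes sym: "transpose M = M"
  shows "Min (eigenvalues M) \<in> eigenvalues M" "Min (eigenvalues M) * (x \<bullet> x) \<le> x \<bullet> (M *v x)"
proof -
  obtain m where m: "m \<in> eigenvalues M" "\<And>x. m * (x \<bullet> x) \<le> x \<bullet> (M *v x)"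
    using least_eigenvalue_exists[OF sym] by blast
  show "Min (eigenvalues M) \<in> eigenvalues M" using m(1) finite_eigenvalues[OF sym] by (intro Min_in) auto
  have "Min (eigenvalues M) \<le> m" using m(1) finite_eigenvalues[OF sym] by simp
  then show "Min (eigenvalues M) * (x \<bullet> x) \<le> x \<bullet> (M *v x)"
    using m(2)[of x] by (meson inner_ge_zero mult_right_mono order_trans)
qed

lemma Max_eigenvalues_ge:
  fixes M :: "real ^ 'd::finite ^ 'd"
  assumes sym: "transpose M = M"
  shows "x \<bullet> (M *v x) \<le> Max (eigenvalues M) * (x \<bullet> x)"
proof -
  obtain m where m: "m \<in> eigenvalues M" "\<And>x. x \<bullet> (M *v x) \<le> m * (x \<bullet> x)"
    using greatest_eigenvalue_exists[OF sym] by blast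
  have "m \<le> Max (eigenvalues M)" using m(1) finite_eigenvalues[OF sym] by simp
  then show ?thesis using m(2)[of x] by (meson inner_ge_zero mult_right_mono order_trans)
qed

section \<open>Quadratic forms\<close>

definition quadratic_form :: "(real ^ 'd::finite \<Rightarrow> real) \<Rightarrow> bool" where
  "quadratic_form q \<longleftrightarrow> (\<exists>M. transpose M = M \<and> (\<forall>x. q x = x \<bullet> (M *v x)))"

lemma quadratic_form_zero: "quadratic_form (\<lambda>x. 0)"
  unfolding quadratic_form_def by (intro exI[of _ 0]) (auto simp: transpose_def vec_eq_iff)

lemma quadratic_form_add:
  assumes "quadratic_form p" "quadratic_form q"
  shows "quadratic_form (\<lambda>x. p x + q x)"
proof -
  obtain M N where "transpose M = M" "\<forall>x. p x = x \<bullet> (M *v x)" "transpose N = N" "\<forall>x. q x = x \<bullet> (N *v x)"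
    using assms unfolding quadratic_form_def by blast
  then show ?thesis unfolding quadratic_form_def
    by (intro exI[of _ "M + N"]) (auto simp: transpose_def vec_eq_iff matrix_vector_mult_add_rdistrib inner_add_right)
qed

lemma quadratic_form_scale:
  assumes "quadratic_form p"
  shows "quadratic_form (\<lambda>x. c * p x)"
proof -
  obtain M where "transpose M = M" "\<forall>x. p x = x \<bullet> (M *v x)"
    using assms unfolding quadratic_form_def by blast
  then show ?thesis unfolding quadratic_form_def
    by (intro exI[of _ "c *\<^sub>R M"]) (auto simp: transpose_def vec_eq_iff scaleR_matrix_vector_assoc[symmetric])
qed

lemma quadratic_form_sum: "(\<And>i. i \<in> I \<Longrightarrow> quadratic_form (q i)) \<Longrightarrow> quadratic_form (\<lambda>x. \<Sum>i\<in>I. q i x)"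
  by (induction I rule: infinite_finite_induct) (auto intro: quadratic_form_zero quadratic_form_add)

lemma quadratic_form_square:
  fixes a :: "real ^ 'd::finite"
  shows "quadratic_form (\<lambda>x. (a \<bullet> x)\<^sup>2)"
proof -
  define M :: "real ^ 'd ^ 'd" where "M = (\<chi> i j. a $ i * a $ j)"
  have Mx: "M *v x = (a \<bullet> x) *\<^sub>R a" for x
    by (simp add: M_def vec_eq_iff matrix_vector_mult_def inner_vec_def sum_distrib_left mult_ac)
  have sym: "transpose M = M" by (simp add: M_def transpose_def vec_eq_iff mult.commute)
  have "(a \<bullet> x)\<^sup>2 = x \<bullet> (M *v x)" for x by (simp add: Mx power2_eq_square inner_commute)
  with sym show ?thesis unfolding quadratic_form_def by blast
qed

lemma quadratic_form_cmod_square: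
  fixes c :: "'i \<Rightarrow> complex"
  shows "quadratic_form (\<lambda>x. (cmod (\<Sum>i\<in>I. c i * of_real (a i \<bullet> x)))\<^sup>2)"
proof -
  have "(cmod (\<Sum>i\<in>I. c i * of_real (a i \<bullet> x)))\<^sup>2 =
      ((\<Sum>i\<in>I. Re (c i) *\<^sub>R a i) \<bullet> x)\<^sup>2 + ((\<Sum>i\<in>I. Im (c i) *\<^sub>R a i) \<bullet> x)\<^sup>2" for x
    by (simp add: cmod_power2 inner_sum_left)
  then show ?thesis by (simp only: quadratic_form_add quadratic_form_square)
qed

text \<open>
  A nonzero kernel vector, scaled to length one, would be a zero of the form.
\<close>

lemma positive_quadratic_form_nondegenerate:
  assumes q: "quadratic_form q" and eq: "\<And>x. norm x = 1 \<Longrightarrow> f x = q x" and pos: "\<And>x. norm x = 1 \<Longrightarrow> 0 < f x"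
  shows "nondegenerate_form f"
proof -
  obtain M where M: "transpose M = M" "\<And>x. q x = x \<bullet> (M *v x)"
    using q unfolding quadratic_form_def by blast
  have "x = 0" if "M *v x = 0" for x
  proof (rule ccontr)
    assume x: "x \<noteq> 0"
    then have n: "norm (x /\<^sub>R norm x) = 1" by simp
    have "q (x /\<^sub>R norm x) = 0" using that unfolding M(2) by (simp add: matrix_vector_mult_scaleR)
    then show False using pos[OF n] eq[OF n] by simp
  qed
  then have "invertible M"
    using matrix_left_invertible_ker[of M] invertible_left_inverse[of M] by blast
  then show ?thesis unfolding nondegenerate_form_def using M eq by auto
qed

section \<open>From discrete to metric eigenvalues\<close>

text \<open>
  The square root of the metric eigenvalue in the \<open>j\<close>-th family, as a function of the discrete
  eigenvalue \<open>y\<close>. For every \<open>j\<close> it satisfies \<open>cos (momentum j y) = 1 - y\<close>, which makes its derivative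
  \<open>1 / sin (momentum j y)\<close> regardless of the parity of \<open>j\<close>.
\<close>

definition momentum :: "nat \<Rightarrow> real \<Rightarrow> real" where
  "momentum j y = (if even j then arccos (1 - y) + pi * real j else (pi - arccos (1 - y)) + pi * real j)"

lemma momentum_nonneg: "0 \<le> y \<Longrightarrow> y \<le> 2 \<Longrightarrow> 0 \<le> momentum j y"
  using arccos_lbound[of "1 - y"] arccos_ubound[of "1 - y"] by (auto simp: momentum_def)

lemma cos_momentum: "0 \<le> y \<Longrightarrow> y \<le> 2 \<Longrightarrow> cos (momentum j y) = 1 - y"
  by (auto simp: momentum_def cos_add sin_add cos_diff sin_diff cos_npi2 sin_npi2 minus_one_power_iff)

lemma momentum_derivative:
  assumes "0 < y" "y < 2"
  shows "(momentum j has_real_derivative 1 / sin (momentum j y)) (at y)" "sin (momentum j y) \<noteq> 0"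
proof -
  define a where "a = arccos (1 - y)"
  have sa: "sin a = sqrt (1 - (1 - y)\<^sup>2)" unfolding a_def using assms by (intro sin_arccos_abs) auto
  have "(1 - y)\<^sup>2 < 1" using assms by (simp add: abs_square_less_1 abs_less_iff)
  then have pos: "0 < sin a" by (simp add: sa)
  have da: "((\<lambda>y. arccos (1 - y)) has_real_derivative 1 / sin a) (at y)"
  proof -
    have "(arccos has_real_derivative inverse (- sqrt (1 - (1 - y)\<^sup>2))) (at (1 - y))"
      using assms by (intro DERIV_arccos) auto
    moreover have "((\<lambda>y::real. 1 - y) has_real_derivative - 1) (at y)"
      by (auto intro!: derivative_eq_intros)
    ultimately have "((\<lambda>y. arccos (1 - y)) has_real_derivative inverse (- sqrt (1 - (1 - y)\<^sup>2)) * - 1) (at y)"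
      by (rule DERIV_chain2)
    then show ?thesis by (simp add: sa divide_inverse)
  qed
  have sz: "sin (momentum j y) = (if even j then sin a else - sin a)"
    by (auto simp: momentum_def a_def[symmetric] sin_add sin_diff sin_npi2 cos_npi2 minus_one_power_iff)
  show "sin (momentum j y) \<noteq> 0" using pos sz by (auto split: if_splits)
  show "(momentum j has_real_derivative 1 / sin (momentum j y)) (at y)"
  proof (cases "even j")
    case True
    then have "momentum j = (\<lambda>y. arccos (1 - y) + pi * real j)" by (simp add: momentum_def fun_eq_iff)
    then show ?thesis using True sz DERIV_add[OF da DERIV_const[of "pi * real j"]] by simp
  next
    case False
    then have "momentum j = (\<lambda>y. (pi + pi * real j) - arccos (1 - y))" by (simp add: momentum_def fun_eq_iff)
    then show ?thesis using False sz DERIV_diff[OF DERIV_const[of "pi + pi * real j"] da] by simp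
  qed
qed

lemma momentum_square_derivative:
  assumes "0 < y" "y < 2"
  shows "((\<lambda>y. (momentum j y)\<^sup>2) has_real_derivative 2 * momentum j y / sin (momentum j y)) (at y)"
    and "\<exists>c. ((\<lambda>y. 2 * momentum j y / sin (momentum j y)) has_real_derivative c) (at y)"
proof -
  note d = momentum_derivative[OF assms, of j]
  show "((\<lambda>y. (momentum j y)\<^sup>2) has_real_derivative 2 * momentum j y / sin (momentum j y)) (at y)"
    by (rule derivative_eq_intros d refl)+ simp
  have s: "((\<lambda>y. sin (momentum j y)) has_real_derivative cos (momentum j y) * (1 / sin (momentum j y))) (at y)"
    by (rule DERIV_chain2[OF DERIV_sin d(1)])
  show "\<exists>c. ((\<lambda>y. 2 * momentum j y / sin (momentum j y)) has_real_derivative c) (at y)"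
    using DERIV_divide[OF DERIV_cmult[OF d(1), of 2] s d(2)] by blast
qed

lemma x_over_sin_tendsto: "((\<lambda>z::real. z / sin z) \<longlongrightarrow> 1) (at 0)"
proof -
  have "((\<lambda>z::real. sin z / z) \<longlongrightarrow> 1) (at 0)"
    using DERIV_sin[of "0::real"] by (simp add: has_field_derivative_iff)
  from tendsto_inverse[OF this] show ?thesis by simp
qed

lemma second_order_quotient:
  assumes g: "second_deriv g 0 0 b" and g0: "g 0 = 0"
  shows "((\<lambda>t. g t / t\<^sup>2) \<longlongrightarrow> b / 2) (at 0)"
proof -
  obtain g' where g': "\<forall>\<^sub>F t in nhds 0. (g has_real_derivative g' t) (at t)" "g' 0 = 0"
    "(g' has_real_derivative b) (at 0)"
    using g unfolding second_deriv_def by blast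
  have q: "((\<lambda>t. g' t / t) \<longlongrightarrow> b) (at 0)" using g'(2,3) by (simp add: has_field_derivative_iff)
  show ?thesis
  proof (rule lhopital)
    have "isCont g 0" using second_derivD(1)[OF g] DERIV_isCont by blast
    then show "g \<midarrow>0\<rightarrow> 0" by (simp add: isCont_def g0)
    show "(\<lambda>t::real. t\<^sup>2) \<midarrow>0\<rightarrow> 0" by (rule tendsto_eq_intros refl)+ simp
    show "\<forall>\<^sub>F t::real in at 0. t\<^sup>2 \<noteq> 0" by (simp add: eventually_at_filter)
    show "\<forall>\<^sub>F t::real in at 0. 2 * t \<noteq> 0" by (simp add: eventually_at_filter)
    show "\<forall>\<^sub>F t in at 0. (g has_real_derivative g' t) (at t)"
      using g'(1) by (simp add: eventually_nhds_conv_at)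
    show "\<forall>\<^sub>F t::real in at 0. ((\<lambda>t. t\<^sup>2) has_real_derivative 2 * t) (at t)"
      by (intro always_eventually allI) (auto intro!: derivative_eq_intros)
    show "(\<lambda>t. g' t / (2 * t)) \<midarrow>0\<rightarrow> b / 2"
      using tendsto_divide[OF q tendsto_const[of 2]] by (simp add: mult.commute)
  qed
qed

text \<open>
  The chain rule does not apply at \<open>t = 0\<close>, because \<open>arccos\<close> is not differentiable at \<open>1\<close>. Instead, \<open>g t\<close>
  is positive for small \<open>t \<noteq> 0\<close>, so there the derivative is \<open>2 z / sin z\<close> times \<open>g' t\<close>, where \<open>z\<close> tends to
  zero; since \<open>z\<^sup>2 / g\<close> tends to \<open>2\<close> and \<open>g' t / t\<close> tends to \<open>b\<close>, both derivatives at \<open>0\<close> can be read off.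
\<close>

lemma second_deriv_arccos_square:
  assumes g: "second_deriv g 0 0 b" and g0: "g 0 = 0" and b: "0 < b"
  shows "second_deriv (\<lambda>t. (arccos (1 - g t))\<^sup>2) 0 0 (2 * b)"
proof -
  obtain g' where g': "\<forall>\<^sub>F t in nhds 0. (g has_real_derivative g' t) (at t)" "g' 0 = 0"
    "(g' has_real_derivative b) (at 0)"
    using g unfolding second_deriv_def by blast
  note quot = second_order_quotient[OF g g0]
  have q: "((\<lambda>t. g' t / t) \<longlongrightarrow> b) (at 0)" using g'(2,3) by (simp add: has_field_derivative_iff)
  have cont: "g \<midarrow>0\<rightarrow> 0"
    using DERIV_isCont[OF second_derivD(1)[OF g]] by (simp add: isCont_def g0)
  have "\<forall>\<^sub>F t in at 0. 0 < g t / t\<^sup>2" using order_tendstoD(1)[OF quot, of 0] b by simp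
  moreover have "\<forall>\<^sub>F t::real in at 0. t \<noteq> 0" by (simp add: eventually_at_filter)
  moreover have "\<forall>\<^sub>F t in at 0. g t < 2" using order_tendstoD(2)[OF cont, of 2] by simp
  ultimately have rng: "\<forall>\<^sub>F t in at 0. 0 < g t \<and> g t < 2 \<and> t \<noteq> 0"
    by eventually_elim (auto simp: zero_less_divide_iff)
  define z where "z t = arccos (1 - g t)" for t
  have mz: "momentum 0 (g t) = z t" for t by (simp add: momentum_def z_def)
  have "z \<midarrow>0\<rightarrow> arccos 1"
    unfolding z_def
  proof (rule continuous_on_tendsto_compose[OF continuous_on_arccos'])
    show "((\<lambda>t. 1 - g t) \<longlongrightarrow> 1) (at 0)" using tendsto_diff[OF tendsto_const[of 1] cont] by simp
    show "\<forall>\<^sub>F t in at 0. 1 - g t \<in> {- 1..1}" using rng by eventually_elim auto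
  qed simp
  then have z0: "z \<midarrow>0\<rightarrow> 0" by simp
  have zne: "\<forall>\<^sub>F t in at 0. z t \<noteq> 0"
    using rng
  proof eventually_elim
    case (elim t)
    then show ?case using momentum_derivative(2)[of "g t" 0] by (auto simp: mz)
  qed
  have zat: "filterlim z (at 0) (at 0)" using z0 zne by (simp add: filterlim_at)
  have sinc: "((\<lambda>t. z t / sin (z t)) \<longlongrightarrow> 1) (at 0)" by (rule filterlim_compose[OF x_over_sin_tendsto zat])
  have half: "filterlim (\<lambda>t. z t / 2) (at 0) (at 0)"
    using tendsto_divide[OF z0 tendsto_const[of 2]] zne by (simp add: filterlim_at)
  have "((\<lambda>t. 2 * ((z t / 2) / sin (z t / 2))\<^sup>2) \<longlongrightarrow> 2 * 1\<^sup>2) (at 0)"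
    by (intro tendsto_intros filterlim_compose[OF x_over_sin_tendsto half])
  then have "((\<lambda>t. 2 * ((z t / 2) / sin (z t / 2))\<^sup>2) \<longlongrightarrow> 2) (at 0)" by simp
  then have sq: "((\<lambda>t. (z t)\<^sup>2 / g t) \<longlongrightarrow> 2) (at 0)"
  proof (rule Lim_transform_eventually)
    show "\<forall>\<^sub>F t in at 0. 2 * ((z t / 2) / sin (z t / 2))\<^sup>2 = (z t)\<^sup>2 / g t"
      using rng
    proof eventually_elim
      case (elim t)
      have "cos (z t) = 1 - g t" using cos_momentum[of "g t" 0] elim by (simp add: mz)
      moreover have "cos (2 * (z t / 2)) = 1 - 2 * (sin (z t / 2))\<^sup>2" by (rule cos_double_sin)
      ultimately have gs: "g t = 2 * (sin (z t / 2))\<^sup>2" by simp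
      show ?case unfolding gs by (simp add: power_divide)
    qed
  qed
  define H where "H t = (if t = 0 then 0 else 2 * z t / sin (z t) * g' t)" for t
  have ev: "\<forall>\<^sub>F t in at 0. ((\<lambda>t. (z t)\<^sup>2) has_real_derivative H t) (at t)"
  proof -
    have "\<forall>\<^sub>F t in at 0. (g has_real_derivative g' t) (at t)"
      using g'(1) by (simp add: eventually_nhds_conv_at)
    with rng show ?thesis
    proof eventually_elim
      case (elim t)
      then have "((\<lambda>t. (momentum 0 (g t))\<^sup>2) has_real_derivative
          2 * momentum 0 (g t) / sin (momentum 0 (g t)) * g' t) (at t)"
        by (intro DERIV_chain2[OF momentum_square_derivative(1)]) auto
      then show ?case using elim by (simp add: mz H_def)
    qed
  qed
  have z00: "z 0 = 0" by (simp add: z_def g0)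
  have at0: "((\<lambda>t. (z t)\<^sup>2) has_real_derivative 0) (at 0)"
  proof -
    have "((\<lambda>t. (z t)\<^sup>2 / g t * (g t / t\<^sup>2) * t) \<longlongrightarrow> 2 * (b / 2) * 0) (at 0)"
      by (intro tendsto_mult sq quot tendsto_ident_at)
    then have "((\<lambda>t. (z t)\<^sup>2 / t) \<longlongrightarrow> 2 * (b / 2) * 0) (at 0)"
    proof (rule Lim_transform_eventually)
      show "\<forall>\<^sub>F t in at 0. (z t)\<^sup>2 / g t * (g t / t\<^sup>2) * t = (z t)\<^sup>2 / t"
        using rng by eventually_elim (auto simp: power2_eq_square)
    qed
    then show ?thesis by (simp add: has_field_derivative_iff z00)
  qed
  have "\<forall>\<^sub>F t in nhds 0. ((\<lambda>t. (z t)\<^sup>2) has_real_derivative H t) (at t)"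
    using ev at0 by (simp add: eventually_nhds_conv_at H_def)
  moreover have "(H has_real_derivative 2 * b) (at 0)"
  proof -
    have "((\<lambda>t. 2 * (z t / sin (z t)) * (g' t / t)) \<longlongrightarrow> 2 * 1 * b) (at 0)"
      by (intro tendsto_mult sinc q tendsto_const)
    then have "((\<lambda>t. H t / t) \<longlongrightarrow> 2 * 1 * b) (at 0)"
    proof (rule Lim_transform_eventually)
      show "\<forall>\<^sub>F t in at 0. 2 * (z t / sin (z t)) * (g' t / t) = H t / t"
        using rng by eventually_elim (auto simp: H_def)
    qed
    then show ?thesis by (simp add: has_field_derivative_iff H_def)
  qed
  ultimately show ?thesis unfolding second_deriv_def z_def by (intro exI[of _ H]) (auto simp: H_def)
qed

lemma phase_quotient_tendsto:
  "((\<lambda>t. (cmod (1 - exp (\<i> * of_real (s * t))))\<^sup>2 / t\<^sup>2) \<longlongrightarrow> s\<^sup>2) (at (0::real))"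
proof -
  have eq: "(cmod (1 - exp (\<i> * of_real (s * t))))\<^sup>2 = 4 * (sin (s * t / 2))\<^sup>2" for t
  proof -
    have "(cmod (1 - exp (\<i> * of_real (s * t))))\<^sup>2 = (1 - cos (s * t))\<^sup>2 + (sin (s * t))\<^sup>2"
      unfolding cis_conv_exp[symmetric] by (simp add: cmod_power2)
    also have "\<dots> = 2 - 2 * cos (2 * (s * t / 2))"
      using sin_cos_squared_add[of "s * t"] by (simp add: power2_diff)
    also have "\<dots> = 4 * (sin (s * t / 2))\<^sup>2" unfolding cos_double_sin by simp
    finally show ?thesis .
  qed
  have "((\<lambda>t. sin (s * t / 2)) has_real_derivative s / 2) (at 0)"
    by (auto intro!: derivative_eq_intros)
  then have "((\<lambda>t. sin (s * t / 2) / t) \<longlongrightarrow> s / 2) (at 0)" by (simp add: has_field_derivative_iff)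
  then have "((\<lambda>t. 4 * (sin (s * t / 2) / t)\<^sup>2) \<longlongrightarrow> 4 * (s / 2)\<^sup>2) (at 0)"
    by (intro tendsto_mult tendsto_power tendsto_const)
  then show ?thesis unfolding eq by (simp add: power_divide)
qed

section \<open>Eigenvalues of the Floquet matrices\<close>

context periodic_graph_with_tree
begin

definition eigval :: "real ^ 'd \<Rightarrow> nat \<Rightarrow> real" where
  "eigval \<theta> = fst (SOME p. eigenbasis S (floquet \<theta>) (fst p) (snd p))"

definition eigvec :: "real ^ 'd \<Rightarrow> nat \<Rightarrow> 'v set \<Rightarrow> complex" where
  "eigvec \<theta> = snd (SOME p. eigenbasis S (floquet \<theta>) (fst p) (snd p))"

lemma eigenbasis_floquet: "eigenbasis S (floquet \<theta>) (eigval \<theta>) (eigvec \<theta>)"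
proof -
  obtain l e where "eigenbasis S (floquet \<theta>) l e"
    using eigenbasis_exists[OF finite_quotient_verts floquet_hermitian] by blast
  then have "eigenbasis S (floquet \<theta>) (fst (l, e)) (snd (l, e))" by simp
  then show ?thesis unfolding eigval_def eigvec_def
    by (rule someI[of "\<lambda>p. eigenbasis S (floquet \<theta>) (fst p) (snd p)"])
qed

lemma energy_eigenvector:
  assumes "\<And>u. u \<in> S \<Longrightarrow> apply_on S (floquet \<theta>) f u = of_real c * f u"
  shows "energy \<theta> f = c * (\<Sum>u\<in>S. (cmod (f u))\<^sup>2)"
proof -
  have "complex_of_real (energy \<theta> f) = inner_on S (\<lambda>u. of_real c * f u) f"
    unfolding floquet_form[symmetric] by (rule inner_on_cong) (use assms in auto)
  also have "\<dots> = of_real (c * (\<Sum>u\<in>S. (cmod (f u))\<^sup>2))"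
    by (simp only: inner_on_scale_left inner_on_self of_real_mult)
  finally show ?thesis by (simp only: of_real_eq_iff)
qed

lemma eigvec_norm:
  assumes "k < card S"
  shows "(\<Sum>u\<in>S. (cmod (eigvec \<theta> k u))\<^sup>2) = 1"
proof -
  have "complex_of_real (\<Sum>u\<in>S. (cmod (eigvec \<theta> k u))\<^sup>2) = of_real 1"
    unfolding inner_on_self[symmetric] using eigenbasisD(3)[OF eigenbasis_floquet assms assms] by simp
  then show ?thesis by (simp only: of_real_eq_iff)
qed

lemma eigval_bounds:
  assumes k: "k < card S"
  shows "0 \<le> eigval \<theta> k" "eigval \<theta> k \<le> 2"
proof -
  have "energy \<theta> (eigvec \<theta> k) = eigval \<theta> k"
    using energy_eigenvector[OF eigenbasisD(2)[OF eigenbasis_floquet k]] eigvec_norm[OF k] by simp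
  then show "0 \<le> eigval \<theta> k" "eigval \<theta> k \<le> 2"
    using energy_nonneg[of \<theta> "eigvec \<theta> k"] energy_le[of \<theta> "eigvec \<theta> k"] eigvec_norm[OF k, of \<theta>] by auto
qed

lemma floquet_tendsto: "((\<lambda>\<theta>. floquet \<theta> u v) \<longlongrightarrow> floquet \<theta>0 u v) (nhds \<theta>0)"
  unfolding floquet_eq arc_matrix_def phase_def divide_inverse
  by (intro tendsto_intros filterlim_ident)

lemma eigval_tendsto: "j < card S \<Longrightarrow> ((\<lambda>\<theta>. eigval \<theta> j) \<longlongrightarrow> eigval \<theta>0 j) (nhds \<theta>0)"
  by (rule eigenvalue_tendsto[OF finite_quotient_verts eigenbasis_floquet _ floquet_tendsto])

section \<open>Eigenvalues along lines\<close>

lemma arc_matrix_vector_derivative: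
  assumes "\<And>a. a \<in> arcs (oriented Q) \<Longrightarrow> ((\<lambda>t. w t a) has_vector_derivative w' a) (at x)"
  shows "((\<lambda>t. arc_matrix P (w t) u v) has_vector_derivative arc_matrix P w' u v) (at x)"
  unfolding arc_matrix_def
  by (intro has_vector_derivative_divide has_vector_derivative_sum assms) auto

lemma phase_line_derivative:
  "((\<lambda>t. phase (\<theta>0 + t *\<^sub>R \<omega>) a) has_vector_derivative
     \<i> * of_real (tau_oriented P V0 a \<bullet> \<omega>) * phase (\<theta>0 + t *\<^sub>R \<omega>) a) (at t)"
proof -
  let ?A = "complex_of_real (tau_oriented P V0 a \<bullet> \<theta>0)" and ?B = "complex_of_real (tau_oriented P V0 a \<bullet> \<omega>)"
  have eq: "phase (\<theta>0 + t *\<^sub>R \<omega>) a = exp (\<i> * (?A + of_real t * ?B))" for t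
    by (simp add: phase_def inner_add_right)
  have "((\<lambda>z. exp (\<i> * (?A + z * ?B))) has_field_derivative \<i> * ?B * exp (\<i> * (?A + of_real t * ?B))) (at (of_real t))"
    by (rule derivative_eq_intros refl | simp)+
  from has_vector_derivative_real_field[OF this] show ?thesis unfolding eq .
qed

text \<open>
  The weights of the first and second derivative of the Floquet matrix in the direction \<open>\<omega>\<close>; the minus
  sign of the adjacency part of the Floquet matrix is included.
\<close>

definition line_weight1 :: "real ^ 'd \<Rightarrow> real ^ 'd \<Rightarrow> 'e set \<times> bool \<Rightarrow> complex" where
  "line_weight1 \<theta> \<omega> a = - (\<i> * of_real (tau_oriented P V0 a \<bullet> \<omega>) * phase \<theta> a)"

definition line_weight2 :: "real ^ 'd \<Rightarrow> real ^ 'd \<Rightarrow> 'e set \<times> bool \<Rightarrow> complex" where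
  "line_weight2 \<theta> \<omega> a = of_real ((tau_oriented P V0 a \<bullet> \<omega>)\<^sup>2) * phase \<theta> a"

lemma floquet_line_derivative:
  "((\<lambda>t. floquet (\<theta>0 + t *\<^sub>R \<omega>) u v) has_vector_derivative
     arc_matrix P (line_weight1 (\<theta>0 + t *\<^sub>R \<omega>) \<omega>) u v) (at t)"
proof -
  have "((\<lambda>t. (if u = v then 1 else 0) - arc_matrix P (phase (\<theta>0 + t *\<^sub>R \<omega>)) u v) has_vector_derivative
      0 - arc_matrix P (\<lambda>a. \<i> * of_real (tau_oriented P V0 a \<bullet> \<omega>) * phase (\<theta>0 + t *\<^sub>R \<omega>) a) u v) (at t)"
    by (intro has_vector_derivative_diff has_vector_derivative_const arc_matrix_vector_derivative phase_line_derivative)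
  moreover have "0 - arc_matrix P (\<lambda>a. \<i> * of_real (tau_oriented P V0 a \<bullet> \<omega>) * phase (\<theta>0 + t *\<^sub>R \<omega>) a) u v =
      arc_matrix P (line_weight1 (\<theta>0 + t *\<^sub>R \<omega>) \<omega>) u v"
    by (simp add: arc_matrix_def line_weight1_def sum_negf)
  ultimately show ?thesis unfolding floquet_eq by simp
qed

lemma line_weight1_derivative:
  "((\<lambda>t. arc_matrix P (line_weight1 (\<theta>0 + t *\<^sub>R \<omega>) \<omega>) u v) has_vector_derivative
     arc_matrix P (line_weight2 (\<theta>0 + t *\<^sub>R \<omega>) \<omega>) u v) (at t)"
proof (rule arc_matrix_vector_derivative)
  fix a
  let ?c = "- (\<i> * complex_of_real (tau_oriented P V0 a \<bullet> \<omega>))"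
  have "((\<lambda>t. ?c * phase (\<theta>0 + t *\<^sub>R \<omega>) a) has_vector_derivative
      ?c * (\<i> * of_real (tau_oriented P V0 a \<bullet> \<omega>) * phase (\<theta>0 + t *\<^sub>R \<omega>) a)) (at t)"
    by (intro has_vector_derivative_mult_right phase_line_derivative)
  moreover have "?c * (\<i> * of_real (tau_oriented P V0 a \<bullet> \<omega>) * phase (\<theta>0 + t *\<^sub>R \<omega>) a) = line_weight2 (\<theta>0 + t *\<^sub>R \<omega>) \<omega> a"
  proof -
    have sq: "(\<i> * s) * (\<i> * s * p) = - (s * s * p)" for s p :: complex
    proof -
      have "(\<i> * s) * (\<i> * s * p) = (\<i> * \<i>) * (s * s * p)" by (simp only: mult_ac)
      then show ?thesis by simp
    qed
    show ?thesis
      unfolding line_weight2_def power2_eq_square of_real_mult mult_minus_left sq by simp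
  qed
  ultimately show "((\<lambda>t. line_weight1 (\<theta>0 + t *\<^sub>R \<omega>) \<omega> a) has_vector_derivative line_weight2 (\<theta>0 + t *\<^sub>R \<omega>) \<omega> a) (at t)"
    unfolding line_weight1_def by simp
qed

text \<open>
  The derivatives of the \<open>k\<close>-th eigenvalue in the direction \<open>\<omega>\<close>, as given by perturbation theory.
\<close>

definition slope :: "real ^ 'd \<Rightarrow> nat \<Rightarrow> real ^ 'd \<Rightarrow> real" where
  "slope \<theta> k \<omega> = Re (inner_on S (apply_on S (arc_matrix P (line_weight1 \<theta> \<omega>)) (eigvec \<theta> k)) (eigvec \<theta> k))"

definition curvature :: "real ^ 'd \<Rightarrow> nat \<Rightarrow> real ^ 'd \<Rightarrow> real" where
  "curvature \<theta> k \<omega> =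
     Re (inner_on S (apply_on S (arc_matrix P (line_weight2 \<theta> \<omega>)) (eigvec \<theta> k)) (eigvec \<theta> k)) +
     2 * (\<Sum>j\<in>{..<card S} - {k}.
        (cmod (inner_on S (apply_on S (arc_matrix P (line_weight1 \<theta> \<omega>)) (eigvec \<theta> k)) (eigvec \<theta> j)))\<^sup>2 /
        (eigval \<theta> k - eigval \<theta> j))"

definition simple_at :: "real ^ 'd \<Rightarrow> nat \<Rightarrow> bool" where
  "simple_at \<theta> k \<longleftrightarrow> k < card S \<and> (\<forall>j<card S. j \<noteq> k \<longrightarrow> eigval \<theta> j \<noteq> eigval \<theta> k)"

lemma eigval_second_deriv:
  assumes "simple_at \<theta> k"
  shows "second_deriv (\<lambda>t. eigval (\<theta> + t *\<^sub>R \<omega>) k) 0 (slope \<theta> k \<omega>) (curvature \<theta> k \<omega>)"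
proof -
  have k: "k < card S" and simple: "\<And>j. j < card S \<Longrightarrow> j \<noteq> k \<Longrightarrow> eigval \<theta> j \<noteq> eigval \<theta> k"
    using assms by (auto simp: simple_at_def)
  have herm1: "hermitian_on S (arc_matrix P (line_weight1 \<theta> \<omega>))"
    by (rule arc_matrix_hermitian) (simp add: line_weight1_def phase_flip tau_oriented_def)
  show ?thesis
    using simple_eigenvalue_second_deriv[of S "\<lambda>t. floquet (\<theta> + t *\<^sub>R \<omega>)" "\<lambda>t. eigval (\<theta> + t *\<^sub>R \<omega>)"
        "\<lambda>t. eigvec (\<theta> + t *\<^sub>R \<omega>)" k 0 "\<lambda>t. arc_matrix P (line_weight1 (\<theta> + t *\<^sub>R \<omega>) \<omega>)"
        "arc_matrix P (line_weight2 (\<theta> + 0 *\<^sub>R \<omega>) \<omega>)",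
        OF finite_quotient_verts floquet_hermitian eigenbasis_floquet k _ floquet_line_derivative
          line_weight1_derivative] simple herm1
    unfolding slope_def curvature_def by simp
qed

section \<open>Bands\<close>

lemma discrete_mult_eq: "discrete_mult P V0 \<theta> c = card {j. j < card S \<and> eigval \<theta> j = c}"
  unfolding discrete_mult_def discrete_eigenspace_def
  by (rule eigenspace_dim[OF finite_quotient_verts floquet_hermitian eigenbasis_floquet])

lemma count_spectrum: "count (image_mset (eigval \<theta>) (mset_set {..<card S})) c = discrete_mult P V0 \<theta> c"
  unfolding discrete_mult_eq by (subst count_image_mset_set) auto

lemma finite_discrete_mult: "finite {c. 0 < discrete_mult P V0 \<theta> c}"
proof -
  have "{c. 0 < discrete_mult P V0 \<theta> c} \<subseteq> set_mset (image_mset (eigval \<theta>) (mset_set {..<card S}))"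
    unfolding count_spectrum[symmetric] by (auto simp: count_greater_zero_iff)
  then show ?thesis by (rule finite_subset) simp
qed

lemma spectrum_eq: "mset_of_mult (discrete_mult P V0 \<theta>) = image_mset (eigval \<theta>) (mset_set {..<card S})"
  by (rule multiset_eqI) (simp only: count_mset_of_mult[OF finite_discrete_mult] count_spectrum)

lemma flat_mult_le: "flat_mult P V0 c \<le> discrete_mult P V0 \<theta> c"
  unfolding flat_mult_def by (rule cINF_lower) auto

lemma count_flat: "count (mset_of_mult (flat_mult P V0)) c = flat_mult P V0 c"
proof (rule count_mset_of_mult)
  have "{c. 0 < flat_mult P V0 c} \<subseteq> {c. 0 < discrete_mult P V0 0 c}"
    using flat_mult_le[of _ 0] by (auto intro: less_le_trans)
  then show "finite {c. 0 < flat_mult P V0 c}" using finite_discrete_mult finite_subset by blast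
qed

abbreviation "flat_part \<equiv> mset_of_mult (flat_mult P V0)"

lemma flat_part_subset: "flat_part \<subseteq># mset_of_mult (discrete_mult P V0 \<theta>)"
  by (rule mset_subset_eqI) (simp add: count_flat count_mset_of_mult[OF finite_discrete_mult] flat_mult_le)

lemma size_spectrum: "size (mset_of_mult (discrete_mult P V0 \<theta>)) = card S"
  by (simp add: spectrum_eq)

text \<open>
  An element that survives the removal of the flat part occurs more often in the whole spectrum than in
  the flat part.
\<close>

lemma band_value:
  assumes n: "n \<in> {1..nu P - flat_count P V0}"
  shows "\<exists>k<card S. band P V0 n \<theta> = eigval \<theta> k"
    and "flat_mult P V0 (band P V0 n \<theta>) < discrete_mult P V0 \<theta> (band P V0 n \<theta>)"
proof -
  let ?M = "mset_of_mult (discrete_mult P V0 \<theta>)"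
  have sz: "size (?M - flat_part) = card S - size flat_part"
    using flat_part_subset by (simp add: size_Diff_submset size_spectrum)
  have "length (sorted_list_of_multiset (?M - flat_part)) = size (?M - flat_part)"
    by (metis mset_sorted_list_of_multiset size_mset)
  then have "n - 1 < length (sorted_list_of_multiset (?M - flat_part))"
    using n sz by (auto simp: nu_def flat_count_def)
  then have "band P V0 n \<theta> \<in> set (sorted_list_of_multiset (?M - flat_part))"
    unfolding band_def by (rule nth_mem)
  then have mem: "band P V0 n \<theta> \<in># ?M - flat_part" by simp
  then show "flat_mult P V0 (band P V0 n \<theta>) < discrete_mult P V0 \<theta> (band P V0 n \<theta>)"
    by (simp add: in_diff_count count_flat count_mset_of_mult[OF finite_discrete_mult])
  from mem have "band P V0 n \<theta> \<in># ?M" by (rule in_diffD)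
  then show "\<exists>k<card S. band P V0 n \<theta> = eigval \<theta> k" unfolding spectrum_eq by auto
qed

lemma band_continuation:
  assumes n: "n \<in> {1..nu P - flat_count P V0}" and simple: "simple_at \<theta>0 k"
    and flat: "flat_mult P V0 (eigval \<theta>0 k) = 0" and start: "band P V0 n \<theta>0 = eigval \<theta>0 k"
  shows "\<forall>\<^sub>F \<theta> in nhds \<theta>0. band P V0 n \<theta> = eigval \<theta> k"
  unfolding band_def
proof (rule remaining_simple_eigenvalue_continuation[where n = "card S"])
  show "n - 1 < card S - size flat_part" using n by (auto simp: nu_def flat_count_def)
  show "eigval \<theta>0 k \<notin># flat_part" using flat by (metis count_flat count_eq_zero_iff)
  show "sorted_list_of_multiset (mset_of_mult (discrete_mult P V0 \<theta>0) - flat_part) ! (n - 1) = eigval \<theta>0 k"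
    using start by (simp add: band_def)
qed (use simple in \<open>auto simp: simple_at_def spectrum_eq flat_part_subset[unfolded spectrum_eq] intro: eigval_tendsto eigenbasisD(4)[OF eigenbasis_floquet]\<close>)

lemma line_eventually:
  fixes R :: "real ^ 'd \<Rightarrow> bool"
  assumes "\<forall>\<^sub>F \<theta> in nhds \<theta>0. R \<theta>"
  shows "\<forall>\<^sub>F t in nhds (0::real). R (\<theta>0 + t *\<^sub>R \<omega>)"
proof -
  have "filterlim (\<lambda>t::real. \<theta>0 + t *\<^sub>R \<omega>) (nhds (\<theta>0 + 0 *\<^sub>R \<omega>)) (nhds 0)"
    by (intro tendsto_intros filterlim_ident)
  then show ?thesis using assms unfolding filterlim_iff by simp
qed

lemma band_second_deriv:
  assumes "n \<in> {1..nu P - flat_count P V0}" "simple_at \<theta>0 k"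
    "flat_mult P V0 (eigval \<theta>0 k) = 0" "band P V0 n \<theta>0 = eigval \<theta>0 k"
  shows "second_deriv (\<lambda>t. band P V0 n (\<theta>0 + t *\<^sub>R \<omega>)) 0 (slope \<theta>0 k \<omega>) (curvature \<theta>0 k \<omega>)"
proof (rule second_deriv_cong[OF eigval_second_deriv[OF assms(2)]])
  show "\<forall>\<^sub>F t in nhds 0. eigval (\<theta>0 + t *\<^sub>R \<omega>) k = band P V0 n (\<theta>0 + t *\<^sub>R \<omega>)"
    using line_eventually[OF band_continuation[OF assms], of \<omega>] by eventually_elim simp
qed

lemma metric_band_momentum: "metric_band P V0 n j \<theta> = (momentum j (band P V0 n \<theta>))\<^sup>2"
  by (simp add: metric_band_def zband_def momentum_def Let_def)

lemma local_extremum_derivative_zero: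
  fixes f :: "real ^ 'd \<Rightarrow> real"
  assumes g: "(g has_real_derivative a) (at 0)" and gf: "\<And>t. g t = f (x + t *\<^sub>R \<omega>)"
    and ext: "local_min_at f x \<or> local_max_at f x"
  shows "a = 0"
proof -
  from ext show ?thesis
  proof
    assume "local_min_at f x"
    then have "\<forall>\<^sub>F t in nhds 0. g 0 \<le> g t"
      unfolding local_min_at_def gf using line_eventually[of "\<lambda>y. f x \<le> f y" x \<omega>] by simp
    then obtain d where "d > 0" "\<forall>y. \<bar>0 - y\<bar> < d \<longrightarrow> g 0 \<le> g y"
      unfolding eventually_nhds_metric by (auto simp: dist_real_def)
    then show ?thesis by (rule DERIV_local_min[OF g])
  next
    assume "local_max_at f x"
    then have "\<forall>\<^sub>F t in nhds 0. g t \<le> g 0"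
      unfolding local_max_at_def gf using line_eventually[of "\<lambda>y. f y \<le> f x" x \<omega>] by simp
    then obtain d where "d > 0" "\<forall>y. \<bar>0 - y\<bar> < d \<longrightarrow> g y \<le> g 0"
      unfolding eventually_nhds_metric by (auto simp: dist_real_def)
    then show ?thesis by (rule DERIV_local_max[OF g])
  qed
qed

lemma effective_form_of_second_deriv:
  fixes f :: "real ^ 'd \<Rightarrow> real"
  assumes "second_deriv (\<lambda>t. f (\<theta>0 + t *\<^sub>R \<omega>)) 0 a b"
  shows "effective_form_exists f \<theta>0 \<omega>" "effective_form f \<theta>0 \<omega> = b / 2"
  using second_derivD(2,3)[OF assms] by (simp_all add: effective_form_exists_def effective_form_def)

text \<open>
  The excluded values of the metric band function are those where the discrete eigenvalue is \<open>0\<close> or \<open>2\<close>,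
  the end points at which \<open>arccos\<close> fails to be differentiable. The discrete eigenvalue is simple because
  the metric one is, and it is not flat because its multiplicity \<open>1\<close> exceeds the flat one.
\<close>

theorem effective_form_at_extremum:
  assumes n: "n \<in> {1..nu P - flat_count P V0}"
    and ext: "local_min_at (metric_band P V0 n j) \<theta>0 \<or> local_max_at (metric_band P V0 n j) \<theta>0"
    and gap: "\<forall>k::int. metric_band P V0 n j \<theta>0 \<noteq> (pi * of_int k)\<^sup>2"
    and sm: "simple_metric_eigenvalue P \<theta>0 (metric_band P V0 n j \<theta>0)"
  shows "effective_form_exists (metric_band P V0 n j) \<theta>0 \<omega> \<and>
     effective_form_exists (band P V0 n) \<theta>0 \<omega> \<and>
     effective_form (metric_band P V0 n j) \<theta>0 \<omega> =
       2 * sqrt (metric_band P V0 n j \<theta>0) / sin (sqrt (metric_band P V0 n j \<theta>0))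
         * effective_form (band P V0 n) \<theta>0 \<omega>"
proof -
  obtain k where k: "k < card S" "band P V0 n \<theta>0 = eigval \<theta>0 k" using band_value(1)[OF n] by blast
  define y where "y = eigval \<theta>0 k"
  have bandy: "band P V0 n \<theta>0 = y" using k by (simp add: y_def)
  have y02: "0 \<le> y" "y \<le> 2" using eigval_bounds[OF k(1)] by (auto simp: y_def)
  define z where "z = momentum j y"
  have mz: "metric_band P V0 n j \<theta>0 = z\<^sup>2" by (simp add: metric_band_momentum bandy z_def)
  \<comment> \<open>At both end points of \<open>[0, 2]\<close> the momentum is an integer multiple of \<open>\<pi>\<close>.\<close>
  have "y \<noteq> 0"
  proof
    assume "y = 0"
    then have "z = pi * of_int (if even j then int j else int j + 1)" by (simp add: z_def momentum_def algebra_simps)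
    then show False using gap mz by metis
  qed
  moreover have "y \<noteq> 2"
  proof
    assume "y = 2"
    then have "z = pi * of_int (if even j then int j + 1 else int j)" by (simp add: z_def momentum_def algebra_simps)
    then show False using gap mz by metis
  qed
  ultimately have y: "0 < y" "y < 2" using y02 by auto
  have sz: "sin z \<noteq> 0" unfolding z_def by (rule momentum_derivative(2)[OF y])
  have z0: "0 \<le> z" unfolding z_def by (rule momentum_nonneg[OF y02])
  have cz: "cos z = 1 - y" unfolding z_def by (rule cos_momentum[OF y02])
  have uniq: "i = k" if "i < card S" "eigval \<theta>0 i = eigval \<theta>0 k" for i
    by (rule simple_metric_imp_simple_discrete[OF sz sm[unfolded mz] eigenbasis_floquet])
      (use that k cz in \<open>auto simp: y_def\<close>)
  then have simple: "simple_at \<theta>0 k" using k by (auto simp: simple_at_def)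
  have "{i. i < card S \<and> eigval \<theta>0 i = eigval \<theta>0 k} = {k}" using uniq k by auto
  then have "discrete_mult P V0 \<theta>0 (eigval \<theta>0 k) = 1" by (simp add: discrete_mult_eq)
  then have flat: "flat_mult P V0 (eigval \<theta>0 k) = 0" using band_value(2)[OF n, of \<theta>0] k by simp
  let ?g = "\<lambda>t. band P V0 n (\<theta>0 + t *\<^sub>R \<omega>)"
  have g: "second_deriv ?g 0 (slope \<theta>0 k \<omega>) (curvature \<theta>0 k \<omega>)"
    by (rule band_second_deriv[OF n simple flat k(2)])
  have g0: "?g 0 = y" using bandy by simp
  let ?G' = "\<lambda>y. 2 * momentum j y / sin (momentum j y)"
  obtain c where c: "(?G' has_real_derivative c) (at (?g 0))"
    using momentum_square_derivative(2)[OF y, of j] unfolding g0 by blast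
  have "\<forall>\<^sub>F x in nhds (?g 0). 0 < x \<and> x < 2"
    unfolding g0 using y by (intro eventually_conj order_tendstoD[OF filterlim_ident])
  then have G: "\<forall>\<^sub>F x in nhds (?g 0). ((\<lambda>y. (momentum j y)\<^sup>2) has_real_derivative ?G' x) (at x)"
    by eventually_elim (auto intro: momentum_square_derivative)
  let ?h = "\<lambda>t. metric_band P V0 n j (\<theta>0 + t *\<^sub>R \<omega>)"
  have h: "second_deriv ?h 0 (?G' y * slope \<theta>0 k \<omega>)
      (c * slope \<theta>0 k \<omega> * slope \<theta>0 k \<omega> + ?G' y * curvature \<theta>0 k \<omega>)"
    using second_deriv_chain[OF g G c] unfolding g0 metric_band_momentum .
  have "?G' y * slope \<theta>0 k \<omega> = 0"
    by (rule local_extremum_derivative_zero[OF second_derivD(1)[OF h] _ ext]) simp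
  moreover have "?G' y \<noteq> 0" using sz by (auto simp: z_def[symmetric])
  ultimately have slope: "slope \<theta>0 k \<omega> = 0" by simp
  have "effective_form (metric_band P V0 n j) \<theta>0 \<omega> = ?G' y * curvature \<theta>0 k \<omega> / 2"
    using effective_form_of_second_deriv(2)[OF h] slope by simp
  also have "\<dots> = ?G' y * effective_form (band P V0 n) \<theta>0 \<omega>"
    using effective_form_of_second_deriv(2)[OF g] by simp
  also have "?G' y = 2 * sqrt (metric_band P V0 n j \<theta>0) / sin (sqrt (metric_band P V0 n j \<theta>0))"
    using z0 by (simp add: mz z_def[symmetric] real_sqrt_abs)
  finally show ?thesis
    using effective_form_of_second_deriv(1)[OF h] effective_form_of_second_deriv(1)[OF g] by blast
qed

section \<open>The beginning of the spectrum\<close>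

lemma kappa_pos: "0 < real (kappa P)"
proof -
  obtain u where u: "u \<in> S" using card_S_pos by (metis all_not_in_conv card.empty less_irrefl)
  have "\<kappa> u \<le> kappa P" unfolding kappa_def using u finite_quotient_verts by (intro member_le_sum) auto
  then show ?thesis using degree_pos[OF u] by simp
qed

lemma phase_0 [simp]: "phase 0 a = 1" by (simp add: phase_def)

text \<open>
  An eigenvector for the eigenvalue \<open>0\<close> has no energy, so its rescaled version does not change along any
  edge, and any two vertices are joined by a path in the tree.
\<close>

lemma zero_eigenvector_constant:
  assumes "\<And>u. u \<in> S \<Longrightarrow> apply_on S (floquet 0) f u = 0" and uv: "u \<in> S" "v \<in> S"
  shows "normalized P f u = normalized P f v"
proof -
  have "energy 0 f = 0" using energy_eigenvector[of 0 f 0] assms(1) by simp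
  then have eq: "normalized P f (tail Q x) = normalized P f (head Q x)" if "x \<in> A" for x
    unfolding energy_def using that finite_quotient_arcs by (subst (asm) sum_nonneg_eq_0_iff) auto
  obtain X where X: "X \<subseteq> A" "cmod (normalized P f u - normalized P f v) \<le>
      (\<Sum>x\<in>X. cmod (normalized P f (tail Q x) - normalized P f (head Q x)))"
    using tree_path[OF uv] by blast
  have "(\<Sum>x\<in>X. cmod (normalized P f (tail Q x) - normalized P f (head Q x))) = 0"
    using X(1) eq by (intro sum.neutral) auto
  then show ?thesis using X(2) by simp
qed

lemma normalized_zero_eigvec:
  assumes k: "k < card S" and "eigval 0 k = 0"
  shows "\<exists>c. (cmod c)\<^sup>2 = 1 / real (kappa P) \<and> (\<forall>u\<in>S. normalized P (eigvec 0 k) u = c \<and>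
      eigvec 0 k u = c * of_real (sqrt (\<kappa> u)))"
proof -
  obtain u0 where u0: "u0 \<in> S" using card_S_pos by (metis all_not_in_conv card.empty less_irrefl)
  define c where "c = normalized P (eigvec 0 k) u0"
  have n: "normalized P (eigvec 0 k) u = c" if "u \<in> S" for u
    unfolding c_def using zero_eigenvector_constant[OF _ that u0, of "eigvec 0 k"]
      eigenbasisD(2)[OF eigenbasis_floquet k, of _ 0] assms(2) by auto
  have e: "eigvec 0 k u = c * of_real (sqrt (\<kappa> u))" if "u \<in> S" for u
    using n[OF that] degree_pos[OF that] by (auto simp: normalized_def field_simps)
  have "1 = (\<Sum>u\<in>S. (cmod c)\<^sup>2 * real (\<kappa> u))"
    using eigvec_norm[OF k, of 0] by (simp add: e norm_mult power_mult_distrib)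
  also have "\<dots> = (cmod c)\<^sup>2 * real (kappa P)" by (simp add: kappa_def sum_distrib_left)
  finally have "(cmod c)\<^sup>2 = 1 / real (kappa P)" using kappa_pos by (simp add: field_simps)
  with n e show ?thesis by blast
qed

text \<open>
  The square roots of the degrees form an eigenvector for the eigenvalue \<open>0\<close>, which is the lowest
  possible one.
\<close>

lemma eigval_0_0: "eigval 0 0 = 0"
proof -
  define f where "f u = complex_of_real (sqrt (\<kappa> u))" for u
  have nf: "normalized P f u = 1" if "u \<in> S" for u
    using degree_pos[OF that] by (simp add: normalized_def f_def)
  have Af: "apply_on S (floquet 0) f u = 0" if u: "u \<in> S" for u
  proof -
    have "apply_on S (arc_matrix P (phase 0)) f u =
        (\<Sum>a\<in>{a \<in> arcs (oriented Q). src a = u}. 1) / of_real (sqrt (\<kappa> u))"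
      unfolding apply_arc_matrix[OF u] by (intro arg_cong2[where f = "(/)"] sum.cong) (auto simp: nf)
    also have "\<dots> = of_real (sqrt (\<kappa> u) * sqrt (\<kappa> u)) / of_real (sqrt (\<kappa> u))"
      by (simp add: card_oriented_tail)
    also have "\<dots> = f u" using degree_pos[OF u] by (simp only: of_real_mult f_def) simp
    finally show ?thesis by (simp add: apply_floquet[OF u])
  qed
  have fin: "finite S" by (rule finite_quotient_verts)
  have "eigval 0 j * (cmod (inner_on S f (eigvec 0 j)))\<^sup>2 = 0" if j: "j < card S" for j
  proof -
    have "0 = inner_on S (apply_on S (floquet 0) f) f"
      unfolding inner_on_def by (simp add: Af)
    also have "\<dots> = of_real (\<Sum>j<card S. eigval 0 j * (cmod (inner_on S f (eigvec 0 j)))\<^sup>2)"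
      by (rule eigenbasis_quadratic_form(1)[OF fin eigenbasis_floquet])
    finally have "complex_of_real (\<Sum>j<card S. eigval 0 j * (cmod (inner_on S f (eigvec 0 j)))\<^sup>2) = 0"
      by (rule sym)
    then have sum0: "(\<Sum>j<card S. eigval 0 j * (cmod (inner_on S f (eigvec 0 j)))\<^sup>2) = 0"
      by (simp only: of_real_eq_0_iff)
    have nonneg: "0 \<le> eigval 0 i * (cmod (inner_on S f (eigvec 0 i)))\<^sup>2" if "i \<in> {..<card S}" for i
      using eigval_bounds(1)[of i 0] that by simp
    from sum_nonneg_0[OF _ nonneg sum0] j show ?thesis by simp
  qed
  moreover have "\<exists>j<card S. inner_on S f (eigvec 0 j) \<noteq> 0"
  proof (rule ccontr)
    assume "\<not> ?thesis"
    then have z: "f u = 0" if "u \<in> S" for u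
      using eigenbasis_expansion[OF fin eigenbasis_floquet that, of f 0] by simp
    obtain u where u: "u \<in> S" using card_S_pos by (metis all_not_in_conv card.empty less_irrefl)
    then show False using z[OF u] degree_pos[OF u] by (simp add: f_def)
  qed
  ultimately obtain j where "j < card S" "eigval 0 j = 0" by auto
  then show ?thesis
    using eigenbasisD(4)[OF eigenbasis_floquet, of 0 j 0] eigval_bounds(1)[OF card_S_pos, of 0] by simp
qed

lemma simple_at_0: "simple_at 0 0"
proof -
  have "eigval 0 j \<noteq> eigval 0 0" if j: "j < card S" "j \<noteq> 0" for j
  proof
    assume "eigval 0 j = eigval 0 0"
    then have ej: "eigval 0 j = 0" by (simp add: eigval_0_0)
    obtain c where c: "(cmod c)\<^sup>2 = 1 / real (kappa P)" "\<forall>u\<in>S. eigvec 0 j u = c * of_real (sqrt (\<kappa> u))"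
      using normalized_zero_eigvec[OF j(1) ej] by blast
    obtain d where d: "(cmod d)\<^sup>2 = 1 / real (kappa P)" "\<forall>u\<in>S. eigvec 0 0 u = d * of_real (sqrt (\<kappa> u))"
      using normalized_zero_eigvec[OF card_S_pos eigval_0_0] by blast
    have nz: "c \<noteq> 0" "d \<noteq> 0" using c(1) d(1) kappa_pos by auto
    have "d * inner_on S (eigvec 0 j) h = c * inner_on S (eigvec 0 0) h" for h
      unfolding inner_on_scale_left[symmetric] by (rule inner_on_cong) (use c(2) d(2) in auto)
    from this[of "eigvec 0 j"] show False
      using nz j card_S_pos by (simp add: eigenbasisD(3)[OF eigenbasis_floquet])
  qed
  then show ?thesis using card_S_pos by (simp add: simple_at_def)
qed

text \<open>
  The lowest eigenvalue attains its minimal value \<open>0\<close> at the origin.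
\<close>

lemma slope_0: "slope 0 0 \<omega> = 0"
proof (rule local_extremum_derivative_zero[where f = "\<lambda>\<theta>. eigval \<theta> 0" and x = 0])
  show "((\<lambda>t. eigval (0 + t *\<^sub>R \<omega>) 0) has_real_derivative slope 0 0 \<omega>) (at 0)"
    by (rule second_derivD(1)[OF eigval_second_deriv[OF simple_at_0]])
  show "local_min_at (\<lambda>\<theta>. eigval \<theta> 0) 0 \<or> local_max_at (\<lambda>\<theta>. eigval \<theta> 0) 0"
    unfolding local_min_at_def using eigval_bounds(1)[OF card_S_pos] by (simp add: eigval_0_0)
qed simp

lemma eigval_line_quotient:
  "((\<lambda>t. eigval (t *\<^sub>R \<omega>) 0 / t\<^sup>2) \<longlongrightarrow> curvature 0 0 \<omega> / 2) (at 0)"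
  using second_order_quotient[of "\<lambda>t. eigval (0 + t *\<^sub>R \<omega>) 0"] eigval_second_deriv[OF simple_at_0, of \<omega>]
  by (simp add: slope_0 eigval_0_0)

text \<open>
  At the lowest eigenvalue no denominator in the second-order correction is positive. The rescaled
  eigenvector is constant, which turns the main term into the sum over the edges, and edges that are not bridges do not contribute.
\<close>

lemma curvature_0_upper:
  "curvature 0 0 \<omega> \<le> 2 / real (kappa P) * (\<Sum>x\<in>bridges P V0. (tau P V0 x \<bullet> \<omega>)\<^sup>2)"
proof -
  obtain c where c: "(cmod c)\<^sup>2 = 1 / real (kappa P)" "\<forall>u\<in>S. normalized P (eigvec 0 0) u = c"
    using normalized_zero_eigvec[OF card_S_pos eigval_0_0] by blast
  have cc: "c * cnj c = of_real (1 / real (kappa P))"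
    using complex_norm_square[of c] c(1) by simp
  have "inner_on S (apply_on S (arc_matrix P (line_weight2 0 \<omega>)) (eigvec 0 0)) (eigvec 0 0) =
      (\<Sum>a\<in>arcs (oriented Q). of_real ((tau_oriented P V0 a \<bullet> \<omega>)\<^sup>2) * (c * cnj c))"
    unfolding arc_matrix_form by (rule sum.cong) (auto simp: c(2) line_weight2_def)
  also have "\<dots> = of_real (\<Sum>a\<in>arcs (oriented Q). (tau_oriented P V0 a \<bullet> \<omega>)\<^sup>2 * (1 / real (kappa P)))"
    unfolding cc of_real_mult[symmetric] of_real_sum ..
  also have "(\<Sum>a\<in>arcs (oriented Q). (tau_oriented P V0 a \<bullet> \<omega>)\<^sup>2 * (1 / real (kappa P))) =
      2 / real (kappa P) * (\<Sum>x\<in>A. (tau P V0 x \<bullet> \<omega>)\<^sup>2)"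
    unfolding sum_oriented sum_distrib_left
    by (rule sum.cong) (auto simp: tau_oriented_def)
  also have "(\<Sum>x\<in>A. (tau P V0 x \<bullet> \<omega>)\<^sup>2) = (\<Sum>x\<in>bridges P V0. (tau P V0 x \<bullet> \<omega>)\<^sup>2)"
    using finite_quotient_arcs by (intro sum.mono_neutral_right) (auto simp: bridges_def)
  finally have 1: "Re (inner_on S (apply_on S (arc_matrix P (line_weight2 0 \<omega>)) (eigvec 0 0)) (eigvec 0 0)) =
      2 / real (kappa P) * (\<Sum>x\<in>bridges P V0. (tau P V0 x \<bullet> \<omega>)\<^sup>2)"
    by simp
  have "(\<Sum>j\<in>{..<card S} - {0}. (cmod (inner_on S (apply_on S (arc_matrix P (line_weight1 0 \<omega>)) (eigvec 0 0)) (eigvec 0 j)))\<^sup>2 /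
        (eigval 0 0 - eigval 0 j)) \<le> 0"
    using eigval_bounds(1) by (intro sum_nonpos divide_nonneg_nonpos) (auto simp: eigval_0_0)
  then show ?thesis unfolding curvature_def 1 by simp
qed

text \<open>
  The inequality of \<open>bridge_energy\<close> for the lowest eigenvector at \<open>t \<omega>\<close>, divided by \<open>t\<^sup>2\<close>, in the limit
  \<open>t \<rightarrow> 0\<close>. The eigenvector is scaled as in \<open>simple_eigenpair_derivative\<close>, so that it converges to the
  lowest eigenvector at the origin.
\<close>

lemma curvature_0_bridge:
  assumes x: "x \<in> bridges P V0"
  shows "(tau P V0 x \<bullet> \<omega>)\<^sup>2 / real (kappa P) \<le> real (card S) * (curvature 0 0 \<omega> / 2)"
proof -
  let ?e = "\<lambda>t. eigvec (t *\<^sub>R \<omega>) 0"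
  define f where "f t u = ?e t u / inner_on S (?e t) (?e 0)" for t u
  note der = simple_eigenpair_derivative[of S "\<lambda>t. floquet (t *\<^sub>R \<omega>)" "\<lambda>t. eigval (t *\<^sub>R \<omega>)"
        "\<lambda>t. eigvec (t *\<^sub>R \<omega>)" 0 0,
      OF finite_quotient_verts floquet_hermitian eigenbasis_floquet card_S_pos]
  have simple: "eigval (0 *\<^sub>R \<omega>) j \<noteq> eigval (0 *\<^sub>R \<omega>) 0" if "j < card S" "j \<noteq> 0" for j
    using simple_at_0 that by (simp add: simple_at_def)
  have fl: "((\<lambda>t. floquet (t *\<^sub>R \<omega>) u v) has_vector_derivative arc_matrix P (line_weight1 (0 *\<^sub>R \<omega>) \<omega>) u v) (at 0)" for u v
    using floquet_line_derivative[of 0 \<omega> u v 0] by simp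
  have f0: "f 0 = eigvec 0 0"
    using eigenbasisD(3)[OF eigenbasis_floquet card_S_pos card_S_pos, of 0] by (simp add: f_def fun_eq_iff)
  have flim: "((\<lambda>t. f t u) \<longlongrightarrow> eigvec 0 0 u) (at 0)" if "u \<in> S" for u
    using has_vector_derivative_continuous[OF der(2)[OF simple fl that]] f0
    unfolding f_def[symmetric] isCont_def by simp
  obtain c where c: "(cmod c)\<^sup>2 = 1 / real (kappa P)" "\<forall>u\<in>S. normalized P (eigvec 0 0) u = c"
    using normalized_zero_eigvec[OF card_S_pos eigval_0_0] by blast
  have xA: "tail Q x \<in> S" using x by (auto simp: bridges_def)
  have ph: "phase (t *\<^sub>R \<omega>) (x, True) = exp (\<i> * of_real ((tau P V0 x \<bullet> \<omega>) * t))" for t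
    by (simp add: phase_def tau_oriented_def mult.commute)
  \<comment> \<open>Both sides of the inequality of \<open>bridge_energy\<close>, divided by \<open>t\<^sup>2\<close>.\<close>
  have lim1: "((\<lambda>t. (cmod (1 - phase (t *\<^sub>R \<omega>) (x, True)))\<^sup>2 / t\<^sup>2 * (cmod (normalized P (f t) (tail Q x)))\<^sup>2) \<longlongrightarrow>
      (tau P V0 x \<bullet> \<omega>)\<^sup>2 * (cmod (normalized P (eigvec 0 0) (tail Q x)))\<^sup>2) (at 0)"
    unfolding ph normalized_def divide_inverse[of _ "complex_of_real _"]
    by (intro tendsto_mult phase_quotient_tendsto tendsto_power tendsto_norm flim xA tendsto_const)
  have lim2: "((\<lambda>t. real (card S) * (eigval (t *\<^sub>R \<omega>) 0 / t\<^sup>2 * (\<Sum>u\<in>S. (cmod (f t u))\<^sup>2))) \<longlongrightarrow>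
      real (card S) * (curvature 0 0 \<omega> / 2 * (\<Sum>u\<in>S. (cmod (eigvec 0 0 u))\<^sup>2))) (at 0)"
    by (intro tendsto_mult eigval_line_quotient tendsto_power tendsto_norm flim tendsto_const tendsto_sum)
  have "\<forall>\<^sub>F t in at 0. (cmod (1 - phase (t *\<^sub>R \<omega>) (x, True)))\<^sup>2 / t\<^sup>2 * (cmod (normalized P (f t) (tail Q x)))\<^sup>2 \<le>
      real (card S) * (eigval (t *\<^sub>R \<omega>) 0 / t\<^sup>2 * (\<Sum>u\<in>S. (cmod (f t u))\<^sup>2))"
  proof (intro always_eventually allI)
    fix t
    have "energy (t *\<^sub>R \<omega>) (f t) = eigval (t *\<^sub>R \<omega>) 0 * (\<Sum>u\<in>S. (cmod (f t u))\<^sup>2)"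
    proof (rule energy_eigenvector)
      fix u assume u: "u \<in> S"
      have ft: "f t = (\<lambda>u. (1 / inner_on S (?e t) (?e 0)) * ?e t u)" by (simp add: f_def fun_eq_iff)
      show "apply_on S (floquet (t *\<^sub>R \<omega>)) (f t) u = of_real (eigval (t *\<^sub>R \<omega>) 0) * f t u"
        unfolding ft apply_on_scale using eigenbasisD(2)[OF eigenbasis_floquet card_S_pos u] by simp
    qed
    then have "(cmod (1 - phase (t *\<^sub>R \<omega>) (x, True)))\<^sup>2 * (cmod (normalized P (f t) (tail Q x)))\<^sup>2 / t\<^sup>2 \<le>
        real (card S) * (eigval (t *\<^sub>R \<omega>) 0 * (\<Sum>u\<in>S. (cmod (f t u))\<^sup>2)) / t\<^sup>2"
      using bridge_energy[OF x, of "t *\<^sub>R \<omega>" "f t"] by (intro divide_right_mono) auto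
    then show "(cmod (1 - phase (t *\<^sub>R \<omega>) (x, True)))\<^sup>2 / t\<^sup>2 * (cmod (normalized P (f t) (tail Q x)))\<^sup>2 \<le>
      real (card S) * (eigval (t *\<^sub>R \<omega>) 0 / t\<^sup>2 * (\<Sum>u\<in>S. (cmod (f t u))\<^sup>2))" by simp
  qed
  from tendsto_le[OF _ lim2 lim1 this] show ?thesis
    using c xA eigvec_norm[OF card_S_pos, of 0] by simp
qed

lemma T0_injective:
  assumes b: "bridge_basis P V0 b" and "T0 P V0 b *v x = 0"
  shows "x = 0"
proof -
  let ?R = "range (\<lambda>i. tau P V0 (b i))"
  have ind: "independent ?R" and inj: "inj (\<lambda>i. tau P V0 (b i))"
    using b by (auto simp: bridge_basis_def)
  have "card ?R = CARD('d)" using inj by (rule card_image)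
  then have "UNIV \<subseteq> span ?R" by (intro card_ge_dim_independent ind) (auto simp: dim_UNIV)
  moreover have "orthogonal x y" if "y \<in> ?R" for y
    using that assms(2) by (auto simp: orthogonal_def T0_def vec_eq_iff matrix_vector_mult_def inner_vec_def mult.commute)
  ultimately have "orthogonal x x" by (intro orthogonal_to_span[of x ?R]) auto
  then show ?thesis by (simp add: orthogonal_self)
qed

lemma T0_gram: "x \<bullet> ((transpose (T0 P V0 b) ** T0 P V0 b) *v x) = (\<Sum>i\<in>UNIV. (tau P V0 (b i) \<bullet> x)\<^sup>2)"
proof -
  have "x \<bullet> ((transpose (T0 P V0 b) ** T0 P V0 b) *v x) = (T0 P V0 b *v x) \<bullet> (T0 P V0 b *v x)"
    by (simp add: matrix_vector_mul_assoc[symmetric] dot_lmul_matrix[symmetric] transpose_matrix_vector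
        inner_commute)
  also have "\<dots> = (\<Sum>i\<in>UNIV. (tau P V0 (b i) \<bullet> x)\<^sup>2)"
    by (simp add: inner_vec_def[of "_ *v _"] T0_def matrix_vector_mult_def power2_eq_square)
      (simp add: inner_vec_def)
  finally show ?thesis .
qed

lemma T0_gram_symmetric: "transpose (transpose (T0 P V0 b) ** T0 P V0 b) = transpose (T0 P V0 b) ** T0 P V0 b"
  by (simp add: matrix_transpose_mul)

lemma Lambda0_pos:
  assumes b: "bridge_basis P V0 b"
  shows "0 < Lambda0 P V0 b"
proof -
  let ?M = "transpose (T0 P V0 b) ** T0 P V0 b"
  have "Lambda0 P V0 b \<in> eigenvalues ?M"
    unfolding Lambda0_def by (rule Min_eigenvalues_le(1)[OF T0_gram_symmetric])
  then obtain x where x: "x \<noteq> 0" "?M *v x = Lambda0 P V0 b *s x" by (auto simp: eigenvalues_def)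
  have "Lambda0 P V0 b * (x \<bullet> x) = (\<Sum>i\<in>UNIV. (tau P V0 (b i) \<bullet> x)\<^sup>2)"
    unfolding T0_gram[symmetric] x(2) by (simp add: scalar_mult_eq_scaleR)
  moreover have "0 < (\<Sum>i\<in>UNIV. (tau P V0 (b i) \<bullet> x)\<^sup>2)"
  proof (rule ccontr)
    assume "\<not> ?thesis"
    then have "(\<Sum>i\<in>UNIV. (tau P V0 (b i) \<bullet> x)\<^sup>2) = 0" by (meson antisym_conv1 not_le sum_nonneg zero_le_power2)
    then have "\<forall>i. tau P V0 (b i) \<bullet> x = 0" by (simp add: sum_nonneg_eq_0_iff)
    then have "T0 P V0 b *v x = 0" by (simp add: T0_def vec_eq_iff matrix_vector_mult_def inner_vec_def)
    then show False using T0_injective[OF b] x(1) by blast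
  qed
  ultimately show ?thesis using x(1) by (metis inner_ge_zero not_less zero_less_mult_pos2 inner_gt_zero_iff)
qed

lemma Lambda0_le:
  assumes "norm \<omega> = 1"
  shows "Lambda0 P V0 b \<le> (\<Sum>i\<in>UNIV. (tau P V0 (b i) \<bullet> \<omega>)\<^sup>2)"
  using Min_eigenvalues_le(2)[OF T0_gram_symmetric, of b \<omega>] assms
  by (simp add: T0_gram Lambda0_def norm_eq_1)

lemma Lambda1_ge:
  assumes "norm \<omega> = 1"
  shows "(\<Sum>x\<in>bridges P V0. (tau P V0 x \<bullet> \<omega>)\<^sup>2) \<le> Lambda1 P V0"
proof -
  let ?M = "T1_transpose_T1 P V0"
  have sym: "transpose ?M = ?M" by (simp add: T1_transpose_T1_def transpose_def vec_eq_iff mult.commute)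
  have "\<omega> \<bullet> (?M *v \<omega>) = (\<Sum>k\<in>UNIV. \<Sum>l\<in>UNIV. \<Sum>x\<in>bridges P V0. (tau P V0 x $ k * \<omega> $ k) * (tau P V0 x $ l * \<omega> $ l))"
    by (simp add: inner_vec_def matrix_vector_mult_def T1_transpose_T1_def T1_def sum_distrib_left sum_distrib_right mult_ac)
  also have "\<dots> = (\<Sum>x\<in>bridges P V0. \<Sum>k\<in>UNIV. \<Sum>l\<in>UNIV. (tau P V0 x $ k * \<omega> $ k) * (tau P V0 x $ l * \<omega> $ l))"
    by (subst sum.swap[of _ "bridges P V0"], subst sum.swap[of _ "bridges P V0"]) (rule refl)
  also have "\<dots> = (\<Sum>x\<in>bridges P V0. (tau P V0 x \<bullet> \<omega>)\<^sup>2)"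
    by (simp add: power2_eq_square inner_vec_def sum_product)
  finally show ?thesis
    using Max_eigenvalues_ge[OF sym, of \<omega>] assms by (simp add: Lambda1_def norm_eq_1)
qed

lemma curvature_0_lower:
  assumes b: "bridge_basis P V0 b" and \<omega>: "norm \<omega> = 1"
  shows "2 * Lambda0 P V0 b / (real (kappa P) * real (nu P) * real CARD('d)) \<le> curvature 0 0 \<omega>"
proof -
  have "Lambda0 P V0 b / real (kappa P) \<le> (\<Sum>i\<in>(UNIV::'d set). (tau P V0 (b i) \<bullet> \<omega>)\<^sup>2 / real (kappa P))"
    using Lambda0_le[OF \<omega>, of b] kappa_pos by (simp add: sum_divide_distrib[symmetric] divide_right_mono)
  also have "\<dots> \<le> (\<Sum>i\<in>(UNIV::'d set). real (card S) * (curvature 0 0 \<omega> / 2))"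
    using b by (intro sum_mono curvature_0_bridge) (auto simp: bridge_basis_def)
  also have "\<dots> = real CARD('d) * real (nu P) * (curvature 0 0 \<omega> / 2)" by (simp add: nu_def)
  finally have "Lambda0 P V0 b / real (kappa P) \<le> real CARD('d) * real (nu P) * (curvature 0 0 \<omega> / 2)" .
  then show ?thesis using kappa_pos card_S_pos by (simp add: nu_def field_simps)
qed

lemma Lambda0_bound_pos:
  "bridge_basis P V0 b \<Longrightarrow> 0 < 2 * Lambda0 P V0 b / (real (kappa P) * real (nu P) * real CARD('d))"
  using Lambda0_pos[of b] kappa_pos card_S_pos by (simp add: nu_def)

text \<open>
  By positive curvature the lowest eigenvalue is positive at some \<open>t \<omega>\<close>, where \<open>0\<close> is therefore not an
  eigenvalue at all.
\<close>

lemma flat_mult_0: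
  assumes b: "bridge_basis P V0 b"
  shows "flat_mult P V0 0 = 0"
proof -
  define \<omega> :: "real ^ 'd" where "\<omega> = axis undefined 1"
  have \<omega>: "norm \<omega> = 1" by (simp add: \<omega>_def)
  have "0 < curvature 0 0 \<omega> / 2" using Lambda0_bound_pos[OF b] curvature_0_lower[OF b \<omega>] by linarith
  from order_tendstoD(1)[OF eigval_line_quotient this]
  have "\<exists>t. 0 < eigval (t *\<^sub>R \<omega>) 0 / t\<^sup>2" by (meson eventually_happens trivial_limit_at)
  then obtain t where "0 < eigval (t *\<^sub>R \<omega>) 0" by (auto simp: zero_less_divide_iff)
  then have pos: "0 < eigval (t *\<^sub>R \<omega>) j" if "j < card S" for j
    using eigenbasisD(4)[OF eigenbasis_floquet, of 0 j "t *\<^sub>R \<omega>"] that by simp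
  have "{j. j < card S \<and> eigval (t *\<^sub>R \<omega>) j = 0} = {}" using pos by force
  then have "discrete_mult P V0 (t *\<^sub>R \<omega>) 0 = 0" by (simp add: discrete_mult_eq)
  then show ?thesis using flat_mult_le[of 0 "t *\<^sub>R \<omega>"] by simp
qed

text \<open>
  As \<open>0\<close> is a simple eigenvalue at the origin and is not flat, it is the smallest element of the list
  that remains when the flat eigenvalues are removed.
\<close>

lemma first_band:
  assumes b: "bridge_basis P V0 b"
  shows "1 \<in> {1..nu P - flat_count P V0}" "band P V0 1 0 = eigval 0 0"
proof -
  let ?M = "mset_of_mult (discrete_mult P V0 0)"
  have notin: "eigval 0 0 \<notin># flat_part"
    using flat_mult_0[OF b] by (metis count_flat count_eq_zero_iff eigval_0_0)
  have "flat_part \<noteq> ?M" using notin card_S_pos unfolding spectrum_eq by auto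
  then have "size flat_part < size ?M"
    using flat_part_subset by (intro mset_subset_size) (simp add: subset_mset.less_le)
  then have sz: "size flat_part < card S" by (simp add: size_spectrum)
  then show "1 \<in> {1..nu P - flat_count P V0}" by (simp add: nu_def flat_count_def)
  have gt: "eigval 0 0 < eigval 0 j" if "0 < j" "j < card S" for j
    using simple_at_0 eigval_bounds(1)[OF that(2), of 0] that by (auto simp: simple_at_def eigval_0_0)
  have "filter_mset (\<lambda>y. y < eigval 0 0) flat_part = {#}"
  proof -
    have "0 \<le> y" if "y \<in># flat_part" for y
    proof -
      have "y \<in># ?M" using that flat_part_subset by (rule mset_subset_eqD[rotated])
      then show ?thesis using eigval_bounds(1) unfolding spectrum_eq by auto
    qed
    then have "filter_mset (\<lambda>y. y < eigval 0 0) flat_part = filter_mset (\<lambda>_. False) flat_part"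
      by (intro filter_mset_cong refl) (auto simp: eigval_0_0 not_less)
    then show ?thesis by simp
  qed
  then have "sorted_list_of_multiset (?M - flat_part) ! 0 = eigval 0 0"
    using remaining_simple_eigenvalue_rank[OF spectrum_eq flat_part_subset _ card_S_pos _ gt notin, of 0] sz
    by simp
  then show "band P V0 1 0 = eigval 0 0" by (simp add: band_def)
qed

text \<open>
  The second derivative of the matrix is quadratic in \<open>\<omega>\<close>, and the correction consists of squared moduli
  of expressions that are linear in \<open>\<omega>\<close>, with coefficients that do not depend on \<open>\<omega>\<close>.
\<close>

lemma curvature_quadratic: "quadratic_form (curvature \<theta> k)"
proof -
  have inner_as_sum: "inner_on S (apply_on S (arc_matrix P (line_weight1 \<theta> \<omega>)) f) h =
     (\<Sum>a\<in>arcs (oriented Q). (- \<i> * phase \<theta> a * normalized P f (tgt a) *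
        cnj (normalized P h (src a))) * of_real (tau_oriented P V0 a \<bullet> \<omega>))" for \<omega> f h
    unfolding arc_matrix_form by (rule sum.cong) (auto simp: line_weight1_def mult_ac)
  have Re_as_sum: "Re (inner_on S (apply_on S (arc_matrix P (line_weight2 \<theta> \<omega>)) f) f) =
     (\<Sum>a\<in>arcs (oriented Q). Re (phase \<theta> a * normalized P f (tgt a) *
        cnj (normalized P f (src a))) * (tau_oriented P V0 a \<bullet> \<omega>)\<^sup>2)" for \<omega> f
    unfolding arc_matrix_form Re_sum
  proof (rule sum.cong[OF refl])
    fix a
    have Re_scale: "Re (complex_of_real r * w) = Re w * r" for r w by simp
    have "line_weight2 \<theta> \<omega> a * normalized P f (tgt a) * cnj (normalized P f (src a)) =
      of_real ((tau_oriented P V0 a \<bullet> \<omega>)\<^sup>2) * (phase \<theta> a * normalized P f (tgt a) *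
        cnj (normalized P f (src a)))"
      by (simp add: line_weight2_def mult_ac)
    then show "Re (line_weight2 \<theta> \<omega> a * normalized P f (tgt a) * cnj (normalized P f (src a))) =
      Re (phase \<theta> a * normalized P f (tgt a) *
        cnj (normalized P f (src a))) * (tau_oriented P V0 a \<bullet> \<omega>)\<^sup>2"
      by (simp only: Re_scale)
  qed
  show ?thesis
    unfolding curvature_def[abs_def] inner_as_sum Re_as_sum divide_inverse mult.commute[of "_\<^sup>2" "inverse _"]
    by (intro quadratic_form_add quadratic_form_scale quadratic_form_sum quadratic_form_cmod_square
        quadratic_form_square)
qed

text \<open>
  Near \<open>\<lambda> = 0\<close> the metric eigenvalue is \<open>arccos (1 - \<lambda>)\<^sup>2 \<approx> 2 \<lambda>\<close>, so the effective form doubles; with the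
  factor \<open>1/2\<close> in its definition it equals the curvature of the discrete eigenvalue.
\<close>

theorem effective_form_at_bottom:
  assumes b: "bridge_basis P V0 b"
  shows "nondegenerate_form (effective_form (metric_band P V0 1 0) 0) \<and>
        (\<forall>\<omega>. norm \<omega> = 1 \<longrightarrow>
           effective_form_exists (metric_band P V0 1 0) 0 \<omega> \<and>
           effective_form_exists (band P V0 1) 0 \<omega> \<and>
           0 < 2 * Lambda0 P V0 b / (real (kappa P) * real (nu P) * real CARD('d)) \<and>
           2 * Lambda0 P V0 b / (real (kappa P) * real (nu P) * real CARD('d))
             \<le> effective_form (metric_band P V0 1 0) 0 \<omega> \<and>
           effective_form (metric_band P V0 1 0) 0 \<omega> = 2 * effective_form (band P V0 1) 0 \<omega> \<and>
           2 * effective_form (band P V0 1) 0 \<omega>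
             \<le> 2 / real (kappa P) * (\<Sum>x\<in>bridges P V0. (tau P V0 x \<bullet> \<omega>)\<^sup>2) \<and>
           2 / real (kappa P) * (\<Sum>x\<in>bridges P V0. (tau P V0 x \<bullet> \<omega>)\<^sup>2)
             \<le> 2 * Lambda1 P V0 / real (kappa P))"
proof -
  have flat: "flat_mult P V0 (eigval 0 0) = 0" using flat_mult_0[OF b] by (simp add: eigval_0_0)
  have g: "second_deriv (\<lambda>t. band P V0 1 (0 + t *\<^sub>R \<omega>)) 0 0 (curvature 0 0 \<omega>)" for \<omega>
    using band_second_deriv[OF first_band(1)[OF b] simple_at_0 flat first_band(2)[OF b], of \<omega>]
    by (simp add: slope_0)
  have pos: "0 < curvature 0 0 \<omega>" if "norm \<omega> = 1" for \<omega>
    using Lambda0_bound_pos[OF b] curvature_0_lower[OF b that] by linarith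
  have h: "second_deriv (\<lambda>t. metric_band P V0 1 0 (0 + t *\<^sub>R \<omega>)) 0 0 (2 * curvature 0 0 \<omega>)"
    if "norm \<omega> = 1" for \<omega>
    using second_deriv_arccos_square[OF g _ pos[OF that]] first_band(2)[OF b]
    by (simp add: metric_band_momentum momentum_def eigval_0_0)
  have em: "effective_form (metric_band P V0 1 0) 0 \<omega> = curvature 0 0 \<omega>" if "norm \<omega> = 1" for \<omega>
    using effective_form_of_second_deriv(2)[OF h[OF that]] by simp
  have ed: "effective_form (band P V0 1) 0 \<omega> = curvature 0 0 \<omega> / 2" for \<omega>
    by (rule effective_form_of_second_deriv(2)[OF g])
  have nd: "nondegenerate_form (effective_form (metric_band P V0 1 0) 0)"
  proof (rule positive_quadratic_form_nondegenerate[OF curvature_quadratic em])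
    fix \<omega> :: "real ^ 'd" assume "norm \<omega> = 1"
    then show "0 < effective_form (metric_band P V0 1 0) 0 \<omega>" by (simp only: em pos)
  qed
  have upper: "2 / real (kappa P) * (\<Sum>x\<in>bridges P V0. (tau P V0 x \<bullet> \<omega>)\<^sup>2) \<le> 2 * Lambda1 P V0 / real (kappa P)"
    if "norm \<omega> = 1" for \<omega>
    using Lambda1_ge[OF that] kappa_pos by (simp add: divide_right_mono)
  show ?thesis
  proof (intro conjI allI impI nd)
    fix \<omega> :: "real ^ 'd" assume \<omega>: "norm \<omega> = 1"
    show "effective_form_exists (metric_band P V0 1 0) 0 \<omega>"
      by (rule effective_form_of_second_deriv(1)[OF h[OF \<omega>]])
    show "effective_form_exists (band P V0 1) 0 \<omega>"
      by (rule effective_form_of_second_deriv(1)[OF g])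
    show "0 < 2 * Lambda0 P V0 b / (real (kappa P) * real (nu P) * real CARD('d))"
      by (rule Lambda0_bound_pos[OF b])
    show "2 * Lambda0 P V0 b / (real (kappa P) * real (nu P) * real CARD('d))
        \<le> effective_form (metric_band P V0 1 0) 0 \<omega>"
      unfolding em[OF \<omega>] by (rule curvature_0_lower[OF b \<omega>])
    show "effective_form (metric_band P V0 1 0) 0 \<omega> = 2 * effective_form (band P V0 1) 0 \<omega>"
      unfolding em[OF \<omega>] ed by linarith
    show "2 * effective_form (band P V0 1) 0 \<omega>
        \<le> 2 / real (kappa P) * (\<Sum>x\<in>bridges P V0. (tau P V0 x \<bullet> \<omega>)\<^sup>2)"
      unfolding ed using curvature_0_upper[of \<omega>] by linarith
    show "2 / real (kappa P) * (\<Sum>x\<in>bridges P V0. (tau P V0 x \<bullet> \<omega>)\<^sup>2)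
        \<le> 2 * Lambda1 P V0 / real (kappa P)"
      by (rule upper[OF \<omega>])
  qed
qed

end

section \<open>Effective forms of the metric and the discrete Laplacian\<close>

theorem theorem3p1:
  fixes P :: "('v, 'e, 'd::finite) zd_graph"
    and T :: "('v, 'e) pre_digraph"
  defines "V0 \<equiv> verts T"
  assumes "periodic_graph P"
    and "fundamental_tree P T"
  shows
    "(\<forall>n j \<theta>0.
        n \<in> {1..nu P - flat_count P V0} \<longrightarrow>
        local_min_at (metric_band P V0 n j) \<theta>0 \<or> local_max_at (metric_band P V0 n j) \<theta>0 \<longrightarrow>
        (\<forall>k::int. metric_band P V0 n j \<theta>0 \<noteq> (pi * of_int k)\<^sup>2) \<longrightarrow>
        simple_metric_eigenvalue P \<theta>0 (metric_band P V0 n j \<theta>0) \<longrightarrow>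
        (\<forall>\<omega>. norm \<omega> = 1 \<longrightarrow>
           effective_form_exists (metric_band P V0 n j) \<theta>0 \<omega> \<and>
           effective_form_exists (band P V0 n) \<theta>0 \<omega> \<and>
           effective_form (metric_band P V0 n j) \<theta>0 \<omega> =
             2 * sqrt (metric_band P V0 n j \<theta>0) / sin (sqrt (metric_band P V0 n j \<theta>0))
               * effective_form (band P V0 n) \<theta>0 \<omega>))
   \<and> (\<forall>b. bridge_basis P V0 b \<longrightarrow>
        nondegenerate_form (effective_form (metric_band P V0 1 0) 0) \<and>
        (\<forall>\<omega>. norm \<omega> = 1 \<longrightarrow>
           effective_form_exists (metric_band P V0 1 0) 0 \<omega> \<and>
           effective_form_exists (band P V0 1) 0 \<omega> \<and>
           0 < 2 * Lambda0 P V0 b / (real (kappa P) * real (nu P) * real CARD('d)) \<and>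
           2 * Lambda0 P V0 b / (real (kappa P) * real (nu P) * real CARD('d))
             \<le> effective_form (metric_band P V0 1 0) 0 \<omega> \<and>
           effective_form (metric_band P V0 1 0) 0 \<omega> = 2 * effective_form (band P V0 1) 0 \<omega> \<and>
           2 * effective_form (band P V0 1) 0 \<omega>
             \<le> 2 / real (kappa P) * (\<Sum>x\<in>bridges P V0. (tau P V0 x \<bullet> \<omega>)\<^sup>2) \<and>
           2 / real (kappa P) * (\<Sum>x\<in>bridges P V0. (tau P V0 x \<bullet> \<omega>)\<^sup>2)
             \<le> 2 * Lambda1 P V0 / real (kappa P)))"
proof -
  interpret periodic_graph_with_tree P T
    using assms(2,3) by (simp add: periodic_graph_with_tree_def periodic_graph_with_tree_axioms_def)
  show ?thesis
    unfolding V0_def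
    by (intro conjI allI impI effective_form_at_extremum[THEN conjunct1]
        effective_form_at_extremum[THEN conjunct2, THEN conjunct1]
        effective_form_at_extremum[THEN conjunct2, THEN conjunct2] effective_form_at_bottom)
      (simp_all add: effective_form_at_bottom)
qed

end
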